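(* Let $p\in(1,\infty)$. Let $\mathbb{S}:=\prod_{n\in\mathbb{N}}\mathbb{S}^{n-1}$, and let $\sigma$ be any Borel probability measure on $\mathbb{S}$ such that for every $n$ its $n$-th marginal (the image of $\sigma$ under $\theta=(\theta^{(1)},\theta^{(2)},\dots)\mapsto\theta^{(n)}$) is the rotationally invariant probability measure $\sigma_n$ on the unit sphere $\mathbb{S}^{n-1}\subset\mathbb{R}^n$. For each $n$ let $X^{(n,p)}$ be uniformly distributed on the unit $\ell^p$ ball $\mathbb{B}_{n,p}$ of $\mathbb{R}^n$, and for $\theta\in\mathbb{S}$ set $$W^{(n,p)}_\theta:=\frac{n^{1/p}}{n^{1/2}}\sum_{i=1}^nX^{(n,p)}_i\,\theta^{(n)}_i .$$ Then for $\sigma$-a.e. $\theta\in\mathbb{S}$, the sequence $(W^{(n,p)}_\theta)_{n\in\mathbb{N}}$ satisfies a large deviation principle (with speed $n$) with the quasiconvex, symmetric, good rate function $\mathbb{I}^{\mathsf{qu}}_{p,\mu_2}$.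
   Context: $\mathbb{B}_{n,p}=\{x\in\mathbb{R}^n:\sum_{i=1}^n|x_i|^p\le 1\}$. $\mu_p$ is the probability measure on $\mathbb{R}$ with density $f_p(y)=\frac{1}{2p^{1/p}\Gamma(1+1/p)}e^{-|y|^p/p}$; $\mu_2$ is standard Gaussian. For $p\in(1,\infty)$ and a probability measure $\nu$ on $\mathbb{R}$ define $$\Lambda_p(t_1,t_2)=\log\int_{\mathbb{R}}e^{t_1y+t_2|y|^p}\mu_p(dy),\qquad \Psi_{p,\nu}(t_1,t_2)=\int_{\mathbb{R}}\Lambda_p(t_1u,t_2)\,\nu(du),\quad t_1,t_2\in\mathbb{R},$$ $$\mathbb{I}^{\mathsf{qu}}_{p,\nu}(w)=\inf\{\Psi^*_{p,\nu}(\tau_1,\tau_2):\tau_1\in\mathbb{R},\ \tau_2>0,\ \tau_1\tau_2^{-1/p}=w\},\quad w\in\mathbb{R},$$ where $\Lambda^*(\tau)=\sup_t\{\langle t,\tau\rangle-\Lambda(t)\}$ denotes the Legendre transform. Large deviation principle (LDP): a sequence $(\xi_n)$ of random variables in a topological space $\Sigma$ satisfies an LDP with speed $s(n)$ and rate function $I:\Sigma\to[0,\infty]$ if $I$ is lower semi-continuous and for all Borel $\Gamma\subset\Sigma$, $-\inf_{\Gamma^\circ}I\le\liminf_n\frac{1}{s(n)}\log\mathbb{P}(\xi_n\in\Gamma^\circ)\le\limsup_n\frac1{s(n)}\log\mathbb{P}(\xi_n\in\bar\Gamma)\le-\inf_{\bar\Gamma}I$. $I$ is good if its level sets $\{I\le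 c\}$ are compact. A function $f:\mathbb{R}\to(-\infty,\infty]$ is quasiconvex if $\{f\le c\}$ is convex for all $c\in\mathbb{R}$, and symmetric if $f(-w)=f(w)$. *)

theory Defs
  imports "HOL-Probability.Probability"
begin

section \<open>Extended-real logarithm and integral\<close>

definition ln_ennreal :: "ennreal \<Rightarrow> ereal" where
  "ln_ennreal x = (if x = 0 then -\<infinity> else if x = \<infinity> then \<infinity> else ereal (ln (enn2real x)))"

text \<open>Integral of positive part minus integral of negative part; \<^const>\<open>e2ennreal\<close> maps
  negative arguments to 0. Below it is only used for integrands whose negative part is integrable,
  so the case \<open>\<infinity> - \<infinity>\<close> does not occur.\<close>

definition ereal_integral :: "'a measure \<Rightarrow> ('a \<Rightarrow> ereal) \<Rightarrow> ereal" where
  "ereal_integral M f =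
     enn2ereal (\<integral>\<^sup>+x. e2ennreal (f x) \<partial>M) - enn2ereal (\<integral>\<^sup>+x. e2ennreal (- f x) \<partial>M)"


section \<open>Large deviation principles\<close>

definition lower_semicontinuous :: "('a::topological_space \<Rightarrow> ereal) \<Rightarrow> bool" where
  "lower_semicontinuous I \<longleftrightarrow> (\<forall>c. closed {x. I x \<le> c})"

text \<open>The random variables \<open>\<xi> n\<close> may live on different probability spaces \<open>P n\<close>.\<close>

definition satisfies_LDP ::
  "(nat \<Rightarrow> 'a measure) \<Rightarrow> (nat \<Rightarrow> 'a \<Rightarrow> 'b::topological_space) \<Rightarrow> (nat \<Rightarrow> real) \<Rightarrow> ('b \<Rightarrow> ereal) \<Rightarrow> bool"
where
  "satisfies_LDP P \<xi> s I \<longleftrightarrow>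
     (\<forall>x. 0 \<le> I x) \<and> lower_semicontinuous I \<and>
     (\<forall>\<Gamma>\<in>sets borel.
        - (INF x\<in>interior \<Gamma>. I x)
          \<le> liminf (\<lambda>n. ereal (1 / s n) *
               ln_ennreal (emeasure (P n) (\<xi> n -` interior \<Gamma> \<inter> space (P n)))) \<and>
        liminf (\<lambda>n. ereal (1 / s n) *
               ln_ennreal (emeasure (P n) (\<xi> n -` interior \<Gamma> \<inter> space (P n))))
          \<le> limsup (\<lambda>n. ereal (1 / s n) *
               ln_ennreal (emeasure (P n) (\<xi> n -` closure \<Gamma> \<inter> space (P n)))) \<and>
        limsup (\<lambda>n. ereal (1 / s n) *
               ln_ennreal (emeasure (P n) (\<xi> n -` closure \<Gamma> \<inter> space (P n))))
          \<le> - (INF x\<in>closure \<Gamma>. I x))"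

definition good_rate_function :: "('a::topological_space \<Rightarrow> ereal) \<Rightarrow> bool" where
  "good_rate_function I \<longleftrightarrow> (\<forall>c::real. compact {x. I x \<le> ereal c})"

definition quasiconvex :: "(real \<Rightarrow> ereal) \<Rightarrow> bool" where
  "quasiconvex f \<longleftrightarrow> (\<forall>w. f w \<noteq> -\<infinity>) \<and> (\<forall>c::real. convex {w. f w \<le> ereal c})"

definition symmetric_fun :: "(real \<Rightarrow> ereal) \<Rightarrow> bool" where
  "symmetric_fun f \<longleftrightarrow> (\<forall>w. f (- w) = f w)"


section \<open>The rate function\<close>

definition mu :: "real \<Rightarrow> real measure" where
  "mu p = density lborel (\<lambda>y. ennreal
     (1 / (2 * p powr (1 / p) * Gamma (1 + 1 / p)) * exp (- (\<bar>y\<bar> powr p) / p)))"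

definition Lam :: "real \<Rightarrow> real \<Rightarrow> real \<Rightarrow> ereal" where
  "Lam p t1 t2 = ln_ennreal (\<integral>\<^sup>+y. ennreal (exp (t1 * y + t2 * \<bar>y\<bar> powr p)) \<partial>mu p)"

text \<open>For \<open>p > 1\<close>, Jensen's inequality gives \<open>Lam p t1 t2 \<ge> t2\<close>, so for a probability measure
  \<open>\<nu>\<close> the negative part of the integrand is bounded and \<open>Psi\<close> takes values in \<open>(-\<infinity>, \<infinity>]\<close>.\<close>

definition Psi :: "real \<Rightarrow> real measure \<Rightarrow> real \<Rightarrow> real \<Rightarrow> ereal" where
  "Psi p \<nu> t1 t2 = ereal_integral \<nu> (\<lambda>u. Lam p (t1 * u) t2)"

definition legendre2 :: "(real \<Rightarrow> real \<Rightarrow> ereal) \<Rightarrow> real \<Rightarrow> real \<Rightarrow> ereal" where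
  "legendre2 F \<tau>1 \<tau>2 = (SUP (t1, t2)\<in>UNIV. ereal (t1 * \<tau>1 + t2 * \<tau>2) - F t1 t2)"

definition I_qu :: "real \<Rightarrow> real measure \<Rightarrow> real \<Rightarrow> ereal" where
  "I_qu p \<nu> w =
     Inf {legendre2 (Psi p \<nu>) \<tau>1 \<tau>2 | \<tau>1 \<tau>2. \<tau>2 > 0 \<and> \<tau>1 * \<tau>2 powr (- (1 / p)) = w}"


section \<open>Spheres and the space of direction sequences\<close>

text \<open>The library's \<^const>\<open>nsphere\<close> \<open>(n - 1)\<close> is the unit sphere of \<open>\<real>\<^sup>n\<close>, where a vector
  is a function \<^typ>\<open>nat \<Rightarrow> real\<close> with coordinates \<open>0, \<dots>, n - 1\<close>, extended by 0.\<close>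

definition borel_of :: "'a topology \<Rightarrow> 'a measure" where
  "borel_of T = sigma (topspace T) {U. openin T U}"

definition sphere_product :: "(nat \<Rightarrow> nat \<Rightarrow> real) topology" where
  "sphere_product = product_topology (\<lambda>n. nsphere (n - 1)) {1..}"

definition orthogonal_array :: "nat \<Rightarrow> (nat \<Rightarrow> nat \<Rightarrow> real) \<Rightarrow> bool" where
  "orthogonal_array n A \<longleftrightarrow>
     (\<forall>i<n. \<forall>j<n. (\<Sum>k<n. A k i * A k j) = (if i = j then 1 else 0))"

definition apply_array :: "nat \<Rightarrow> (nat \<Rightarrow> nat \<Rightarrow> real) \<Rightarrow> (nat \<Rightarrow> real) \<Rightarrow> nat \<Rightarrow> real" where
  "apply_array n A x = (\<lambda>i. if i < n then \<Sum>j<n. A i j * x j else 0)"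

text \<open>For \<open>n \<ge> 1\<close>, exactly one measure has this property. Invariance is under the full orthogonal
  group: for \<open>n = 1\<close> invariance under proper rotations would say nothing, whereas here it forces
  the uniform measure on \<open>{-1, 1}\<close>.\<close>

definition rotation_invariant_prob :: "nat \<Rightarrow> (nat \<Rightarrow> real) measure \<Rightarrow> bool" where
  "rotation_invariant_prob n M \<longleftrightarrow>
     prob_space M \<and> sets M = sets (borel_of (nsphere (n - 1))) \<and>
     (\<forall>A. orthogonal_array n A \<longrightarrow> distr M M (apply_array n A) = M)"


section \<open>Uniform distribution on the unit ball and the projections\<close>

text \<open>Here \<open>\<real>\<^sup>n\<close> carries the product Lebesgue measure, so a vector is a function on \<open>{..<n}\<close>,
  extended by \<^const>\<open>undefined\<close>; only the coordinates below \<open>n\<close> enter \<open>W\<close>.\<close>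

definition lp_ball :: "nat \<Rightarrow> real \<Rightarrow> (nat \<Rightarrow> real) set" where
  "lp_ball n p = {x \<in> space (\<Pi>\<^sub>M i\<in>{..<n}. lborel). (\<Sum>i<n. \<bar>x i\<bar> powr p) \<le> 1}"

definition uniform_on_lp_ball ::
  "'a measure \<Rightarrow> nat \<Rightarrow> real \<Rightarrow> ('a \<Rightarrow> nat \<Rightarrow> real) \<Rightarrow> bool" where
  "uniform_on_lp_ball M n p Y \<longleftrightarrow>
     Y \<in> M \<rightarrow>\<^sub>M (\<Pi>\<^sub>M i\<in>{..<n}. lborel) \<and>
     distr M (\<Pi>\<^sub>M i\<in>{..<n}. lborel) Y = uniform_measure (\<Pi>\<^sub>M i\<in>{..<n}. lborel) (lp_ball n p)"

definition W :: "real \<Rightarrow> (nat \<Rightarrow> 'a \<Rightarrow> nat \<Rightarrow> real) \<Rightarrow> (nat \<Rightarrow> nat \<Rightarrow> real) \<Rightarrow> nat \<Rightarrow> 'a \<Rightarrow> real" where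
  "W p X \<theta> n \<omega> =
     real n powr (1 / p) / real n powr (1 / 2) * (\<Sum>i<n. X n \<omega> i * \<theta> n i)"

end

theory Submission
  imports Defs
begin

text \<open>Write \<open>K(x) = ln \<integral> cosh(x y) exp(-\<bar>y\<bar>\<^sup>p) dy\<close> and \<open>H(x) = \<integral> K(x u) \<mu>\<^sub>2(du)\<close>. With \<open>t\<^sub>2 = 1/p - s\<close>, substitution
  in the inner integral turns \<open>\<Psi>(t, t\<^sub>2)\<close> into \<open>-(1/p) ln s + H(t s\<^sup>-\<^sup>1\<^sup>/\<^sup>p)\<close> up to a constant, so everything
  depends on the single function \<open>H\<close>, and scaling shows that the infimum defining the rate function is the
  value \<open>\<Psi>\<^sup>*(w, 1)\<close>: a supremum of affine functions of \<open>w\<close>.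

  For fixed directions, exponential tilting of Lebesgue measure on the \<open>\<ell>\<^sup>p\<close> ball by
  \<open>exp(n (t W - s \<parallel>x\<parallel>\<^sup>p))\<close> factorises over the coordinates. Chernoff's bound gives the upper bound; for the
  lower bound one tilts by a minimiser \<open>(t, s)\<close>, where differentiability of \<open>H\<close> makes the complement of a
  neighbourhood of \<open>(w, 1)\<close> negligible. Both need only \<open>1/n \<Sum> K(x \<surd>n \<theta>\<^sub>i) \<longrightarrow> H(x)\<close> for all \<open>x\<close>.

  As the joint law of the directions for different \<open>n\<close> is arbitrary, this convergence requires summable tail
  bounds. These come from fourth moments of i.i.d. Gaussians, since a rotation-invariant direction is
  distributed like a normalised Gaussian vector and \<open>K\<close> is monotone in \<open>\<bar>x\<bar>\<close>.\<close>

section \<open>The logarithmic moment generating function\<close>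

text \<open>\<open>log_mgf\<close> depends on x only through \<bar>x\<bar> and increases with it.
  This monotonicity replaces equicontinuity twice: in passing from rational x to all x, and from
  approximate to exact normalisation of a Gaussian vector.

  The obstacle is the lower bound. Differentiating H under the integral is avoided: at a minimiser
  of \<open>objective\<close> a supporting line is known, so a small second difference is enough to
  identify the derivative. A minimiser is obtained only at 0 and at points whose modulus is strictly
  below that of a point of finite rate; other points of an open set are shrunk slightly towards 0,
  which cannot raise the rate. The tilted measure concentrates where \<open>lp_sum\<close> is near
  1, on both sides of the boundary of the ball, so the resulting shell has to be contracted into the
  ball at an arbitrarily small exponential rate.

  All volumes carry the same factor n to the power -n/p, visible as the term
  \<open>(1 / p) * ln (real n)\<close>; it cancels in quotients of volumes.\<close>

definition cosh_mgf :: "real \<Rightarrow> real \<Rightarrow> real" where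
  "cosh_mgf p x = (\<integral>y. cosh (x * y) * exp (- (\<bar>y\<bar> powr p)) \<partial>lborel)"

definition log_mgf :: "real \<Rightarrow> real \<Rightarrow> real" where
  "log_mgf p x = ln (cosh_mgf p x)"

definition avg_log_mgf :: "real \<Rightarrow> real \<Rightarrow> real" where
  "avg_log_mgf p x = (\<integral>u. log_mgf p (x * u) \<partial>mu 2)"

lemma has_bochner_integral_exp_neg_abs:
  "has_bochner_integral lborel (\<lambda>y::real. exp (- \<bar>y\<bar>)) 2"
proof -
  have "(\<integral>\<^sup>+y. ennreal (indicator {0..} (y::real) *\<^sub>R exp (- \<bar>y\<bar>)) \<partial>lborel)
      = (\<integral>\<^sup>+y. ennreal (y ^ 0 * exp (- y)) * indicator {0..} y \<partial>lborel)"
    by (intro nn_integral_cong) (simp split: split_indicator)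
  also have "\<dots> = ennreal 1" by (subst nn_intergal_power_times_exp_Ici) simp
  finally have "has_bochner_integral lborel (\<lambda>x::real. indicator {0..} x *\<^sub>R exp (- \<bar>x\<bar>)) 1"
    by (intro has_bochner_integral_nn_integral) (auto split: split_indicator)
  from has_bochner_integral_even_function[OF this] show ?thesis by simp
qed

text \<open>The radius R with R^(p-1) = (c+1)/b is where \<open>b * \<bar>y\<bar> powr p\<close>
  overtakes \<open>(c + 1) * \<bar>y\<bar>\<close>: beyond it the power wins, inside it the power is
  dropped. The extra 1 leaves \<open>- \<bar>y\<bar>\<close> over, hence an integrable exponential,
  and the explicit R later controls the growth in x.\<close>

lemma linear_minus_powr_le:
  fixes p b c y :: real
  assumes "1 < p" "0 < b" "0 \<le> c"
  shows "c * \<bar>y\<bar> - b * \<bar>y\<bar> powr p \<le> (c + 1) * ((c + 1) / b) powr (1 / (p - 1)) - \<bar>y\<bar>"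
proof -
  define R where "R = ((c + 1) / b) powr (1 / (p - 1))"
  have R: "R > 0" using assms by (simp add: R_def)
  have Rp: "R powr (p - 1) = (c + 1) / b" using assms by (simp add: R_def powr_powr)
  show ?thesis
  proof (cases "\<bar>y\<bar> \<le> R")
    case True
    then have "(c + 1) * \<bar>y\<bar> \<le> (c + 1) * R" using assms by (intro mult_left_mono) auto
    moreover have "0 \<le> b * \<bar>y\<bar> powr p" using assms by simp
    ultimately show ?thesis unfolding R_def[symmetric] by (simp add: algebra_simps)
  next
    case False
    then have y: "\<bar>y\<bar> > 0" using R by linarith
    have "(c + 1) / b \<le> \<bar>y\<bar> powr (p - 1)"
      unfolding Rp[symmetric] using False R assms by (intro powr_mono2) auto
    then have "c + 1 \<le> b * \<bar>y\<bar> powr (p - 1)" using assms by (simp add: field_simps)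
    then have "(c + 1) * \<bar>y\<bar> \<le> b * \<bar>y\<bar> powr (p - 1) * \<bar>y\<bar>" by (intro mult_right_mono) auto
    also have "\<dots> = b * \<bar>y\<bar> powr p" using y powr_add[of "\<bar>y\<bar>" "p - 1" 1] by simp
    finally have "(c + 1) * \<bar>y\<bar> \<le> b * \<bar>y\<bar> powr p" .
    moreover have "0 \<le> (c + 1) * R" using assms R by simp
    ultimately show ?thesis unfolding R_def[symmetric] by (simp add: algebra_simps)
  qed
qed

lemma integrable_exp_abs_minus_powr:
  fixes p b c :: real
  assumes "1 < p" "0 < b"
  shows "integrable lborel (\<lambda>y. exp (c * \<bar>y\<bar>) * exp (- (b * \<bar>y\<bar> powr p)))"
proof (rule Bochner_Integration.integrable_bound)
  let ?R = "(\<bar>c\<bar> + 1) * ((\<bar>c\<bar> + 1) / b) powr (1 / (p - 1))"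
  show "integrable lborel (\<lambda>y::real. exp ?R * exp (- \<bar>y\<bar>))"
    using has_bochner_integral_exp_neg_abs by (intro integrable_mult_right) (auto simp: has_bochner_integral_iff)
  have "c * \<bar>y\<bar> - b * \<bar>y\<bar> powr p \<le> ?R - \<bar>y\<bar>" for y
  proof -
    have "c * \<bar>y\<bar> \<le> \<bar>c\<bar> * \<bar>y\<bar>" by (intro mult_right_mono) auto
    with linear_minus_powr_le[OF assms, of "\<bar>c\<bar>" y] show ?thesis by simp
  qed
  then show "AE y in lborel. norm (exp (c * \<bar>y\<bar>) * exp (- (b * \<bar>y\<bar> powr p))) \<le> norm (exp ?R * exp (- \<bar>y\<bar>))"
    by (auto simp: exp_add[symmetric])
qed measurable

lemma cosh_le_exp_abs: "cosh x \<le> exp \<bar>x\<bar>" for x :: real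
  by (cases "x \<ge> 0") (auto simp: cosh_def field_simps)

lemma cosh_abs_mono: "\<bar>x\<bar> \<le> \<bar>y\<bar> \<Longrightarrow> cosh x \<le> cosh (y::real)"
  using cosh_real_nonneg_le_iff[of "\<bar>x\<bar>" "\<bar>y\<bar>"] by simp

lemma borel_measurable_cosh [measurable]: "(cosh :: real \<Rightarrow> real) \<in> borel_measurable borel"
  by (intro borel_measurable_continuous_onI continuous_intros)

context
  fixes p :: real
  assumes p: "1 < p"
begin

lemma integrable_cosh_mgf: "integrable lborel (\<lambda>y. cosh (x * y) * exp (- (\<bar>y\<bar> powr p)))"
proof (rule Bochner_Integration.integrable_bound)
  show "integrable lborel (\<lambda>y. exp (\<bar>x\<bar> * \<bar>y\<bar>) * exp (- (1 * \<bar>y\<bar> powr p)))"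
    using p by (intro integrable_exp_abs_minus_powr) auto
  show "AE y in lborel. norm (cosh (x * y) * exp (- (\<bar>y\<bar> powr p))) \<le> norm (exp (\<bar>x\<bar> * \<bar>y\<bar>) * exp (- (1 * \<bar>y\<bar> powr p)))"
    using cosh_le_exp_abs[of "x * _"] by (auto simp: abs_mult)
qed measurable

lemma cosh_mgf_mono: "\<bar>x\<bar> \<le> \<bar>x'\<bar> \<Longrightarrow> cosh_mgf p x \<le> cosh_mgf p x'"
  unfolding cosh_mgf_def using integrable_cosh_mgf
  by (intro integral_mono) (auto intro!: cosh_abs_mono simp: abs_mult mult_right_mono)

lemma cosh_mgf_0_pos: "0 < cosh_mgf p 0"
proof -
  have "0 \<le> cosh_mgf p 0" unfolding cosh_mgf_def by (intro integral_nonneg_AE) auto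
  moreover have "cosh_mgf p 0 \<noteq> 0"
  proof
    assume "cosh_mgf p 0 = 0"
    then have "AE y in lborel. exp (- (\<bar>y\<bar> powr p)) = 0"
      unfolding cosh_mgf_def using integrable_cosh_mgf[of 0]
      by (subst (asm) integral_nonneg_eq_0_iff_AE) auto
    then have "AE y::real in lborel. False" by simp
    then show False
      by (simp add: eventually_False ae_filter_eq_bot_iff)
  qed
  ultimately show ?thesis by simp
qed

lemma cosh_mgf_pos: "0 < cosh_mgf p x"
  using cosh_mgf_0_pos cosh_mgf_mono[of 0 x] by simp

lemma cosh_mgf_minus [simp]: "cosh_mgf p (- x) = cosh_mgf p x"
  by (simp add: cosh_mgf_def)

lemma cosh_mgf_le: "cosh_mgf p x \<le> 2 * exp ((\<bar>x\<bar> + 1) * (\<bar>x\<bar> + 1) powr (1 / (p - 1)))"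
proof -
  let ?R = "(\<bar>x\<bar> + 1) * (\<bar>x\<bar> + 1) powr (1 / (p - 1))"
  have "cosh_mgf p x \<le> (\<integral>y. exp ?R * exp (- \<bar>y\<bar>) \<partial>lborel)"
    unfolding cosh_mgf_def
  proof (rule integral_mono)
    fix y :: real
    have "cosh (x * y) * exp (- (\<bar>y\<bar> powr p)) \<le> exp (\<bar>x\<bar> * \<bar>y\<bar>) * exp (- (\<bar>y\<bar> powr p))"
      using cosh_le_exp_abs[of "x * y"] by (simp add: abs_mult)
    also have "\<dots> \<le> exp ?R * exp (- \<bar>y\<bar>)"
      using linear_minus_powr_le[OF p, of 1 "\<bar>x\<bar>" y] by (simp add: exp_add[symmetric])
    finally show "cosh (x * y) * exp (- (\<bar>y\<bar> powr p)) \<le> exp ?R * exp (- \<bar>y\<bar>)" .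
  qed (use has_bochner_integral_exp_neg_abs integrable_cosh_mgf in \<open>auto simp: has_bochner_integral_iff\<close>)
  also have "\<dots> = 2 * exp ?R" using has_bochner_integral_exp_neg_abs by (simp add: has_bochner_integral_iff)
  finally show ?thesis .
qed

lemma continuous_cosh_mgf: "continuous_on UNIV (cosh_mgf p)"
  unfolding continuous_on_sequentially comp_def
proof safe
  fix f :: "nat \<Rightarrow> real" and a assume f: "f \<longlonglongrightarrow> a"
  then obtain B where B: "\<And>n. \<bar>f n\<bar> \<le> B"
    using convergent_imp_Bseq[OF convergentI[OF f]] by (metis BseqE real_norm_def)
  show "(\<lambda>n. cosh_mgf p (f n)) \<longlonglongrightarrow> cosh_mgf p a"
    unfolding cosh_mgf_def
  proof (rule integral_dominated_convergence[OF _ _ integrable_cosh_mgf[of B]])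
    show "AE y in lborel. (\<lambda>n. cosh (f n * y) * exp (- (\<bar>y\<bar> powr p))) \<longlonglongrightarrow> cosh (a * y) * exp (- (\<bar>y\<bar> powr p))"
      using f by (auto intro!: tendsto_intros)
    show "AE y in lborel. norm (cosh (f n * y) * exp (- (\<bar>y\<bar> powr p))) \<le> cosh (B * y) * exp (- (\<bar>y\<bar> powr p))" for n
      using B[of n] by (auto intro!: AE_I2 mult_right_mono cosh_abs_mono simp: abs_mult)
  qed measurable
qed

lemma log_mgf_mono: "\<bar>x\<bar> \<le> \<bar>x'\<bar> \<Longrightarrow> log_mgf p x \<le> log_mgf p x'"
  using cosh_mgf_mono cosh_mgf_pos by (simp add: log_mgf_def)

lemma log_mgf_minus [simp]: "log_mgf p (- x) = log_mgf p x"
  by (simp add: log_mgf_def)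

lemma exp_log_mgf: "exp (log_mgf p x) = cosh_mgf p x"
  using cosh_mgf_pos by (simp add: log_mgf_def)

lemma continuous_log_mgf: "continuous_on A (log_mgf p)"
proof -
  have "continuous_on UNIV (log_mgf p)"
    unfolding log_mgf_def using cosh_mgf_pos less_imp_neq[OF cosh_mgf_pos]
    by (intro continuous_on_ln continuous_cosh_mgf) (metis less_irrefl)
  then show ?thesis by (rule continuous_on_subset) simp
qed

lemma borel_measurable_log_mgf [measurable]: "log_mgf p \<in> borel_measurable borel"
  by (intro borel_measurable_continuous_onI continuous_log_mgf)

text \<open>By \<open>cosh_mgf_le\<close> the growth is at most that of the conjugate power 1 +
  1/(p-1) = p/(p-1). The coarser exponential majorant is what a Gaussian integrates, also after
  taking fourth powers.\<close>

lemma log_mgf_growth: "\<exists>B\<ge>0. \<forall>x. \<bar>log_mgf p x\<bar> \<le> B * exp \<bar>x\<bar>"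
proof -
  \<comment> \<open>An integer exponent, so that the power is at most m! times the exponential, of
    which it is one series term.\<close>
  define m where "m = nat \<lceil>1 / (p - 1)\<rceil> + 1"
  have m: "1 + 1 / (p - 1) \<le> real m" unfolding m_def by linarith
  define C where "C = fact m * exp (1::real)"
  have up: "log_mgf p x \<le> (ln 2 + C) * exp \<bar>x\<bar>" for x
  proof -
    have "log_mgf p x \<le> ln 2 + (\<bar>x\<bar> + 1) * (\<bar>x\<bar> + 1) powr (1 / (p - 1))"
      using ln_mono[OF cosh_mgf_le cosh_mgf_pos, of x] by (simp add: log_mgf_def ln_mult)
    also have "(\<bar>x\<bar> + 1) * (\<bar>x\<bar> + 1) powr (1 / (p - 1)) = (\<bar>x\<bar> + 1) powr (1 + 1 / (p - 1))"
      by (simp add: powr_add)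
    also have "\<dots> \<le> (\<bar>x\<bar> + 1) powr real m" using m by (intro powr_mono) auto
    also have "\<dots> = (\<bar>x\<bar> + 1) ^ m" by (simp add: powr_realpow)
    also have "(\<bar>x\<bar> + 1) ^ m \<le> fact m * exp (\<bar>x\<bar> + 1)"
    proof -
      have "(\<bar>x\<bar> + 1) ^ m / fact m \<le> exp (\<bar>x\<bar> + 1)"
        using sum_le_suminf[OF summable_exp_generic[of "\<bar>x\<bar> + 1"], of "{m}"]
        by (simp add: exp_def field_simps)
      then show ?thesis by (simp add: field_simps)
    qed
    also have "\<dots> = C * exp \<bar>x\<bar>" by (simp add: C_def exp_add)
    also have "ln 2 \<le> ln 2 * exp \<bar>x\<bar>" using mult_left_mono[of 1 "exp \<bar>x\<bar>" "ln 2"] by simp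
    finally show ?thesis by (simp add: algebra_simps)
  qed
  have C: "0 \<le> C" by (simp add: C_def)
  have "\<bar>log_mgf p x\<bar> \<le> (ln 2 + C + \<bar>log_mgf p 0\<bar>) * exp \<bar>x\<bar>" for x
  proof -
    have "log_mgf p 0 \<le> log_mgf p x" by (intro log_mgf_mono) simp
    then have "\<bar>log_mgf p x\<bar> \<le> max (\<bar>log_mgf p 0\<bar>) ((ln 2 + C) * exp \<bar>x\<bar>)" using up[of x] by linarith
    also have "\<dots> \<le> \<bar>log_mgf p 0\<bar> * exp \<bar>x\<bar> + (ln 2 + C) * exp \<bar>x\<bar>"
    proof -
      have "\<bar>log_mgf p 0\<bar> \<le> \<bar>log_mgf p 0\<bar> * exp \<bar>x\<bar>" using mult_left_mono[of 1 "exp \<bar>x\<bar>" "\<bar>log_mgf p 0\<bar>"] by simp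
      moreover have "0 \<le> (ln 2 + C) * exp \<bar>x\<bar>" "0 \<le> \<bar>log_mgf p 0\<bar> * exp \<bar>x\<bar>" using C by auto
      ultimately show ?thesis by linarith
    qed
    finally show ?thesis by (simp add: algebra_simps)
  qed
  moreover have "0 \<le> ln 2 + C + \<bar>log_mgf p 0\<bar>" using C by simp
  ultimately show ?thesis by blast
qed

end

section \<open>Averaging over a Gaussian\<close>

lemma mu_2_eq: "mu 2 = density lborel (\<lambda>x. ennreal (std_normal_density x))"
proof -
  \<comment> \<open>The recursion for Gamma needs its argument to avoid the poles; it gives
    Gamma(3/2) = sqrt(pi)/2, which turns the normaliser for p = 2 into sqrt(2 pi).\<close>
  have "(1 / 2 :: real) \<notin> \<int>\<^sub>\<le>\<^sub>0" by (auto dest: nonpos_Ints_nonpos)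
  from Gamma_plus1[OF this] have "Gamma (1 + 1 / 2 :: real) = sqrt pi / 2"
    by (simp add: Gamma_one_half_real add.commute)
  then have "2 * 2 powr (1 / 2) * Gamma (1 + 1 / 2 :: real) = sqrt (2 * pi)"
    by (simp add: powr_half_sqrt real_sqrt_mult)
  then show ?thesis
    unfolding mu_def std_normal_density_def by (intro arg_cong2[where f = density]) (auto simp: fun_eq_iff)
qed

lemma prob_space_mu_2: "prob_space (mu 2)"
  unfolding mu_2_eq by (rule prob_space_normal_density) simp

lemma sets_mu [measurable_cong, simp]: "sets (mu p) = sets borel"
  and space_mu [simp]: "space (mu p) = UNIV"
  by (simp_all add: mu_def)

lemma integrable_mu_2_exp_abs: "integrable (mu 2) (\<lambda>u. exp (c * \<bar>u\<bar>))"
proof -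
  have "integrable lborel (\<lambda>u. 1 / sqrt (2 * pi) * (exp (c * \<bar>u\<bar>) * exp (- (1 / 2 * \<bar>u\<bar> powr 2))))"
    by (intro integrable_mult_right integrable_exp_abs_minus_powr) auto
  then show ?thesis
    unfolding mu_2_eq by (subst integrable_density) (auto simp: std_normal_density_def mult_ac)
qed

lemma integrable_mu_2_exp_bound:
  fixes f :: "real \<Rightarrow> real"
  assumes "f \<in> borel_measurable borel" "\<And>u. \<bar>f u\<bar> \<le> B * exp (c * \<bar>u\<bar>)"
  shows "integrable (mu 2) f"
proof (rule Bochner_Integration.integrable_bound)
  show "integrable (mu 2) (\<lambda>u. B * exp (c * \<bar>u\<bar>))"
    by (intro integrable_mult_right integrable_mu_2_exp_abs)
  show "AE u in mu 2. norm (f u) \<le> norm (B * exp (c * \<bar>u\<bar>))"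
    using assms(2) by (auto intro!: order.trans[OF _ abs_ge_self])
qed (use assms(1) in simp)

section \<open>Second differences of the averaged logarithm\<close>

lemma cosh_minus_1_le: "\<bar>h\<bar> \<le> 1 \<Longrightarrow> cosh (h * z) - 1 \<le> h\<^sup>2 * (cosh z - 1)" for h z :: real
proof -
  assume h: "\<bar>h\<bar> \<le> 1"
  let ?a = "\<lambda>n. if even n then z ^ n /\<^sub>R fact n else 0"
  have "?a sums cosh z" by (rule cosh_converges)
  from sums_diff[OF sums_mult[OF this, of "h\<^sup>2"] sums_mult[OF sums_single[of 0 "\<lambda>_. 1::real"], of "h\<^sup>2"]]
  have r: "(\<lambda>n. h\<^sup>2 * ?a n - h\<^sup>2 * (if n = 0 then 1 else 0)) sums (h\<^sup>2 * (cosh z - 1))"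
    by (simp add: right_diff_distrib)
  have l: "(\<lambda>n. (if even n then (h * z) ^ n /\<^sub>R fact n else 0) - (if n = 0 then 1 else 0)) sums (cosh (h * z) - 1)"
    using sums_diff[OF cosh_converges[of "h * z"] sums_single[of 0 "\<lambda>_. 1::real"]] by simp
  \<comment> \<open>Termwise comparison of power series: odd terms vanish, the constant terms
    cancel, and for even n \<ge> 2 the power h^n is at most h^2.\<close>
  show ?thesis
  proof (rule sums_le[OF _ l r])
    fix n :: nat
    show "(if even n then (h * z) ^ n /\<^sub>R fact n else 0) - (if n = 0 then 1 else 0)
        \<le> h\<^sup>2 * ?a n - h\<^sup>2 * (if n = 0 then 1 else 0)"
    proof (cases "even n \<and> n \<noteq> 0")
      case True
      then have n: "even n" "2 \<le> n" by (auto elim!: evenE)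
      have "h ^ n = \<bar>h\<bar> ^ n" using n by (simp add: power_even_abs)
      also have "\<dots> \<le> \<bar>h\<bar> ^ 2" using h n by (intro power_decreasing) auto
      finally have "h ^ n * z ^ n \<le> h\<^sup>2 * z ^ n" using n by (intro mult_right_mono) auto
      then show ?thesis using n by (simp add: power_mult_distrib divide_simps)
    qed auto
  qed
qed

lemma exp_convex_bound: "0 \<le> h \<Longrightarrow> h \<le> 1 \<Longrightarrow> exp (h * a) \<le> 1 - h + h * exp (a::real)"
  using convex_onD[OF exp_convex, of h 0 a] by simp

text \<open>The logarithm of the tilted mean of \<open>cosh (k y)\<close>: it dominates half the second difference
  of \<open>log_mgf\<close> and obeys an integrable bound linear in \<open>k\<close>.\<close>

definition sym_excess :: "real \<Rightarrow> real \<Rightarrow> real \<Rightarrow> real" where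
  "sym_excess p v k = ln ((cosh_mgf p (v + k) + cosh_mgf p (v - k)) / 2) - ln (cosh_mgf p v)"

context
  fixes p :: real
  assumes p: "1 < p"
begin

lemma integrable_log_mgf_mu_2: "integrable (mu 2) (\<lambda>u. log_mgf p (x * u))"
proof -
  obtain B where B: "B \<ge> 0" "\<And>x. \<bar>log_mgf p x\<bar> \<le> B * exp \<bar>x\<bar>"
    using log_mgf_growth[OF p] by blast
  show ?thesis
    using B(2)[of "x * _"] borel_measurable_log_mgf[OF p]
    by (intro integrable_mu_2_exp_bound[of _ B "\<bar>x\<bar>"]) (auto simp: abs_mult)
qed

lemma integrable_log_mgf_power4_mu_2: "integrable (mu 2) (\<lambda>u. (log_mgf p (x * u)) ^ 4)"
proof -
  obtain B where B: "B \<ge> 0" "\<And>x. \<bar>log_mgf p x\<bar> \<le> B * exp \<bar>x\<bar>"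
    using log_mgf_growth[OF p] by blast
  have "\<bar>(log_mgf p (x * u)) ^ 4\<bar> \<le> B ^ 4 * exp ((4 * \<bar>x\<bar>) * \<bar>u\<bar>)" for u
  proof -
    have "\<bar>log_mgf p (x * u)\<bar> ^ 4 \<le> (B * exp \<bar>x * u\<bar>) ^ 4"
      by (intro power_mono B) auto
    also have "\<dots> = B ^ 4 * exp ((4 * \<bar>x\<bar>) * \<bar>u\<bar>)"
      by (simp add: power_mult_distrib exp_of_nat_mult[symmetric] abs_mult mult_ac)
    finally show ?thesis by (simp add: power_abs)
  qed
  then show ?thesis
    using borel_measurable_log_mgf[OF p] by (intro integrable_mu_2_exp_bound) auto
qed

lemma avg_log_mgf_mono: "\<bar>x\<bar> \<le> \<bar>x'\<bar> \<Longrightarrow> avg_log_mgf p x \<le> avg_log_mgf p x'"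
  unfolding avg_log_mgf_def using integrable_log_mgf_mu_2
  by (intro integral_mono log_mgf_mono[OF p]) (auto simp: abs_mult mult_right_mono)

lemma avg_log_mgf_minus [simp]: "avg_log_mgf p (- x) = avg_log_mgf p x"
  by (simp add: avg_log_mgf_def log_mgf_minus[OF p])

lemma avg_log_mgf_0: "avg_log_mgf p 0 = log_mgf p 0"
  using prob_space.prob_space[OF prob_space_mu_2] by (simp add: avg_log_mgf_def)

lemma continuous_avg_log_mgf: "continuous_on A (avg_log_mgf p)"
proof -
  have "continuous_on UNIV (avg_log_mgf p)"
    unfolding continuous_on_sequentially comp_def
  proof safe
    fix f :: "nat \<Rightarrow> real" and a assume f: "f \<longlonglongrightarrow> a"
    then obtain B where B: "\<And>n. \<bar>f n\<bar> \<le> B"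
      using convergent_imp_Bseq[OF convergentI[OF f]] by (metis BseqE real_norm_def)
    show "(\<lambda>n. avg_log_mgf p (f n)) \<longlonglongrightarrow> avg_log_mgf p a"
      unfolding avg_log_mgf_def
    proof (rule integral_dominated_convergence)
      show "integrable (mu 2) (\<lambda>u. \<bar>log_mgf p 0\<bar> + \<bar>log_mgf p (B * u)\<bar>)"
        using integrable_log_mgf_mu_2[of 0] integrable_log_mgf_mu_2[of B] by auto
      show "AE u in mu 2. (\<lambda>n. log_mgf p (f n * u)) \<longlonglongrightarrow> log_mgf p (a * u)"
        using f continuous_log_mgf[OF p, of UNIV]
        by (intro AE_I2 continuous_on_tendsto_compose[of UNIV "log_mgf p"]) (auto intro!: tendsto_intros)
      show "AE u in mu 2. norm (log_mgf p (f n * u)) \<le> \<bar>log_mgf p 0\<bar> + \<bar>log_mgf p (B * u)\<bar>" for n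
      proof (intro AE_I2)
        fix u
        have "\<bar>f n * u\<bar> \<le> \<bar>B * u\<bar>" using B[of n] by (auto simp: abs_mult intro!: mult_right_mono)
        then have "log_mgf p 0 \<le> log_mgf p (f n * u)" "log_mgf p (f n * u) \<le> log_mgf p (B * u)"
          by (auto intro!: log_mgf_mono[OF p])
        then show "norm (log_mgf p (f n * u)) \<le> \<bar>log_mgf p 0\<bar> + \<bar>log_mgf p (B * u)\<bar>" by auto
      qed
    qed (use borel_measurable_log_mgf[OF p] in measurable)
  qed
  then show ?thesis by (rule continuous_on_subset) simp
qed

text \<open>The inequality of arithmetic and geometric means, applied to the values at v + k and v -
  k.\<close>

lemma log_mgf_second_difference: "log_mgf p (v + k) + log_mgf p (v - k) - 2 * log_mgf p v \<le> 2 * sym_excess p v k"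
proof -
  let ?a = "cosh_mgf p (v + k)" and ?b = "cosh_mgf p (v - k)"
  have ab: "0 < ?a" "0 < ?b" using cosh_mgf_pos[OF p] by auto
  have "?a * ?b \<le> ((?a + ?b) / 2)\<^sup>2"
    using sum_squares_bound[of ?a ?b] by (simp add: power2_eq_square field_simps)
  then have "ln (?a * ?b) \<le> ln (((?a + ?b) / 2)\<^sup>2)" using ab by (intro ln_mono) auto
  then show ?thesis using ab
    by (simp add: log_mgf_def sym_excess_def ln_mult ln_realpow)
qed

text \<open>The addition formulas turn the average over v + k and v - k into an integral of cosh(k
  y) against the unnormalised weight tilted by v.\<close>

lemma cosh_mgf_average:
  "(cosh_mgf p (v + k) + cosh_mgf p (v - k)) / 2 = (\<integral>y. cosh (k * y) * (cosh (v * y) * exp (- (\<bar>y\<bar> powr p))) \<partial>lborel)"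
  and integrable_cosh_mgf_average: "integrable lborel (\<lambda>y. cosh (k * y) * (cosh (v * y) * exp (- (\<bar>y\<bar> powr p))))"
proof -
  have eq: "cosh (k * y) * (cosh (v * y) * exp (- (\<bar>y\<bar> powr p))) =
     1/2 * (cosh ((v + k) * y) * exp (- (\<bar>y\<bar> powr p)) + cosh ((v - k) * y) * exp (- (\<bar>y\<bar> powr p)))" for y
    by (simp add: cosh_add cosh_diff algebra_simps)
  show "integrable lborel (\<lambda>y. cosh (k * y) * (cosh (v * y) * exp (- (\<bar>y\<bar> powr p))))"
    unfolding eq using integrable_cosh_mgf[OF p] by simp
  show "(cosh_mgf p (v + k) + cosh_mgf p (v - k)) / 2 = (\<integral>y. cosh (k * y) * (cosh (v * y) * exp (- (\<bar>y\<bar> powr p))) \<partial>lborel)"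
    unfolding eq cosh_mgf_def using integrable_cosh_mgf[OF p] by simp
qed

lemma sym_excess_nonneg: "0 \<le> sym_excess p v k"
proof -
  have "cosh_mgf p v \<le> (cosh_mgf p (v + k) + cosh_mgf p (v - k)) / 2"
    unfolding cosh_mgf_average unfolding cosh_mgf_def
    using integrable_cosh_mgf[OF p] integrable_cosh_mgf_average cosh_real_ge_1
    by (intro integral_mono) auto
  from ln_mono[OF this cosh_mgf_pos[OF p]] show ?thesis by (simp add: sym_excess_def)
qed

text \<open>Combines ln z \<le> z - 1 with \<open>cosh_minus_1_le\<close>. For fixed u this gives
  the pointwise limit of the difference quotient; the dominating function comes from
  \<open>sym_excess_linear\<close> instead.\<close>

lemma sym_excess_quadratic:
  assumes "\<bar>h\<bar> \<le> 1"
  shows "sym_excess p v (h * u) \<le> h\<^sup>2 * (((cosh_mgf p (v + u) + cosh_mgf p (v - u)) / 2 - cosh_mgf p v) / cosh_mgf p v)"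
proof -
  let ?w = "\<lambda>y. cosh (v * y) * exp (- (\<bar>y\<bar> powr p))"
  let ?G = "\<lambda>k. (cosh_mgf p (v + k) + cosh_mgf p (v - k)) / 2"
  have E: "0 < cosh_mgf p v" by (rule cosh_mgf_pos[OF p])
  have G: "0 < ?G k" for k using cosh_mgf_pos[OF p] by (simp add: add_pos_pos)
  have "?G (h * u) - cosh_mgf p v = (\<integral>y. (cosh (h * (u * y)) - 1) * ?w y \<partial>lborel)"
    unfolding cosh_mgf_average unfolding cosh_mgf_def
    using integrable_cosh_mgf[OF p, of v] integrable_cosh_mgf_average[of "h * u" v]
    by (simp add: left_diff_distrib mult.assoc)
  also have "\<dots> \<le> (\<integral>y. h\<^sup>2 * ((cosh (u * y) - 1) * ?w y) \<partial>lborel)"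
  proof (rule integral_mono)
    show "integrable lborel (\<lambda>y. (cosh (h * (u * y)) - 1) * ?w y)"
      using integrable_cosh_mgf[OF p, of v] integrable_cosh_mgf_average[of "h * u" v]
      by (simp add: left_diff_distrib mult.assoc)
    show "integrable lborel (\<lambda>y. h\<^sup>2 * ((cosh (u * y) - 1) * ?w y))"
      using integrable_cosh_mgf[OF p, of v] integrable_cosh_mgf_average[of u v]
      by (simp add: left_diff_distrib mult.assoc)
    fix y
    show "(cosh (h * (u * y)) - 1) * ?w y \<le> h\<^sup>2 * ((cosh (u * y) - 1) * ?w y)"
      unfolding mult.assoc[of "h\<^sup>2", symmetric] by (intro mult_right_mono cosh_minus_1_le assms) auto
  qed
  also have "\<dots> = h\<^sup>2 * (?G u - cosh_mgf p v)"
    unfolding cosh_mgf_average unfolding cosh_mgf_def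
    using integrable_cosh_mgf[OF p, of v] integrable_cosh_mgf_average[of u v]
    by (simp add: left_diff_distrib mult.assoc)
  finally have *: "?G (h * u) - cosh_mgf p v \<le> h\<^sup>2 * (?G u - cosh_mgf p v)" .
  have "sym_excess p v (h * u) = ln (?G (h * u) / cosh_mgf p v)"
    using E G[of "h * u"] by (simp add: sym_excess_def ln_div ln_mult)
  also have "\<dots> \<le> ?G (h * u) / cosh_mgf p v - 1" using E G[of "h * u"] by (intro ln_le_minus_one) simp
  also have "\<dots> = (?G (h * u) - cosh_mgf p v) / cosh_mgf p v" using E by (simp add: field_simps)
  also have "\<dots> \<le> (h\<^sup>2 * (?G u - cosh_mgf p v)) / cosh_mgf p v" using E * by (intro divide_right_mono) auto
  finally show ?thesis by simp
qed

text \<open>The factor h is pulled out of the exponent by convexity of the exponential, as in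
  Hoelder's inequality. The result is linear in the logarithm, not in \<open>cosh_mgf\<close>
  itself, which keeps it integrable over u.\<close>

lemma sym_excess_linear:
  assumes h: "0 \<le> h" "h \<le> 1"
  shows "sym_excess p v (h * u) \<le> h * (ln 2 + sym_excess p v u)"
proof -
  let ?w = "\<lambda>y. cosh (v * y) * exp (- (\<bar>y\<bar> powr p))"
  let ?G = "\<lambda>k. (cosh_mgf p (v + k) + cosh_mgf p (v - k)) / 2"
  have E: "0 < cosh_mgf p v" by (rule cosh_mgf_pos[OF p])
  have G: "0 < ?G k" for k using cosh_mgf_pos[OF p] by (simp add: add_pos_pos)
  \<comment> \<open>Chosen so that 2 exp(-L) times the average at u equals
    \<open>cosh_mgf p v\<close>; integrating the convex combination then gives total weight (1 - h)
    + h = 1. The summand ln 2 pays for exp \<bar>z\<bar> \<le> 2 cosh z.\<close>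
  define L where "L = ln 2 + sym_excess p v u"
  have eL: "exp L = 2 * ?G u / cosh_mgf p v"
    using E G[of u] by (simp add: L_def sym_excess_def exp_add exp_diff)
  have pw: "cosh (h * u * y) * ?w y \<le> exp (h * L) * ((1 - h) * ?w y + 2 * h * exp (- L) * (cosh (u * y) * ?w y))" for y
  proof -
    have "cosh (h * u * y) \<le> exp \<bar>h * u * y\<bar>" by (rule cosh_le_exp_abs)
    also have "\<dots> = exp (h * L) * exp (h * (\<bar>u * y\<bar> - L))"
      using h by (simp add: exp_add[symmetric] abs_mult algebra_simps)
    also have "\<dots> \<le> exp (h * L) * (1 - h + h * exp (\<bar>u * y\<bar> - L))"
      using h by (intro mult_left_mono exp_convex_bound) auto
    also have "exp (\<bar>u * y\<bar> - L) \<le> exp (- L) * (2 * cosh (u * y))"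
    proof -
      have "exp \<bar>u * y\<bar> \<le> 2 * cosh (u * y)" by (cases "u * y \<ge> 0") (auto simp: cosh_def)
      then show ?thesis by (simp add: exp_diff exp_minus field_simps)
    qed
    finally have "cosh (h * u * y) \<le> exp (h * L) * (1 - h + h * (exp (- L) * (2 * cosh (u * y))))"
      using h by (simp add: mult_left_mono)
    from mult_right_mono[OF this, of "?w y"] show ?thesis by (simp add: algebra_simps)
  qed
  have "?G (h * u) \<le> (\<integral>y. exp (h * L) * ((1 - h) * ?w y + 2 * h * exp (- L) * (cosh (u * y) * ?w y)) \<partial>lborel)"
    unfolding cosh_mgf_average using integrable_cosh_mgf[OF p, of v] integrable_cosh_mgf_average
    by (intro integral_mono pw) auto
  also have "\<dots> = exp (h * L) * ((1 - h) * cosh_mgf p v + 2 * h * exp (- L) * ?G u)"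
    unfolding cosh_mgf_average unfolding cosh_mgf_def
    using integrable_cosh_mgf[OF p, of v] integrable_cosh_mgf_average[of u v] by simp
  also have "2 * h * exp (- L) * ?G u = h * cosh_mgf p v"
    unfolding exp_minus eL using E G[of u] cosh_mgf_pos[OF p, of "v + u"] cosh_mgf_pos[OF p, of "v - u"]
    by (simp add: field_simps)
  finally have *: "?G (h * u) \<le> exp (h * L) * cosh_mgf p v" by (simp add: algebra_simps)
  have "ln (?G (h * u)) \<le> h * L + ln (cosh_mgf p v)"
    using ln_mono[OF * G] E by (simp add: ln_mult)
  then show ?thesis by (simp add: sym_excess_def L_def)
qed

text \<open>Both arguments x u + u and x u - u are at most (\<bar>x\<bar> + 1) \<bar>u\<bar> in
  modulus, and the subtracted logarithm is smallest at 0. What remains is a single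
  \<open>log_mgf\<close>, integrable over a Gaussian u.\<close>

lemma sym_excess_le: "sym_excess p (x * u) u \<le> log_mgf p ((\<bar>x\<bar> + 1) * u) - log_mgf p 0"
proof -
  have "\<bar>x * u\<bar> + \<bar>u\<bar> \<le> \<bar>(\<bar>x\<bar> + 1) * u\<bar>" by (simp add: abs_mult algebra_simps)
  then have "\<bar>x * u + u\<bar> \<le> \<bar>(\<bar>x\<bar> + 1) * u\<bar>" "\<bar>x * u - u\<bar> \<le> \<bar>(\<bar>x\<bar> + 1) * u\<bar>" by linarith+
  from this[THEN cosh_mgf_mono[OF p]]
  have "(cosh_mgf p (x * u + u) + cosh_mgf p (x * u - u)) / 2 \<le> cosh_mgf p ((\<bar>x\<bar> + 1) * u)" by simp
  from ln_mono[OF this] cosh_mgf_pos[OF p, of "x * u + u"] cosh_mgf_pos[OF p, of "x * u - u"]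
    log_mgf_mono[OF p, of 0 "x * u"]
  show ?thesis by (simp add: sym_excess_def log_mgf_def)
qed

lemma borel_measurable_cosh_mgf [measurable]: "cosh_mgf p \<in> borel_measurable borel"
  by (intro borel_measurable_continuous_onI continuous_cosh_mgf[OF p])

lemma borel_measurable_sym_excess [measurable]: "(\<lambda>u. sym_excess p (x * u) (h * u)) \<in> borel_measurable borel"
  unfolding sym_excess_def by measurable

lemma integrable_sym_excess:
  assumes "0 \<le> h" "h \<le> 1" shows "integrable (mu 2) (\<lambda>u. sym_excess p (x * u) (h * u))"
proof (rule Bochner_Integration.integrable_bound)
  interpret prob_space "mu 2" by (rule prob_space_mu_2)
  show "integrable (mu 2) (\<lambda>u. ln 2 + (log_mgf p ((\<bar>x\<bar> + 1) * u) - log_mgf p 0))"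
    using integrable_log_mgf_mu_2 by simp
  show "AE u in mu 2. norm (sym_excess p (x * u) (h * u)) \<le> norm (ln 2 + (log_mgf p ((\<bar>x\<bar> + 1) * u) - log_mgf p 0))"
  proof (intro AE_I2)
    fix u
    have "sym_excess p (x * u) (h * u) \<le> h * (ln 2 + sym_excess p (x * u) u)" by (rule sym_excess_linear[OF assms])
    also have "\<dots> \<le> 1 * (ln 2 + sym_excess p (x * u) u)"
      using assms sym_excess_nonneg[of "x * u" u] by (intro mult_right_mono) auto
    finally show "norm (sym_excess p (x * u) (h * u)) \<le> norm (ln 2 + (log_mgf p ((\<bar>x\<bar> + 1) * u) - log_mgf p 0))"
      using sym_excess_nonneg[of "x * u" "h * u"] sym_excess_le[of x u] by simp
  qed
qed measurable

text \<open>Dominated convergence: \<open>sym_excess_quadratic\<close> bounds the quotient by a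
  multiple of h for each u, and \<open>sym_excess_linear\<close> bounds it independently of
  h.\<close>

lemma sym_excess_integral_tendsto:
  assumes h: "\<And>n. 0 < h n" "\<And>n. h n \<le> 1" "h \<longlonglongrightarrow> 0"
  shows "(\<lambda>n. (\<integral>u. sym_excess p (x * u) (h n * u) \<partial>mu 2) / h n) \<longlonglongrightarrow> 0"
proof -
  interpret prob_space "mu 2" by (rule prob_space_mu_2)
  have "(\<lambda>n. \<integral>u. sym_excess p (x * u) (h n * u) / h n \<partial>mu 2) \<longlonglongrightarrow> (\<integral>u. 0 \<partial>mu 2)"
  proof (rule integral_dominated_convergence)
    show "integrable (mu 2) (\<lambda>u. ln 2 + (log_mgf p ((\<bar>x\<bar> + 1) * u) - log_mgf p 0))"
      using integrable_log_mgf_mu_2 by simp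
    show "AE u in mu 2. (\<lambda>n. sym_excess p (x * u) (h n * u) / h n) \<longlonglongrightarrow> 0"
    proof (intro AE_I2)
      fix u
      define c where "c = ((cosh_mgf p (x * u + u) + cosh_mgf p (x * u - u)) / 2 - cosh_mgf p (x * u)) / cosh_mgf p (x * u)"
      show "(\<lambda>n. sym_excess p (x * u) (h n * u) / h n) \<longlonglongrightarrow> 0"
      proof (rule tendsto_sandwich[where f = "\<lambda>_. 0"])
        show "(\<lambda>n. h n * c) \<longlonglongrightarrow> 0" using h(3) by (auto intro!: tendsto_eq_intros)
        show "\<forall>\<^sub>F n in sequentially. 0 \<le> sym_excess p (x * u) (h n * u) / h n"
          using sym_excess_nonneg h(1) by (intro always_eventually) (simp add: less_imp_le)
        show "\<forall>\<^sub>F n in sequentially. sym_excess p (x * u) (h n * u) / h n \<le> h n * c"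
        proof (intro always_eventually allI)
          fix n
          have "sym_excess p (x * u) (h n * u) \<le> (h n)\<^sup>2 * c"
            unfolding c_def using h(1)[of n] h(2)[of n] by (intro sym_excess_quadratic) auto
          then show "sym_excess p (x * u) (h n * u) / h n \<le> h n * c"
            using h(1)[of n] by (simp add: field_simps power2_eq_square)
        qed
      qed simp
    qed
    show "AE u in mu 2. norm (sym_excess p (x * u) (h n * u) / h n) \<le> ln 2 + (log_mgf p ((\<bar>x\<bar> + 1) * u) - log_mgf p 0)" for n
    proof (intro AE_I2)
      fix u
      have "sym_excess p (x * u) (h n * u) \<le> h n * (ln 2 + sym_excess p (x * u) u)"
        using h(1)[of n] h(2)[of n] by (intro sym_excess_linear) auto
      then have "sym_excess p (x * u) (h n * u) / h n \<le> ln 2 + sym_excess p (x * u) u"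
        using h(1)[of n] by (simp add: field_simps)
      then show "norm (sym_excess p (x * u) (h n * u) / h n) \<le> ln 2 + (log_mgf p ((\<bar>x\<bar> + 1) * u) - log_mgf p 0)"
        using sym_excess_nonneg[of "x * u" "h n * u"] sym_excess_le[of x u] h(1)[of n] by simp
    qed
  qed measurable
  then show ?thesis by simp
qed

text \<open>Since the symmetric second difference of \<^const>\<open>avg_log_mgf\<close> is
  \<open>o(h)\<close>, any affine minorant touching it at \<open>x\<close> is its tangent.\<close>

lemma avg_log_mgf_has_derivative:
  assumes D: "\<And>k. avg_log_mgf p x + D * k \<le> avg_log_mgf p (x + k)"
  shows "(avg_log_mgf p has_real_derivative D) (at x)"
  unfolding DERIV_def LIMSEQ_SEQ_conv[symmetric]
proof (intro allI impI, elim conjE)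
  fix S :: "nat \<Rightarrow> real" assume S0: "\<forall>n. S n \<noteq> 0" and S: "S \<longlonglongrightarrow> 0"
  \<comment> \<open>Truncation at 1 keeps every term in the range of the excess bounds; eventually
    it equals \<bar>S n\<bar>.\<close>
  define h where "h n = min 1 \<bar>S n\<bar>" for n
  have h: "\<And>n. 0 < h n" "\<And>n. h n \<le> 1" using S0 by (auto simp: h_def)
  have h0: "h \<longlonglongrightarrow> 0"
    using tendsto_min[OF tendsto_const[of 1] tendsto_rabs[OF S]] by (simp add: h_def[abs_def])
  have ev: "\<forall>\<^sub>F n in sequentially. \<bar>S n\<bar> < 1"
    using tendsto_rabs_zero[OF S] by (rule order_tendstoD) simp
  let ?E = "\<lambda>n. 2 * ((\<integral>u. sym_excess p (x * u) (h n * u) \<partial>mu 2) / h n)"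
  have "(\<lambda>n. (avg_log_mgf p (x + S n) - avg_log_mgf p x) / S n - D) \<longlonglongrightarrow> 0"
  proof (rule Lim_null_comparison[where g = ?E])
    show "?E \<longlonglongrightarrow> 0" using sym_excess_integral_tendsto[OF h h0, of x] by (rule tendsto_mult_right_zero)
    show "\<forall>\<^sub>F n in sequentially. norm ((avg_log_mgf p (x + S n) - avg_log_mgf p x) / S n - D) \<le> ?E n"
      using ev
    proof eventually_elim
      case (elim n)
      then have hS: "h n = \<bar>S n\<bar>" by (simp add: h_def)
      let ?k = "S n"
      have "avg_log_mgf p (x + h n) + avg_log_mgf p (x - h n) - 2 * avg_log_mgf p x
        = (\<integral>u. log_mgf p (x * u + h n * u) + log_mgf p (x * u - h n * u) - 2 * log_mgf p (x * u) \<partial>mu 2)"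
        unfolding avg_log_mgf_def using integrable_log_mgf_mu_2[of "x + h n"] integrable_log_mgf_mu_2[of "x - h n"] integrable_log_mgf_mu_2[of x]
        by (simp add: algebra_simps)
      also have "\<dots> \<le> (\<integral>u. 2 * sym_excess p (x * u) (h n * u) \<partial>mu 2)"
        using integrable_log_mgf_mu_2[of "x + h n"] integrable_log_mgf_mu_2[of "x - h n"] integrable_log_mgf_mu_2[of x]
          integrable_sym_excess[of "h n" x] h(1)[of n] h(2)[of n]
        by (intro integral_mono log_mgf_second_difference) (auto simp: algebra_simps)
      finally have *: "avg_log_mgf p (x + h n) + avg_log_mgf p (x - h n) - 2 * avg_log_mgf p x
          \<le> 2 * (\<integral>u. sym_excess p (x * u) (h n * u) \<partial>mu 2)" by simp
      have "avg_log_mgf p (x + h n) + avg_log_mgf p (x - h n) = avg_log_mgf p (x + ?k) + avg_log_mgf p (x - ?k)"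
        using hS by (cases "?k \<ge> 0") auto
      \<comment> \<open>Both errors, at k and at -k, are nonnegative by the minorant and add up to
        the second difference, so each is bounded by it.\<close>
      with * D[of ?k] D[of "- ?k"]
      have "\<bar>avg_log_mgf p (x + ?k) - avg_log_mgf p x - D * ?k\<bar> \<le> 2 * (\<integral>u. sym_excess p (x * u) (h n * u) \<partial>mu 2)"
        by simp
      then have "\<bar>avg_log_mgf p (x + ?k) - avg_log_mgf p x - D * ?k\<bar> / h n \<le> ?E n"
        using h(1)[of n] by (simp add: divide_right_mono)
      moreover have "\<bar>avg_log_mgf p (x + ?k) - avg_log_mgf p x - D * ?k\<bar> / h n
          = \<bar>(avg_log_mgf p (x + ?k) - avg_log_mgf p x) / ?k - D\<bar>"
        using S0 by (simp add: hS abs_divide[symmetric] diff_divide_distrib)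
      ultimately show ?case by simp
    qed
  qed
  then show "(\<lambda>n. (avg_log_mgf p (x + S n) - avg_log_mgf p x) / S n) \<longlonglongrightarrow> D"
    by (simp add: LIM_zero_cancel)
qed

end

section \<open>Radial integration on \<open>\<real>\<^sup>n\<close>\<close>

abbreviation lborel_Pi :: "nat \<Rightarrow> (nat \<Rightarrow> real) measure" where
  "lborel_Pi n \<equiv> \<Pi>\<^sub>M i\<in>{..<n}. lborel"

interpretation lborel_Pi: product_sigma_finite "\<lambda>_::nat. lborel :: real measure" ..

lemma sigma_finite_lborel_Pi: "sigma_finite_measure (lborel_Pi n)"
  by (rule lborel_Pi.sigma_finite) simp

lemma lborel_Pi_affine:
  fixes b :: "nat \<Rightarrow> real" and c :: real
  assumes c: "0 < c"
  shows "lborel_Pi n = density (distr (lborel_Pi n) (lborel_Pi n) (\<lambda>x. \<lambda>i\<in>{..<n}. b i + c * x i)) (\<lambda>_. ennreal (c ^ n))"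
    (is "_ = density (distr _ _ ?f) _")
proof (rule lborel_Pi.PiM_eqI[symmetric])
  fix A :: "nat \<Rightarrow> real set" assume A: "\<And>i. i \<in> {..<n} \<Longrightarrow> A i \<in> sets lborel"
  have m: "?f \<in> lborel_Pi n \<rightarrow>\<^sub>M lborel_Pi n" by measurable
  have PA: "Pi\<^sub>E {..<n} A \<in> sets (lborel_Pi n)" using A by (intro sets_PiM_I_finite) auto
  have pre: "?f -` Pi\<^sub>E {..<n} A \<inter> space (lborel_Pi n) = Pi\<^sub>E {..<n} (\<lambda>i. (\<lambda>x. b i + c * x) -` A i)"
    by (auto simp: space_PiM PiE_iff)
  have "emeasure (density (distr (lborel_Pi n) (lborel_Pi n) ?f) (\<lambda>_. ennreal (c ^ n))) (Pi\<^sub>E {..<n} A)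
      = ennreal (c ^ n) * emeasure (lborel_Pi n) (Pi\<^sub>E {..<n} (\<lambda>i. (\<lambda>x. b i + c * x) -` A i))"
    using PA by (subst emeasure_density) (auto simp: nn_integral_cmult_indicator emeasure_distr[OF m] pre)
  also have "emeasure (lborel_Pi n) (Pi\<^sub>E {..<n} (\<lambda>i. (\<lambda>x. b i + c * x) -` A i))
      = (\<Prod>i<n. emeasure lborel ((\<lambda>x. b i + c * x) -` A i))"
    using A measurable_sets_borel[of "\<lambda>x. b _ + c * x" borel] 
    by (intro lborel_Pi.emeasure_PiM) auto
  also have "ennreal (c ^ n) * \<dots> = (\<Prod>i<n. ennreal c * emeasure lborel ((\<lambda>x. b i + c * x) -` A i))"
    using c by (simp add: prod.distrib ennreal_power)
  also have "\<dots> = (\<Prod>i<n. emeasure lborel (A i))"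
  proof (rule prod.cong)
    fix i assume "i \<in> {..<n}"
    with A have Ai: "A i \<in> sets borel" by auto
    have "emeasure lborel (A i) = emeasure (density (distr lborel borel (\<lambda>x. b i + c * x)) (\<lambda>_. \<bar>c\<bar>)) (A i)"
      using lborel_real_affine[of c "b i"] c by simp
    also have "\<dots> = ennreal c * emeasure lborel ((\<lambda>x. b i + c * x) -` A i)"
      using Ai c by (subst emeasure_density) (auto simp: nn_integral_cmult_indicator emeasure_distr)
    finally show "ennreal c * emeasure lborel ((\<lambda>x. b i + c * x) -` A i) = emeasure lborel (A i)" by simp
  qed simp
  finally show "emeasure (density (distr (lborel_Pi n) (lborel_Pi n) ?f) (\<lambda>_. ennreal (c ^ n))) (Pi\<^sub>E {..<n} A)
      = (\<Prod>i\<in>{..<n}. emeasure lborel (A i))" .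
qed simp_all

lemma emeasure_lborel_Pi_affine:
  fixes b :: "nat \<Rightarrow> real" and c :: real
  assumes c: "0 < c" and S: "S \<in> sets (lborel_Pi n)"
  shows "emeasure (lborel_Pi n) S
    = ennreal (c ^ n) * emeasure (lborel_Pi n) {x \<in> space (lborel_Pi n). (\<lambda>i\<in>{..<n}. b i + c * x i) \<in> S}"
proof -
  let ?f = "\<lambda>x. \<lambda>i\<in>{..<n}. b i + c * x i"
  have m: "?f \<in> lborel_Pi n \<rightarrow>\<^sub>M lborel_Pi n" by measurable
  have "emeasure (lborel_Pi n) S = ennreal (c ^ n) * emeasure (distr (lborel_Pi n) (lborel_Pi n) ?f) S"
    using S by (subst lborel_Pi_affine[OF c, of n b], subst emeasure_density) (auto simp: nn_integral_cmult_indicator)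
  also have "emeasure (distr (lborel_Pi n) (lborel_Pi n) ?f) S
      = emeasure (lborel_Pi n) {x \<in> space (lborel_Pi n). ?f x \<in> S}"
    using S m by (subst emeasure_distr) (auto intro!: arg_cong[where f = "emeasure _"])
  finally show ?thesis .
qed

section \<open>Volumes of cones and radial integrals\<close>

lemma measurable_L2_set [measurable (raw)]:
  assumes "\<And>i. i \<in> I \<Longrightarrow> (\<lambda>x. f x i) \<in> borel_measurable M"
  shows "(\<lambda>x. L2_set (f x) I) \<in> borel_measurable M"
  unfolding L2_set_def using assms by measurable

text \<open>Meant for cones: divided by the value for the whole space it is the proportion of
  directions in C, so no surface measure on the sphere has to be built.\<close>

definition unit_vol :: "nat \<Rightarrow> (nat \<Rightarrow> real) set \<Rightarrow> ennreal" where
  "unit_vol n C = emeasure (lborel_Pi n) {y \<in> C. L2_set y {..<n} < 1}"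

lemma L2_set_scale: "0 \<le> c \<Longrightarrow> L2_set (\<lambda>i. c * x i) A = c * L2_set x A"
  by (simp add: L2_set_def power_mult_distrib sum_distrib_left[symmetric] real_sqrt_mult)

lemma L2_set_restrict [simp]: "L2_set (restrict x A) A = L2_set x A"
  unfolding L2_set_def by (intro arg_cong[where f = sqrt] sum.cong) auto

lemma abs_le_L2_set: "finite A \<Longrightarrow> i \<in> A \<Longrightarrow> \<bar>x i\<bar> \<le> L2_set x A"
  using member_le_L2_set[of A i "\<lambda>i. \<bar>x i\<bar>"] by (simp add: L2_set_def)

lemma emeasure_ball_cone:
  assumes C: "C \<in> sets (lborel_Pi n)"
    and cone: "\<And>c y. 0 < c \<Longrightarrow> y \<in> space (lborel_Pi n) \<Longrightarrow> (\<lambda>i\<in>{..<n}. c * y i) \<in> C \<longleftrightarrow> y \<in> C"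
    and r: "0 < r"
  shows "emeasure (lborel_Pi n) {y \<in> C. L2_set y {..<n} < r} = ennreal (r ^ n) * unit_vol n C"
proof -
  have CS: "C \<subseteq> space (lborel_Pi n)" using C by (rule sets.sets_into_space)
  have S: "{y \<in> C. L2_set y {..<n} < r} = C \<inter> {y \<in> space (lborel_Pi n). L2_set y {..<n} < r}"
    using CS by auto
  have meas: "{y \<in> C. L2_set y {..<n} < r} \<in> sets (lborel_Pi n)"
    unfolding S using C by measurable
  have "{x \<in> space (lborel_Pi n). (\<lambda>i\<in>{..<n}. 0 + r * x i) \<in> {y \<in> C. L2_set y {..<n} < r}}
      = {y \<in> C. L2_set y {..<n} < 1}"
    using CS r cone[OF r] by (auto simp: L2_set_scale)
  then show ?thesis
    unfolding unit_vol_def using emeasure_lborel_Pi_affine[OF r meas, of "\<lambda>_. 0"] by simp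
qed

lemma unit_vol_space_finite: "unit_vol n (space (lborel_Pi n)) < \<infinity>"
proof -
  have "unit_vol n (space (lborel_Pi n)) \<le> emeasure (lborel_Pi n) ({..<n} \<rightarrow>\<^sub>E {-1..1})"
    unfolding unit_vol_def
  proof (rule emeasure_mono)
    show "{y \<in> space (lborel_Pi n). L2_set y {..<n} < 1} \<subseteq> {..<n} \<rightarrow>\<^sub>E {- 1..1}"
    proof
      fix y :: "nat \<Rightarrow> real" assume "y \<in> {y \<in> space (lborel_Pi n). L2_set y {..<n} < 1}"
      then have y: "y \<in> space (lborel_Pi n)" "L2_set y {..<n} < 1" by auto
      then have "\<bar>y i\<bar> \<le> 1" if "i < n" for i
        using abs_le_L2_set[of "{..<n}" i y] that by simp
      with y(1) show "y \<in> {..<n} \<rightarrow>\<^sub>E {- 1..1}" by (auto simp: space_PiM PiE_iff abs_le_iff minus_le_iff)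
    qed
  qed (auto intro!: sets_PiM_I_finite)
  also have "\<dots> = (\<Prod>i<n. emeasure lborel {-1..1::real})" by (intro lborel_Pi.emeasure_PiM) auto
  also have "\<dots> < \<infinity>" by (simp add: power_less_top_ennreal) 
  finally show ?thesis .
qed

lemma unit_vol_space_pos: "0 < unit_vol n (space (lborel_Pi n))"
proof -
  \<comment> \<open>A cube of half side d fits into the open unit ball as soon as n d^2 < 1; the
    denominator n + 1 also covers n = 0.\<close>
  define d where "d = 1 / (real n + 1)"
  have d: "0 < d" "d \<le> 1" by (auto simp: d_def)
  have "0 < ennreal ((2 * d) ^ n)" using d by simp
  also have "ennreal ((2 * d) ^ n) = ennreal (2 * d) ^ n" using d by (intro ennreal_power[symmetric]) simp
  also have "\<dots> = (\<Prod>i<n. emeasure lborel {-d..d})" using d by simp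
  also have "\<dots> = emeasure (lborel_Pi n) ({..<n} \<rightarrow>\<^sub>E {-d..d})"
    by (intro lborel_Pi.emeasure_PiM[symmetric]) auto
  also have "\<dots> \<le> unit_vol n (space (lborel_Pi n))"
    unfolding unit_vol_def
  proof (rule emeasure_mono)
    show "{..<n} \<rightarrow>\<^sub>E {- d..d} \<subseteq> {y \<in> space (lborel_Pi n). L2_set y {..<n} < 1}"
    proof safe
      fix y :: "nat \<Rightarrow> real" assume y: "y \<in> {..<n} \<rightarrow>\<^sub>E {- d..d}"
      then show "y \<in> space (lborel_Pi n)" by (auto simp: space_PiM)
      have "(\<Sum>i<n. (y i)\<^sup>2) \<le> (\<Sum>i<n. d\<^sup>2)"
      proof (rule sum_mono)
        fix i assume "i \<in> {..<n}"
        then have "y i \<in> {- d..d}" using y by (simp only: PiE_iff)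
        then have "\<bar>y i\<bar> \<le> \<bar>d\<bar>" using d by auto
        then show "(y i)\<^sup>2 \<le> d\<^sup>2" by (simp add: abs_le_square_iff)
      qed
      also have "\<dots> = (real n * d) * d" by (simp add: power2_eq_square)
      also have "\<dots> \<le> (real n * d) * 1" using d by (intro mult_left_mono) auto
      also have "\<dots> < 1" by (simp add: d_def)
      finally show "L2_set y {..<n} < 1" by (simp add: L2_set_def)
    qed
  qed measurable
  finally show ?thesis .
qed

text \<open>The law of the norm on C and the law of the norm on the whole space give the half-line
  below r masses proportional to r^n, so the two measures are proportional. The statement is
  cross-multiplied to avoid division in \<open>ennreal\<close>.\<close>

lemma nn_integral_radial_cone:
  assumes C: "C \<in> sets (lborel_Pi n)"
    and cone: "\<And>c y. 0 < c \<Longrightarrow> y \<in> space (lborel_Pi n) \<Longrightarrow> (\<lambda>i\<in>{..<n}. c * y i) \<in> C \<longleftrightarrow> y \<in> C"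
    and h: "h \<in> borel_measurable borel"
  shows "unit_vol n (space (lborel_Pi n)) * (\<integral>\<^sup>+y. h (L2_set y {..<n}) * indicator C y \<partial>lborel_Pi n)
       = unit_vol n C * (\<integral>\<^sup>+y. h (L2_set y {..<n}) \<partial>lborel_Pi n)"
proof -
  let ?L = "lborel_Pi n" and ?S = "space (lborel_Pi n)"
  let ?N = "\<lambda>y. L2_set y {..<n}"
  define m where "m D = distr (density ?L (indicator D)) borel ?N" for D
  have cs: "(\<lambda>i\<in>{..<n}. c * y i) \<in> ?S \<longleftrightarrow> y \<in> ?S" if "0 < c" "y \<in> ?S" for c and y :: "nat \<Rightarrow> real"
    using that by (auto simp: space_PiM)
  have m_less: "emeasure (m D) {..<r} = ennreal (r ^ n) * unit_vol n D"
    if D: "D \<in> sets ?L" "\<And>c y. 0 < c \<Longrightarrow> y \<in> ?S \<Longrightarrow> (\<lambda>i\<in>{..<n}. c * y i) \<in> D \<longleftrightarrow> y \<in> D" and r: "0 < r" for D r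
  proof -
    have DS: "D \<subseteq> ?S" using D(1) by (rule sets.sets_into_space)
    have "emeasure (m D) {..<r} = emeasure ?L (D \<inter> (?N -` {..<r} \<inter> ?S))"
    proof -
      have pre: "?N -` {..<r} \<inter> ?S \<in> sets ?L" by measurable
      have "emeasure (m D) {..<r} = emeasure (density ?L (indicator D)) (?N -` {..<r} \<inter> ?S)"
        unfolding m_def by (subst emeasure_distr) auto
      also have "\<dots> = emeasure ?L (D \<inter> (?N -` {..<r} \<inter> ?S))" using D(1) pre by (rule emeasure_restricted)
      finally show ?thesis .
    qed
    also have "D \<inter> (?N -` {..<r} \<inter> ?S) = {y \<in> D. ?N y < r}" using DS by auto
    also have "emeasure ?L \<dots> = ennreal (r ^ n) * unit_vol n D" using D r by (intro emeasure_ball_cone)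
    finally show ?thesis .
  qed
  have m_le0: "emeasure (m D) {..<r} = 0" if "D \<in> sets ?L" "r \<le> 0" for D r
  proof -
    have "\<not> ?N y < r" for y using that(2) L2_set_nonneg[of y "{..<n}"] by linarith
    then have "?N -` {..<r} \<inter> ?S = {}" by auto
    then show ?thesis unfolding m_def using that(1) by (subst emeasure_distr) auto
  qed
  have C_less: "emeasure (m C) {..<r} = ennreal (r ^ n) * unit_vol n C" if "0 < r" for r
    by (rule m_less[OF C _ that]) (rule cone)
  have S_less: "emeasure (m ?S) {..<r} = ennreal (r ^ n) * unit_vol n ?S" if "0 < r" for r
    by (rule m_less[OF sets.top _ that]) (rule cs)
  have C_le0: "emeasure (m C) {..<r} = 0" if "r \<le> 0" for r using m_le0[OF C that] .
  have S_le0: "emeasure (m ?S) {..<r} = 0" if "r \<le> 0" for r using m_le0[OF sets.top that] .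
  have "scale_measure (unit_vol n ?S) (m C) = scale_measure (unit_vol n C) (m ?S)"
  proof (rule measure_eqI_generator_eq[where E = "range lessThan" and A = "\<lambda>i. {..<real i}" and \<Omega> = UNIV])
    show "Int_stable (range lessThan :: real set set)"
    proof (rule Int_stableI_image)
      show "\<exists>k\<in>UNIV. {..<a} \<inter> {..<b} = {..<k}" for a b :: real
        by (intro bexI[of _ "min a b"]) auto
    qed
    show "sets (scale_measure (unit_vol n ?S) (m C)) = sigma_sets UNIV (range lessThan)"
      "sets (scale_measure (unit_vol n C) (m ?S)) = sigma_sets UNIV (range lessThan)"
      by (simp_all add: m_def borel_Iio)
    show "(\<Union>i. {..<real i}) = UNIV" by (auto intro: reals_Archimedean2)
    show "emeasure (scale_measure (unit_vol n ?S) (m C)) {..<real i} \<noteq> \<infinity>" for i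
    proof -
      have "unit_vol n C \<le> unit_vol n ?S"
        unfolding unit_vol_def using sets.sets_into_space[OF C] by (intro emeasure_mono) auto
      then have "unit_vol n C < \<infinity>" using unit_vol_space_finite[of n] by (rule le_less_trans)
      then have "emeasure (m C) {..<real i} < \<infinity>"
        by (cases "i = 0") (simp_all add: C_less C_le0 ennreal_mult_less_top)
      then show ?thesis using unit_vol_space_finite[of n] by (auto simp: ennreal_mult_eq_top_iff)
    qed
    fix X :: "real set" assume "X \<in> range lessThan"
    then obtain r where X: "X = {..<r}" by auto
    show "emeasure (scale_measure (unit_vol n ?S) (m C)) X = emeasure (scale_measure (unit_vol n C) (m ?S)) X"
      unfolding X by (cases "0 < r") (simp_all add: C_less C_le0 S_less S_le0 mult_ac)
  qed auto
  then have "integral\<^sup>N (scale_measure (unit_vol n ?S) (m C)) h = integral\<^sup>N (scale_measure (unit_vol n C) (m ?S)) h"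
    by simp
  moreover have "integral\<^sup>N (m D) h = (\<integral>\<^sup>+y. h (?N y) * indicator D y \<partial>?L)" if D: "D \<in> sets ?L" for D
    unfolding m_def using D h by (subst nn_integral_distr) (auto simp: nn_integral_density mult.commute)
  moreover have "(\<integral>\<^sup>+y. h (?N y) * indicator ?S y \<partial>?L) = (\<integral>\<^sup>+y. h (?N y) \<partial>?L)"
    by (intro nn_integral_cong) simp
  ultimately show ?thesis using C h by (simp add: nn_integral_scale_measure m_def)
qed

section \<open>The Gaussian product measure as a radial weight\<close>

interpretation mu_2: prob_space "mu 2" by (rule prob_space_mu_2)

abbreviation gauss_Pi :: "nat \<Rightarrow> (nat \<Rightarrow> real) measure" where
  "gauss_Pi n \<equiv> \<Pi>\<^sub>M i\<in>{..<n}. mu 2"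

interpretation gauss_Pi: product_sigma_finite "\<lambda>_::nat. mu 2" ..

lemma prob_space_gauss_Pi: "prob_space (gauss_Pi n)"
  by (rule prob_space_PiM) (rule prob_space_mu_2)

lemma sets_gauss_Pi [measurable_cong]: "sets (gauss_Pi n) = sets (lborel_Pi n)"
  by (intro sets_PiM_cong) auto

lemma space_gauss_Pi: "space (gauss_Pi n) = space (lborel_Pi n)"
  by (simp add: space_PiM)

lemma gauss_Pi_eq_density:
  "gauss_Pi n = density (lborel_Pi n) (\<lambda>y. ennreal ((1 / sqrt (2 * pi)) ^ n * exp (- (L2_set y {..<n})\<^sup>2 / 2)))"
proof (rule gauss_Pi.PiM_eqI[symmetric])
  let ?d = "\<lambda>y. ennreal ((1 / sqrt (2 * pi)) ^ n * exp (- (L2_set y {..<n})\<^sup>2 / 2))"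
  have d: "?d y = (\<Prod>i<n. ennreal (std_normal_density (y i)))" for y
    by (simp add: prod_ennreal std_normal_density_def prod.distrib exp_sum[symmetric] L2_set_def sum_nonneg
        sum_negf sum_divide_distrib power_divide prod_dividef)
  fix A :: "nat \<Rightarrow> real set" assume A: "\<And>i. i \<in> {..<n} \<Longrightarrow> A i \<in> sets (mu 2)"
  have PA: "Pi\<^sub>E {..<n} A \<in> sets (lborel_Pi n)" using A by (intro sets_PiM_I_finite) auto
  have "emeasure (density (lborel_Pi n) ?d) (Pi\<^sub>E {..<n} A) = (\<integral>\<^sup>+y. ?d y * indicator (Pi\<^sub>E {..<n} A) y \<partial>lborel_Pi n)"
    using PA by (intro emeasure_density) auto
  also have "\<dots> = (\<integral>\<^sup>+y. (\<Prod>i<n. ennreal (std_normal_density (y i)) * indicator (A i) (y i)) \<partial>lborel_Pi n)"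
  proof (rule nn_integral_cong)
    fix y :: "nat \<Rightarrow> real" assume y: "y \<in> space (lborel_Pi n)"
    then have "indicator (Pi\<^sub>E {..<n} A) y = (\<Prod>i<n. indicator (A i) (y i) :: ennreal)"
      by (auto simp: indicator_def space_PiM PiE_iff prod_zero_iff)
    then show "?d y * indicator (Pi\<^sub>E {..<n} A) y = (\<Prod>i<n. ennreal (std_normal_density (y i)) * indicator (A i) (y i))"
      unfolding d by (simp add: prod.distrib)
  qed
  also have "\<dots> = (\<Prod>i<n. \<integral>\<^sup>+x. ennreal (std_normal_density x) * indicator (A i) x \<partial>lborel)"
    using A by (intro lborel_Pi.product_nn_integral_prod) auto
  also have "\<dots> = (\<Prod>i\<in>{..<n}. emeasure (mu 2) (A i))"
    using A unfolding mu_2_eq by (intro prod.cong) (auto simp: emeasure_density)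
  finally show "emeasure (density (lborel_Pi n) ?d) (Pi\<^sub>E {..<n} A) = (\<Prod>i\<in>{..<n}. emeasure (mu 2) (A i))" .
qed (auto simp: sets_gauss_Pi)

text \<open>The Gaussian density depends on the norm alone and integrates to 1, so the probability
  of a cone is its share of the unit ball.\<close>

lemma gauss_Pi_cone:
  assumes C: "C \<in> sets (lborel_Pi n)"
    and cone: "\<And>c y. 0 < c \<Longrightarrow> y \<in> space (lborel_Pi n) \<Longrightarrow> (\<lambda>i\<in>{..<n}. c * y i) \<in> C \<longleftrightarrow> y \<in> C"
  shows "unit_vol n (space (lborel_Pi n)) * emeasure (gauss_Pi n) C = unit_vol n C"
proof -
  let ?h = "\<lambda>\<rho>. ennreal ((1 / sqrt (2 * pi)) ^ n * exp (- \<rho>\<^sup>2 / 2))"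
  have "emeasure (gauss_Pi n) C = (\<integral>\<^sup>+y. ?h (L2_set y {..<n}) * indicator C y \<partial>lborel_Pi n)"
    using C unfolding gauss_Pi_eq_density by (intro emeasure_density) auto
  moreover have "(\<integral>\<^sup>+y. ?h (L2_set y {..<n}) \<partial>lborel_Pi n) = 1"
  proof -
    have "(\<integral>\<^sup>+y. ?h (L2_set y {..<n}) \<partial>lborel_Pi n) = emeasure (gauss_Pi n) (space (gauss_Pi n))"
      unfolding gauss_Pi_eq_density by (subst emeasure_density) (auto intro!: nn_integral_cong)
    then show ?thesis by (simp only: prob_space.emeasure_space_1[OF prob_space_gauss_Pi])
  qed
  ultimately show ?thesis using nn_integral_radial_cone[OF C cone, of ?h] by simp
qed

section \<open>Rotation-invariant measures on the sphere\<close>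

lemma space_borel_of [simp]: "space (borel_of T) = topspace T"
  by (simp add: borel_of_def space_measure_of_conv)

lemma sets_borel_of: "sets (borel_of T) = sigma_sets (topspace T) {U. openin T U}"
  unfolding borel_of_def by (rule sets_measure_of) (auto dest: openin_subset)

lemma continuous_map_measurable:
  assumes "continuous_map T T' f" shows "f \<in> borel_of T \<rightarrow>\<^sub>M borel_of T'"
proof (rule measurable_sigma_sets[OF sets_borel_of])
  show "{U. openin T' U} \<subseteq> Pow (topspace T')" by (auto dest: openin_subset)
  show "f \<in> space (borel_of T) \<rightarrow> topspace T'" using continuous_map_funspace[OF assms] by simp
  show "f -` U \<inter> space (borel_of T) \<in> sets (borel_of T)" if "U \<in> {U. openin T' U}" for U
    using openin_continuous_map_preimage[OF assms, of U] that
    by (auto simp: sets_borel_of vimage_def Int_def conj_commute intro!: sigma_sets.Basic)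
qed

lemma borel_of_euclidean: "borel_of euclidean = (borel :: 'a::topological_space measure)"
  by (rule measure_eqI) (auto simp: sets_borel_of borel_def borel_of_def emeasure_sigma)

lemma measurable_nsphere_coordinate: "(\<lambda>x. x i) \<in> borel_measurable (borel_of (nsphere n))"
  using continuous_map_measurable[OF continuous_map_nsphere_projection[of n i]] by (simp add: borel_of_euclidean)

lemma topspace_nsphere_iff:
  assumes "1 \<le> n"
  shows "x \<in> topspace (nsphere (n - 1)) \<longleftrightarrow> (\<Sum>i<n. (x i)\<^sup>2) = 1 \<and> (\<forall>i\<ge>n. x i = 0)"
proof -
  have "{..n - 1} = {..<n}" using assms by auto
  moreover have "(\<forall>i>n - 1. x i = 0) \<longleftrightarrow> (\<forall>i\<ge>n. x i = 0)"
    using assms by (metis Suc_le_eq Suc_pred le_simps(3) less_le_trans zero_less_one diff_Suc_1 Suc_diff_1)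
  ultimately show ?thesis by (simp add: nsphere)
qed

section \<open>Orthogonal maps on the sphere\<close>

lemma orthogonal_array_sum_squares:
  assumes "orthogonal_array n A"
  shows "(\<Sum>k<n. (apply_array n A x k)\<^sup>2) = (\<Sum>i<n. (x i)\<^sup>2)"
proof -
  have "(\<Sum>k<n. (apply_array n A x k)\<^sup>2) = (\<Sum>k<n. \<Sum>i<n. \<Sum>j<n. x i * x j * (A k i * A k j))"
    by (intro sum.cong) (auto simp: apply_array_def power2_eq_square sum_product mult_ac)
  also have "\<dots> = (\<Sum>i<n. \<Sum>k<n. \<Sum>j<n. x i * x j * (A k i * A k j))" by (rule sum.swap)
  also have "\<dots> = (\<Sum>i<n. \<Sum>j<n. \<Sum>k<n. x i * x j * (A k i * A k j))"
    by (rule sum.cong[OF refl], rule sum.swap)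
  also have "\<dots> = (\<Sum>i<n. \<Sum>j<n. x i * x j * (if i = j then 1 else 0))"
    using assms by (intro sum.cong refl) (simp add: sum_distrib_left[symmetric] orthogonal_array_def)
  also have "\<dots> = (\<Sum>i<n. (x i)\<^sup>2)"
    by (simp add: power2_eq_square if_distrib[of "(*) _"] cong: if_cong)
  finally show ?thesis .
qed

lemma apply_array_diff:
  "i < n \<Longrightarrow> apply_array n A x i - apply_array n A y i = apply_array n A (\<lambda>j. x j - y j) i"
  by (simp add: apply_array_def sum_subtractf[symmetric] right_diff_distrib)

lemma continuous_map_apply_array:
  assumes n: "1 \<le> n" and A: "orthogonal_array n A"
  shows "continuous_map (nsphere (n - 1)) (nsphere (n - 1)) (apply_array n A)"
proof -
  have "continuous_map (nsphere (n - 1)) (powertop_real UNIV) (apply_array n A)"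
    unfolding continuous_map_componentwise_UNIV
  proof
    fix k
    show "continuous_map (nsphere (n - 1)) euclideanreal (\<lambda>x. apply_array n A x k)"
      by (cases "k < n") (auto simp: apply_array_def intro!: continuous_intros continuous_map_nsphere_projection)
  qed
  moreover have "apply_array n A x \<in> topspace (nsphere (n - 1))" if "x \<in> topspace (nsphere (n - 1))" for x
    using that orthogonal_array_sum_squares[OF A, of x] unfolding topspace_nsphere_iff[OF n]
    by (simp add: apply_array_def)
  ultimately show ?thesis
    by (auto simp: nsphere continuous_map_in_subtopology image_subset_iff)
qed

text \<open>The Householder reflection in the hyperplane orthogonal to y - y' exchanges two vectors
  of equal length.\<close>

lemma exists_orthogonal_array:
  assumes eq: "(\<Sum>i<n. (y i)\<^sup>2) = (\<Sum>i<n. (y' i)\<^sup>2)"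
  shows "\<exists>A. orthogonal_array n A \<and> (\<forall>i<n. apply_array n A y i = y' i)"
proof -
  define v where "v i = y i - y' i" for i
  define N where "N = (\<Sum>i<n. (v i)\<^sup>2)"
  \<comment> \<open>If y and y' agree below n, then N = 0 and division by zero yields 0, so A is the
    identity, as desired.\<close>
  define A where "A i j = (if i = j then 1 else 0) - 2 * v i * v j / N" for i j
  have vy: "2 * (\<Sum>j<n. v j * y j) = N"
  proof -
    have "N = (\<Sum>i<n. (y i)\<^sup>2) + (\<Sum>i<n. (y' i)\<^sup>2) - 2 * (\<Sum>i<n. y i * y' i)"
      by (simp add: N_def v_def power2_diff sum.distrib sum_subtractf sum_distrib_left mult.assoc)
    moreover have "(\<Sum>j<n. v j * y j) = (\<Sum>i<n. (y i)\<^sup>2) - (\<Sum>i<n. y i * y' i)"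
      by (simp add: v_def algebra_simps sum_subtractf power2_eq_square)
    ultimately show ?thesis using eq by simp
  qed
  have "orthogonal_array n A"
    unfolding orthogonal_array_def
  proof (intro allI impI)
    fix i j assume ij: "i < n" "j < n"
    \<comment> \<open>After summation over k the last term contributes 4 v_i v_j / N and cancels the
      two middle ones.\<close>
    have "A k i * A k j = (if k = i then if i = j then 1 else 0 else 0) - (if k = i then 2 * v i * v j / N else 0)
        - (if k = j then 2 * v i * v j / N else 0) + (4 * v i * v j / N / N) * (v k)\<^sup>2" for k
      by (auto simp: A_def algebra_simps power2_eq_square divide_simps)
    then have "(\<Sum>k<n. A k i * A k j) = (if i = j then 1 else 0) - 2 * v i * v j / N - 2 * v i * v j / N
        + (\<Sum>k<n. (4 * v i * v j / N / N) * (v k)\<^sup>2)"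
      using ij by (simp only: sum.distrib sum_subtractf sum.delta finite_lessThan lessThan_iff if_True)
    also have "(\<Sum>k<n. (4 * v i * v j / N / N) * (v k)\<^sup>2) = (4 * v i * v j / N / N) * N"
      by (simp only: sum_distrib_left[symmetric] N_def)
    finally have "(\<Sum>k<n. A k i * A k j) = (if i = j then 1 else 0) - 4 * v i * v j / N + (4 * v i * v j / N / N) * N"
      by simp
    then show "(\<Sum>k<n. A k i * A k j) = (if i = j then 1 else 0)" by simp
  qed
  moreover have "apply_array n A y i = y' i" if i: "i < n" for i
  proof -
    have "A i j * y j = (if j = i then y i else 0) - 2 * v i / N * (v j * y j)" for j
      by (auto simp: A_def left_diff_distrib)
    then have "apply_array n A y i = y i - (\<Sum>j<n. 2 * v i / N * (v j * y j))"
      using i by (simp only: apply_array_def sum_subtractf sum.delta finite_lessThan lessThan_iff if_True)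
    also have "\<dots> = y i - v i / N * (2 * (\<Sum>j<n. v j * y j))"
      by (simp only: sum_distrib_left[symmetric]) simp
    also have "\<dots> = y i - v i"
    proof (cases "N = 0")
      case True
      then have "v i = 0" using i by (simp add: N_def sum_nonneg_eq_0_iff)
      then show ?thesis by simp
    qed (simp add: vy)
    finally show ?thesis by (simp add: v_def)
  qed
  ultimately show ?thesis by blast
qed

text \<open>An orthogonal map taking y to y' carries the ball around y to the ball around y'. Hence
  the mass of a ball of fixed radius is a radial function of its centre, ready for
  \<open>nn_integral_radial_cone\<close>.\<close>

lemma rotation_invariant_ball_radial:
  assumes n: "1 \<le> n" and M: "rotation_invariant_prob n M"
    and eq: "(\<Sum>i<n. (y i)\<^sup>2) = (\<Sum>i<n. (y' i)\<^sup>2)"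
  shows "emeasure M {\<theta> \<in> space M. L2_set (\<lambda>i. y i - \<theta> i) {..<n} < r}
       = emeasure M {\<theta> \<in> space M. L2_set (\<lambda>i. y' i - \<theta> i) {..<n} < r}"
proof -
  have setsM: "sets M = sets (borel_of (nsphere (n - 1)))"
    and inv: "\<And>A. orthogonal_array n A \<Longrightarrow> distr M M (apply_array n A) = M"
    using M by (auto simp: rotation_invariant_prob_def)
  obtain A where A: "orthogonal_array n A" "\<And>i. i < n \<Longrightarrow> apply_array n A y i = y' i"
    using exists_orthogonal_array[OF eq] by blast
  have mA: "apply_array n A \<in> M \<rightarrow>\<^sub>M M"
    using continuous_map_measurable[OF continuous_map_apply_array[OF n A(1)]] measurable_cong_sets[OF setsM setsM] by blast
  have [measurable]: "(\<lambda>x. x i) \<in> borel_measurable M" for i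
    using measurable_nsphere_coordinate measurable_cong_sets[OF setsM refl] by blast
  let ?S = "{\<theta> \<in> space M. L2_set (\<lambda>i. y' i - \<theta> i) {..<n} < r}"
  have S: "?S \<in> sets M" by measurable
  have "emeasure M ?S = emeasure (distr M M (apply_array n A)) ?S" by (simp add: inv[OF A(1)])
  also have "\<dots> = emeasure M (apply_array n A -` ?S \<inter> space M)" using mA S by (rule emeasure_distr)
  also have "apply_array n A -` ?S \<inter> space M = {\<theta> \<in> space M. L2_set (\<lambda>i. y i - \<theta> i) {..<n} < r}"
  proof -
    have "L2_set (\<lambda>i. y' i - apply_array n A \<theta> i) {..<n} = L2_set (\<lambda>i. y i - \<theta> i) {..<n}" for \<theta>
    proof -
      have "L2_set (\<lambda>i. y' i - apply_array n A \<theta> i) {..<n} = L2_set (apply_array n A (\<lambda>i. y i - \<theta> i)) {..<n}"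
        using A(2) by (intro L2_set_cong) (auto simp: apply_array_diff[symmetric])
      then show ?thesis unfolding L2_set_def orthogonal_array_sum_squares[OF A(1)] .
    qed
    then show ?thesis using measurable_space[OF mA] by auto
  qed
  finally show ?thesis by simp
qed

lemma sets_lborel_Pi_ball [measurable]:
  "{y \<in> space (lborel_Pi n). L2_set (\<lambda>i. y i - \<theta> i) {..<n} < r} \<in> sets (lborel_Pi n)"
  by measurable

lemma emeasure_lborel_Pi_ball:
  assumes r: "0 < r"
  shows "emeasure (lborel_Pi n) {y \<in> space (lborel_Pi n). L2_set (\<lambda>i. y i - \<theta> i) {..<n} < r}
       = ennreal (r ^ n) * unit_vol n (space (lborel_Pi n))"
proof -
  let ?B = "{y \<in> space (lborel_Pi n). L2_set (\<lambda>i. y i - \<theta> i) {..<n} < r}"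
  have B: "?B \<in> sets (lborel_Pi n)" by measurable
  have "L2_set (\<lambda>i. (\<lambda>i\<in>{..<n}. \<theta> i + r * x i) i - \<theta> i) {..<n} = r * L2_set x {..<n}" for x :: "nat \<Rightarrow> real"
    unfolding L2_set_scale[OF less_imp_le[OF r], symmetric] by (intro L2_set_cong) auto
  then have "{x \<in> space (lborel_Pi n). (\<lambda>i\<in>{..<n}. \<theta> i + r * x i) \<in> ?B} = {x \<in> space (lborel_Pi n). L2_set x {..<n} < 1}"
    using r by (auto simp: space_PiM)
  with emeasure_lborel_Pi_affine[OF r B, of \<theta>] show ?thesis by (simp add: unit_vol_def)
qed

text \<open>Averaging the indicator of a cone over small balls centred on the sphere and exchanging the
  order of integration turns any rotation-invariant law into a radial weight on \<open>\<real>\<^sup>n\<close>. As the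
  radius tends to \<open>0\<close>, this bounds the law on open sets by the normalised cone volume, and hence by
  the law of a Gaussian direction.\<close>

lemma rotation_invariant_le_gauss_Pi:
  assumes n: "1 \<le> n" and M: "rotation_invariant_prob n M"
    and C: "C \<in> sets (lborel_Pi n)"
    and cone: "\<And>c y. 0 < c \<Longrightarrow> y \<in> space (lborel_Pi n) \<Longrightarrow> (\<lambda>i\<in>{..<n}. c * y i) \<in> C \<longleftrightarrow> y \<in> C"
    and D: "D \<in> sets M"
    and op: "\<And>\<theta>. \<theta> \<in> D \<Longrightarrow> \<exists>r>0. \<forall>y\<in>space (lborel_Pi n). L2_set (\<lambda>i. y i - \<theta> i) {..<n} < r \<longrightarrow> y \<in> C"
  shows "emeasure M D \<le> emeasure (gauss_Pi n) C"
proof -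
  have setsM: "sets M = sets (borel_of (nsphere (n - 1)))"
    using M by (auto simp: rotation_invariant_prob_def)
  interpret M: prob_space M using M by (auto simp: rotation_invariant_prob_def)
  interpret L: sigma_finite_measure "lborel_Pi n" by (rule sigma_finite_lborel_Pi)
  interpret P: pair_sigma_finite M "lborel_Pi n" ..
  have [measurable]: "(\<lambda>x. x i) \<in> borel_measurable M" for i
    using measurable_nsphere_coordinate measurable_cong_sets[OF setsM refl] by blast
  note C[measurable]
  let ?L = "lborel_Pi n"
  let ?S = "space ?L"
  let ?N = "\<lambda>y. L2_set y {..<n}"
  let ?V = "unit_vol n ?S"
  define r where "r k = 1 / (real k + 1)" for k :: nat
  have r: "0 < r k" for k by (simp add: r_def)
  have r0: "r \<longlonglongrightarrow> 0" unfolding r_def[abs_def] using LIMSEQ_inverse_real_of_nat by (simp add: inverse_eq_divide add.commute)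
  \<comment> \<open>The kernel is symmetric in point and centre: integrated over y it gives the
    volume of a ball, the same for all \<theta>; integrated over \<theta> it gives a radial function
    of y.\<close>
  define K where "K k \<theta> y = (indicator {y. ?N (\<lambda>i. y i - \<theta> i) < r k} y :: ennreal)" for k \<theta> y
  have K_meas [measurable]: "(\<lambda>(\<theta>, y). K k \<theta> y) \<in> borel_measurable (M \<Otimes>\<^sub>M ?L)" for k
    unfolding K_def indicator_def by measurable
  define c where "c k = ennreal (r k ^ n) * ?V" for k
  have Vpos: "0 < ?V" and Vfin: "?V < \<infinity>" using unit_vol_space_pos unit_vol_space_finite by auto
  have c: "0 < c k" "c k < \<infinity>" for k
    using Vpos Vfin r[of k] by (auto simp: c_def ennreal_zero_less_mult_iff ennreal_mult_less_top)
  define \<phi> where "\<phi> k \<theta> = (\<integral>\<^sup>+y. K k \<theta> y * indicator C y \<partial>?L)" for k \<theta>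
  have \<phi>_meas [measurable]: "\<phi> k \<in> borel_measurable M" for k
    unfolding \<phi>_def by measurable
  have ball: "(\<integral>\<^sup>+y. K k \<theta> y \<partial>?L) = c k" for k \<theta>
  proof -
    have "(\<integral>\<^sup>+y. K k \<theta> y \<partial>?L) = (\<integral>\<^sup>+y. indicator {y \<in> ?S. ?N (\<lambda>i. y i - \<theta> i) < r k} y \<partial>?L)"
      by (intro nn_integral_cong) (simp add: K_def indicator_def)
    also have "\<dots> = c k" unfolding c_def emeasure_lborel_Pi_ball[OF r[of k], of n \<theta>, symmetric]
      by (rule nn_integral_indicator) (rule sets_lborel_Pi_ball)
    finally show ?thesis .
  qed
  \<comment> \<open>The vector (\<rho>, 0, ..., 0) represents all vectors of norm \<rho>; its first
    coordinate counts because n \<ge> 1.\<close>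
  define h where "h k \<rho> = (\<integral>\<^sup>+\<theta>. K k \<theta> (\<lambda>i. if i = 0 then \<rho> else 0) \<partial>M)" for k \<rho>
  have [measurable]: "h k \<in> borel_measurable borel" for k
    unfolding h_def K_def indicator_def by measurable
  have \<psi>: "(\<integral>\<^sup>+\<theta>. K k \<theta> y \<partial>M) = h k (?N y)" for k y
  proof -
    let ?y = "\<lambda>i::nat. if i = 0 then ?N y else 0"
    have "(\<Sum>i<n. (?y i)\<^sup>2) = (\<Sum>i<n. if i = 0 then (?N y)\<^sup>2 else 0)" by (intro sum.cong) auto
    also have "\<dots> = (?N y)\<^sup>2" using n by simp
    also have "\<dots> = (\<Sum>i<n. (y i)\<^sup>2)" by (simp add: L2_set_def sum_nonneg)
    finally have "emeasure M {\<theta> \<in> space M. ?N (\<lambda>i. ?y i - \<theta> i) < r k} = emeasure M {\<theta> \<in> space M. ?N (\<lambda>i. y i - \<theta> i) < r k}"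
      by (rule rotation_invariant_ball_radial[OF n M])
    moreover have "(\<integral>\<^sup>+\<theta>. K k \<theta> z \<partial>M) = emeasure M {\<theta> \<in> space M. ?N (\<lambda>i. z i - \<theta> i) < r k}" for z
    proof -
      have "(\<integral>\<^sup>+\<theta>. K k \<theta> z \<partial>M) = (\<integral>\<^sup>+\<theta>. indicator {\<theta> \<in> space M. ?N (\<lambda>i. z i - \<theta> i) < r k} \<theta> \<partial>M)"
        by (intro nn_integral_cong) (simp add: K_def indicator_def)
      also have "\<dots> = emeasure M {\<theta> \<in> space M. ?N (\<lambda>i. z i - \<theta> i) < r k}" by (intro nn_integral_indicator) measurable
      finally show ?thesis .
    qed
    ultimately show ?thesis by (simp add: h_def)
  qed
  \<comment> \<open>Fubini's theorem applied twice, once with and once without the indicator of C;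
    the radial identity links the two, so the unknown radial profile \<open>h k\<close>
    disappears.\<close>
  have avg: "(\<integral>\<^sup>+\<theta>. \<phi> k \<theta> \<partial>M) * ?V = unit_vol n C * c k" for k
  proof -
    have "(\<integral>\<^sup>+\<theta>. \<phi> k \<theta> \<partial>M) = (\<integral>\<^sup>+y. \<integral>\<^sup>+\<theta>. K k \<theta> y * indicator C y \<partial>M \<partial>?L)"
      unfolding \<phi>_def by (intro P.Fubini'[symmetric]) measurable
    also have "\<dots> = (\<integral>\<^sup>+y. h k (?N y) * indicator C y \<partial>?L)"
      by (intro nn_integral_cong) (simp add: nn_integral_multc K_def[abs_def] flip: \<psi>)
    finally have 1: "?V * (\<integral>\<^sup>+\<theta>. \<phi> k \<theta> \<partial>M) = unit_vol n C * (\<integral>\<^sup>+y. h k (?N y) \<partial>?L)"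
      using nn_integral_radial_cone[OF C cone, of "h k"] by simp
    have "(\<integral>\<^sup>+y. h k (?N y) \<partial>?L) = (\<integral>\<^sup>+\<theta>. \<integral>\<^sup>+y. K k \<theta> y \<partial>?L \<partial>M)"
      unfolding \<psi>[symmetric] by (rule P.Fubini') measurable
    also have "\<dots> = c k" by (simp add: ball M.emeasure_space_1)
    finally show ?thesis using 1 by (simp add: mult.commute)
  qed
  have vC: "unit_vol n C = ?V * emeasure (gauss_Pi n) C"
    by (rule gauss_Pi_cone[OF C, symmetric]) (rule cone)
  have "emeasure M D = (\<integral>\<^sup>+\<theta>. indicator D \<theta> \<partial>M)" using D by simp
  \<comment> \<open>Around a point of D all sufficiently small balls lie in C, so the ratio is
    eventually 1. Fatou's lemma then allows the limit, in this direction only.\<close>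
  also have "\<dots> \<le> (\<integral>\<^sup>+\<theta>. liminf (\<lambda>k. \<phi> k \<theta> / c k) \<partial>M)"
  proof (rule nn_integral_mono)
    fix \<theta>
    show "indicator D \<theta> \<le> liminf (\<lambda>k. \<phi> k \<theta> / c k)"
    proof (cases "\<theta> \<in> D")
      case True
      then obtain s where s: "0 < s" "\<And>y. y \<in> ?S \<Longrightarrow> ?N (\<lambda>i. y i - \<theta> i) < s \<Longrightarrow> y \<in> C" using op by blast
      have "\<forall>\<^sub>F k in sequentially. r k < s" using r0 s(1) by (rule order_tendstoD)
      then have "\<forall>\<^sub>F k in sequentially. 1 \<le> \<phi> k \<theta> / c k"
      proof eventually_elim
        case (elim k)
        have "\<phi> k \<theta> = (\<integral>\<^sup>+y. K k \<theta> y \<partial>?L)"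
          unfolding \<phi>_def
        proof (rule nn_integral_cong)
          fix y assume "y \<in> ?S"
          then show "K k \<theta> y * indicator C y = K k \<theta> y" using s(2)[of y] elim by (auto simp: K_def indicator_def)
        qed
        then show ?case using c[of k] by (simp add: ball ennreal_divide_self)
      qed
      then have "1 \<le> liminf (\<lambda>k. \<phi> k \<theta> / c k)" by (rule Liminf_bounded)
      then show ?thesis using True by simp
    qed simp
  qed
  also have "\<dots> \<le> liminf (\<lambda>k. \<integral>\<^sup>+\<theta>. \<phi> k \<theta> / c k \<partial>M)" by (intro nn_integral_liminf) measurable
  also have "(\<lambda>k. \<integral>\<^sup>+\<theta>. \<phi> k \<theta> / c k \<partial>M) = (\<lambda>k. emeasure (gauss_Pi n) C)"
  proof
    fix k
    have "(\<integral>\<^sup>+\<theta>. \<phi> k \<theta> \<partial>M) * ?V = (emeasure (gauss_Pi n) C * c k) * ?V"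
      unfolding avg vC by (simp only: mult_ac)
    then have "(\<integral>\<^sup>+\<theta>. \<phi> k \<theta> \<partial>M) = emeasure (gauss_Pi n) C * c k"
      using Vpos Vfin ennreal_mult_cancel_left[of ?V] by (auto simp: mult.commute[of _ ?V])
    then show "(\<integral>\<^sup>+\<theta>. \<phi> k \<theta> / c k \<partial>M) = emeasure (gauss_Pi n) C"
      using c[of k] by (simp add: nn_integral_divide mult_divide_eq_ennreal)
  qed
  also have "liminf (\<lambda>k. emeasure (gauss_Pi n) C) = emeasure (gauss_Pi n) C" by (rule Liminf_const) simp
  finally show ?thesis .
qed

section \<open>Fourth-moment tail bounds\<close>

context prob_space
begin

lemma integrable_power_le4:
  fixes X :: "'a \<Rightarrow> real"
  assumes [measurable]: "X \<in> borel_measurable M" and X: "integrable M (\<lambda>\<omega>. X \<omega> ^ 4)" and k: "k \<le> 4"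
  shows "integrable M (\<lambda>\<omega>. X \<omega> ^ k)"
proof (rule Bochner_Integration.integrable_bound)
  show "integrable M (\<lambda>\<omega>. 1 + X \<omega> ^ 4)" using X by simp
  show "AE \<omega> in M. norm (X \<omega> ^ k) \<le> norm (1 + X \<omega> ^ 4)"
  proof (intro AE_I2)
    fix \<omega>
    have "\<bar>X \<omega>\<bar> ^ k \<le> 1 + \<bar>X \<omega>\<bar> ^ 4"
    proof (cases "\<bar>X \<omega>\<bar> \<le> 1")
      case True
      then have "\<bar>X \<omega>\<bar> ^ k \<le> 1" by (simp add: power_le_one)
      then show ?thesis by (smt (verit) zero_le_power abs_ge_zero)
    next
      case False
      then have "\<bar>X \<omega>\<bar> ^ k \<le> \<bar>X \<omega>\<bar> ^ 4" using k by (intro power_increasing) auto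
      then show ?thesis by simp
    qed
    then show "norm (X \<omega> ^ k) \<le> norm (1 + X \<omega> ^ 4)" by (simp add: power_abs)
  qed
qed measurable

lemma indep_var_power_mult:
  fixes X Y :: "'a \<Rightarrow> real"
  assumes ind: "indep_var borel X borel Y"
    and X: "integrable M (\<lambda>\<omega>. X \<omega> ^ a)" and Y: "integrable M (\<lambda>\<omega>. Y \<omega> ^ b)"
  shows "expectation (\<lambda>\<omega>. X \<omega> ^ a * Y \<omega> ^ b) = expectation (\<lambda>\<omega>. X \<omega> ^ a) * expectation (\<lambda>\<omega>. Y \<omega> ^ b)"
    and "integrable M (\<lambda>\<omega>. X \<omega> ^ a * Y \<omega> ^ b)"
proof -
  have "indep_var borel ((\<lambda>x. x ^ a) \<circ> X) borel ((\<lambda>x. x ^ b) \<circ> Y)"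
    by (rule indep_var_compose[OF ind]) auto
  then have i: "indep_var borel (\<lambda>\<omega>. X \<omega> ^ a) borel (\<lambda>\<omega>. Y \<omega> ^ b)" by (simp add: comp_def)
  show "expectation (\<lambda>\<omega>. X \<omega> ^ a * Y \<omega> ^ b) = expectation (\<lambda>\<omega>. X \<omega> ^ a) * expectation (\<lambda>\<omega>. Y \<omega> ^ b)"
    by (rule indep_var_lebesgue_integral[OF i X Y])
  show "integrable M (\<lambda>\<omega>. X \<omega> ^ a * Y \<omega> ^ b)"
    by (rule indep_var_integrable[OF i X Y])
qed

text \<open>Induction adding one summand: in the expanded fourth power the terms with an odd power
  of a centred independent factor vanish. The fourth moment is used because the variance would leave
  tails of order 1/n, which are not summable. The second moment is carried along to bound the mixed
  term.\<close>

lemma fourth_moment_sum_le: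
  fixes X :: "nat \<Rightarrow> 'a \<Rightarrow> real"
  assumes ind: "indep_vars (\<lambda>_. borel) X {..<n}"
    and int: "\<And>i. i < n \<Longrightarrow> integrable M (\<lambda>\<omega>. X i \<omega> ^ 4)"
    and mean: "\<And>i. i < n \<Longrightarrow> expectation (X i) = 0"
    and B2: "\<And>i. i < n \<Longrightarrow> expectation (\<lambda>\<omega>. X i \<omega> ^ 2) \<le> B"
    and B4: "\<And>i. i < n \<Longrightarrow> expectation (\<lambda>\<omega>. X i \<omega> ^ 4) \<le> B"
    and k: "k \<le> n"
  shows "integrable M (\<lambda>\<omega>. (\<Sum>i<k. X i \<omega>) ^ 4) \<and> expectation (\<lambda>\<omega>. \<Sum>i<k. X i \<omega>) = 0
    \<and> expectation (\<lambda>\<omega>. (\<Sum>i<k. X i \<omega>) ^ 2) \<le> real k * B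
    \<and> expectation (\<lambda>\<omega>. (\<Sum>i<k. X i \<omega>) ^ 4) \<le> (real k)\<^sup>2 * (3 * B\<^sup>2 + B)"
  using k
proof (induction k)
  case (Suc k)
  then have k: "k < n" by simp
  let ?S = "\<lambda>\<omega>. \<Sum>i<k. X i \<omega>" and ?X = "X k"
  have rv [measurable]: "X i \<in> borel_measurable M" if "i < n" for i
    using indep_vars_def[THEN iffD1, OF ind] that by auto
  have [measurable]: "?X \<in> borel_measurable M" using k by (rule rv)
  have [measurable]: "?S \<in> borel_measurable M" using k by (intro borel_measurable_sum rv) auto
  from Suc have IH: "integrable M (\<lambda>\<omega>. ?S \<omega> ^ 4)" "expectation ?S = 0"
    "expectation (\<lambda>\<omega>. ?S \<omega> ^ 2) \<le> real k * B" "expectation (\<lambda>\<omega>. ?S \<omega> ^ 4) \<le> (real k)\<^sup>2 * (3 * B\<^sup>2 + B)"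
    by auto
  have i: "indep_var borel ?X borel ?S"
    using k by (intro indep_vars_sum indep_vars_subset[OF ind]) auto
  have Sp: "integrable M (\<lambda>\<omega>. ?S \<omega> ^ a)" if "a \<le> 4" for a
    by (rule integrable_power_le4[OF _ IH(1) that]) measurable
  have Xp: "integrable M (\<lambda>\<omega>. ?X \<omega> ^ a)" if "a \<le> 4" for a
    by (rule integrable_power_le4[OF _ int[OF k] that]) measurable
  have XS: "expectation (\<lambda>\<omega>. ?X \<omega> ^ a * ?S \<omega> ^ b) = expectation (\<lambda>\<omega>. ?X \<omega> ^ a) * expectation (\<lambda>\<omega>. ?S \<omega> ^ b)"
    "integrable M (\<lambda>\<omega>. ?X \<omega> ^ a * ?S \<omega> ^ b)" if "a \<le> 4" "b \<le> 4" for a b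
    using indep_var_power_mult[OF i Xp Sp] that by auto
  have e4: "(\<Sum>i<Suc k. X i \<omega>) ^ 4 = ?S \<omega> ^ 4 + 4 * (?X \<omega> ^ 1 * ?S \<omega> ^ 3) + 6 * (?X \<omega> ^ 2 * ?S \<omega> ^ 2)
      + 4 * (?X \<omega> ^ 3 * ?S \<omega> ^ 1) + ?X \<omega> ^ 4" for \<omega>
    by (simp add: power4_eq_xxxx power3_eq_cube power2_eq_square algebra_simps)
  have e2: "(\<Sum>i<Suc k. X i \<omega>) ^ 2 = ?S \<omega> ^ 2 + 2 * (?X \<omega> ^ 1 * ?S \<omega> ^ 1) + ?X \<omega> ^ 2" for \<omega>
    by (simp add: power2_eq_square algebra_simps)
  have m: "expectation (\<lambda>\<omega>. ?X \<omega> ^ 1) = 0" "expectation (\<lambda>\<omega>. ?S \<omega> ^ 1) = 0" using mean[OF k] IH(2) by auto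
  have "integrable M (\<lambda>\<omega>. (\<Sum>i<Suc k. X i \<omega>) ^ 4)"
    unfolding e4 by (intro Bochner_Integration.integrable_add integrable_mult_right XS(2) Sp Xp) auto
  moreover have "expectation (\<lambda>\<omega>. \<Sum>i<Suc k. X i \<omega>) = 0"
    using Xp[of 1] Sp[of 1] mean[OF k] IH(2) by simp
  moreover have "expectation (\<lambda>\<omega>. (\<Sum>i<Suc k. X i \<omega>) ^ 2) \<le> real (Suc k) * B"
  proof -
    have "expectation (\<lambda>\<omega>. (\<Sum>i<Suc k. X i \<omega>) ^ 2) = expectation (\<lambda>\<omega>. ?S \<omega> ^ 2) + 2 * expectation (\<lambda>\<omega>. ?X \<omega> ^ 1 * ?S \<omega> ^ 1) + expectation (\<lambda>\<omega>. ?X \<omega> ^ 2)"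
      unfolding e2 using XS(2)[of 1 1] Sp[of 2] Xp[of 2] by simp
    also have "\<dots> = expectation (\<lambda>\<omega>. ?S \<omega> ^ 2) + expectation (\<lambda>\<omega>. ?X \<omega> ^ 2)"
      using XS(1)[of 1 1] m by simp
    finally show ?thesis using IH(3) B2[OF k] by (simp add: algebra_simps)
  qed
  moreover have "expectation (\<lambda>\<omega>. (\<Sum>i<Suc k. X i \<omega>) ^ 4) \<le> (real (Suc k))\<^sup>2 * (3 * B\<^sup>2 + B)"
  proof -
    have "expectation (\<lambda>\<omega>. (\<Sum>i<Suc k. X i \<omega>) ^ 4) = expectation (\<lambda>\<omega>. ?S \<omega> ^ 4)
        + 4 * expectation (\<lambda>\<omega>. ?X \<omega> ^ 1 * ?S \<omega> ^ 3) + 6 * expectation (\<lambda>\<omega>. ?X \<omega> ^ 2 * ?S \<omega> ^ 2)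
        + 4 * expectation (\<lambda>\<omega>. ?X \<omega> ^ 3 * ?S \<omega> ^ 1) + expectation (\<lambda>\<omega>. ?X \<omega> ^ 4)"
      unfolding e4 using XS(2)[of 1 3] XS(2)[of 2 2] XS(2)[of 3 1] Sp[of 4] Xp[of 4] by simp
    also have "expectation (\<lambda>\<omega>. ?X \<omega> ^ 1 * ?S \<omega> ^ 3) = 0" using XS(1)[of 1 3] m(1) by simp
    also have "expectation (\<lambda>\<omega>. ?X \<omega> ^ 3 * ?S \<omega> ^ 1) = 0" using XS(1)[of 3 1] m(2) by simp
    also have "expectation (\<lambda>\<omega>. ?X \<omega> ^ 2 * ?S \<omega> ^ 2) \<le> B * (real k * B)"
    proof -
      have x: "0 \<le> expectation (\<lambda>\<omega>. ?X \<omega> ^ 2)" "0 \<le> expectation (\<lambda>\<omega>. ?S \<omega> ^ 2)" by auto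
      show ?thesis using XS(1)[of 2 2] B2[OF k] IH(3) x by (auto intro!: mult_mono order.trans[OF x(1) B2[OF k]])
    qed
    finally have "expectation (\<lambda>\<omega>. (\<Sum>i<Suc k. X i \<omega>) ^ 4) \<le> (real k)\<^sup>2 * (3 * B\<^sup>2 + B) + 6 * (B * (real k * B)) + B"
      using IH(4) B4[OF k] by simp
    \<comment> \<open>The increment of k^2 is 2 k + 1; times 3 B^2 it covers the mixed term 6 k B^2,
      and times B it covers the new fourth moment.\<close>
    also have "\<dots> \<le> (real (Suc k))\<^sup>2 * (3 * B\<^sup>2 + B)"
    proof -
      have "0 \<le> B" using order.trans[OF _ B4[OF k]] by (simp add: Bochner_Integration.integral_nonneg)
      then show ?thesis by (simp add: power2_eq_square algebra_simps)
    qed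
    finally show ?thesis .
  qed
  ultimately show ?case by blast
qed simp

end

section \<open>Tail bounds for averages over Gaussian coordinates\<close>

lemma gauss_Pi_component: "i < n \<Longrightarrow> distr (gauss_Pi n) (mu 2) (\<lambda>y. y i) = mu 2"
  using distr_PiM_component[of "{..<n}" "\<lambda>_. mu 2" i] prob_space_mu_2 by auto

lemma gauss_Pi_indep_vars:
  assumes f: "f \<in> borel_measurable borel"
  shows "prob_space.indep_vars (gauss_Pi n) (\<lambda>_. borel) (\<lambda>i y. f (y i) :: real) {..<n}"
proof (cases "n = 0")
  case True
  interpret prob_space "gauss_Pi n" by (rule prob_space_gauss_Pi)
  show ?thesis unfolding indep_vars_def indep_sets_def using True by auto
next
  case False
  interpret prob_space "gauss_Pi n" by (rule prob_space_gauss_Pi)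
  have "indep_vars (\<lambda>_. mu 2) (\<lambda>i y. y i) {..<n}"
  proof (subst indep_vars_iff_distr_eq_PiM')
    have "distr (gauss_Pi n) (gauss_Pi n) (\<lambda>x. \<lambda>i\<in>{..<n}. x i) = distr (gauss_Pi n) (gauss_Pi n) (\<lambda>x. x)"
      by (intro distr_cong) (auto simp: space_PiM PiE_iff fun_eq_iff extensional_def restrict_def)
    also have "\<dots> = gauss_Pi n" by simp
    also have "\<dots> = (\<Pi>\<^sub>M i\<in>{..<n}. distr (gauss_Pi n) (mu 2) (\<lambda>y. y i))"
      by (intro PiM_cong) (auto simp: gauss_Pi_component)
    finally show "distr (gauss_Pi n) (gauss_Pi n) (\<lambda>x. \<lambda>i\<in>{..<n}. x i) = (\<Pi>\<^sub>M i\<in>{..<n}. distr (gauss_Pi n) (mu 2) (\<lambda>y. y i))" .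
  qed (use False in auto)
  from indep_vars_compose2[OF this, of "\<lambda>_. f" "\<lambda>_. borel"] f show ?thesis by simp
qed

text \<open>Markov's inequality for the fourth power of the centred sum: a moment of order n^2
  against a threshold of order n^4.\<close>

lemma gauss_Pi_average_tail:
  fixes f :: "real \<Rightarrow> real"
  assumes f [measurable]: "f \<in> borel_measurable borel" and f4: "integrable (mu 2) (\<lambda>u. f u ^ 4)"
  shows "\<exists>C\<ge>0. \<forall>n\<ge>1. \<forall>\<epsilon>>0. measure (gauss_Pi n)
      {y \<in> space (gauss_Pi n). \<epsilon> \<le> \<bar>(\<Sum>i<n. f (y i)) / real n - (\<integral>u. f u \<partial>mu 2)\<bar>} \<le> C / \<epsilon> ^ 4 * (1 / (real n)\<^sup>2)"
proof -
  define m where "m = (\<integral>u. f u \<partial>mu 2)"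
  define g where "g u = f u - m" for u
  have [measurable]: "g \<in> borel_measurable borel" unfolding g_def[abs_def] by measurable
  have fp: "integrable (mu 2) (\<lambda>u. f u ^ a)" if "a \<le> 4" for a
    by (rule mu_2.integrable_power_le4[OF _ f4 that]) simp
  have g4: "integrable (mu 2) (\<lambda>u. g u ^ 4)"
  proof -
    have "g u ^ 4 = f u ^ 4 - 4 * m * f u ^ 3 + 6 * m\<^sup>2 * f u ^ 2 - 4 * m ^ 3 * f u ^ 1 + m ^ 4" for u
      by (simp add: g_def power4_eq_xxxx power3_eq_cube power2_eq_square algebra_simps)
    then show ?thesis using fp[of 4] fp[of 3] fp[of 2] fp[of 1] by simp
  qed
  have g0: "(\<integral>u. g u \<partial>mu 2) = 0"
    using fp[of 1] mu_2.prob_space by (simp add: g_def m_def)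
  \<comment> \<open>One number bounding both the second and the fourth central moment, as the moment
    lemma expects.\<close>
  define B where "B = max (\<integral>u. g u ^ 2 \<partial>mu 2) (\<integral>u. g u ^ 4 \<partial>mu 2)"
  define C where "C = 3 * B\<^sup>2 + B"
  have B0: "0 \<le> B" unfolding B_def by (intro max.coboundedI1) simp
  then have C0: "0 \<le> C" by (simp add: C_def)
  have "measure (gauss_Pi n) {y \<in> space (gauss_Pi n). \<epsilon> \<le> \<bar>(\<Sum>i<n. f (y i)) / real n - m\<bar>} \<le> C / \<epsilon> ^ 4 * (1 / (real n)\<^sup>2)"
    if n: "1 \<le> n" and e: "0 < \<epsilon>" for n :: nat and \<epsilon> :: real
  proof -
    interpret G: prob_space "gauss_Pi n" by (rule prob_space_gauss_Pi)
    have comp: "(\<integral>y. h (y i) \<partial>gauss_Pi n) = (\<integral>u. h u \<partial>mu 2)" "integrable (gauss_Pi n) (\<lambda>y. h (y i)) \<longleftrightarrow> integrable (mu 2) h"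
      if "i < n" "h \<in> borel_measurable borel" for i and h :: "real \<Rightarrow> real"
    proof -
      have c: "(\<lambda>y. y i) \<in> gauss_Pi n \<rightarrow>\<^sub>M mu 2" using that by (intro measurable_component_singleton) auto
      show "(\<integral>y. h (y i) \<partial>gauss_Pi n) = (\<integral>u. h u \<partial>mu 2)"
        using integral_distr[OF c, of h] that by (simp add: gauss_Pi_component)
      show "integrable (gauss_Pi n) (\<lambda>y. h (y i)) \<longleftrightarrow> integrable (mu 2) h"
        using integrable_distr_eq[OF c, of h] that by (simp add: gauss_Pi_component)
    qed
    have fm: "integrable (gauss_Pi n) (\<lambda>y. (\<Sum>i<n. g (y i)) ^ 4) \<and> G.expectation (\<lambda>y. \<Sum>i<n. g (y i)) = 0
      \<and> G.expectation (\<lambda>y. (\<Sum>i<n. g (y i)) ^ 2) \<le> real n * B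
      \<and> G.expectation (\<lambda>y. (\<Sum>i<n. g (y i)) ^ 4) \<le> (real n)\<^sup>2 * (3 * B\<^sup>2 + B)"
    proof (rule G.fourth_moment_sum_le[where n = n])
      show "G.indep_vars (\<lambda>_. borel) (\<lambda>i y. g (y i)) {..<n}" by (rule gauss_Pi_indep_vars) simp
      fix i assume i: "i < n"
      show "integrable (gauss_Pi n) (\<lambda>y. g (y i) ^ 4)" using comp(2)[OF i, of "\<lambda>u. g u ^ 4"] g4 by simp
      show "G.expectation (\<lambda>y. g (y i)) = 0" using comp(1)[OF i, of g] g0 by simp
      show "G.expectation (\<lambda>y. g (y i) ^ 2) \<le> B" using comp(1)[OF i, of "\<lambda>u. g u ^ 2"] by (simp add: B_def)
      show "G.expectation (\<lambda>y. g (y i) ^ 4) \<le> B" using comp(1)[OF i, of "\<lambda>u. g u ^ 4"] by (simp add: B_def)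
    qed simp
    have pos: "0 < (real n * \<epsilon>) ^ 4" using n e by simp
    have "{y \<in> space (gauss_Pi n). \<epsilon> \<le> \<bar>(\<Sum>i<n. f (y i)) / real n - m\<bar>}
        = {y \<in> space (gauss_Pi n). (real n * \<epsilon>) ^ 4 \<le> (\<Sum>i<n. g (y i)) ^ 4}"
    proof (intro Collect_cong conj_cong refl)
      fix y :: "nat \<Rightarrow> real"
      have "(\<Sum>i<n. f (y i)) / real n - m = (\<Sum>i<n. g (y i)) / real n"
        using n by (simp add: g_def sum_subtractf field_simps)
      then have "\<epsilon> \<le> \<bar>(\<Sum>i<n. f (y i)) / real n - m\<bar> \<longleftrightarrow> real n * \<epsilon> \<le> \<bar>\<Sum>i<n. g (y i)\<bar>"
        using n by (simp add: field_simps)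
      also have "\<dots> \<longleftrightarrow> (real n * \<epsilon>) ^ 4 \<le> \<bar>\<Sum>i<n. g (y i)\<bar> ^ 4"
        using n e by (subst power_mono_iff) auto
      finally show "\<epsilon> \<le> \<bar>(\<Sum>i<n. f (y i)) / real n - m\<bar> \<longleftrightarrow> (real n * \<epsilon>) ^ 4 \<le> (\<Sum>i<n. g (y i)) ^ 4"
        by (simp add: power_even_abs)
    qed
    then have "measure (gauss_Pi n) {y \<in> space (gauss_Pi n). \<epsilon> \<le> \<bar>(\<Sum>i<n. f (y i)) / real n - m\<bar>}
        \<le> G.expectation (\<lambda>y. (\<Sum>i<n. g (y i)) ^ 4) / (real n * \<epsilon>) ^ 4"
      using integral_Markov_inequality_measure[OF conjunct1[OF fm] sets.empty_sets _ pos] by simp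
    also have "\<dots> \<le> (real n)\<^sup>2 * C / (real n * \<epsilon>) ^ 4"
      using fm pos unfolding C_def by (intro divide_right_mono) auto
    also have "\<dots> = C / \<epsilon> ^ 4 * (1 / (real n)\<^sup>2)"
      using n e by (simp add: field_simps power_mult_distrib power4_eq_xxxx power2_eq_square)
    finally show ?thesis .
  qed
  then show ?thesis using C0 unfolding m_def by blast
qed

section \<open>Almost sure convergence along random directions\<close>

text \<open>The numbers sqrt n times the coordinates of a unit vector have mean square 1. For a
  random direction they imitate standard Gaussians, so this is the empirical version of
  \<open>avg_log_mgf\<close>.\<close>

definition emp_log_mgf :: "real \<Rightarrow> nat \<Rightarrow> (nat \<Rightarrow> real) \<Rightarrow> real \<Rightarrow> real" where
  "emp_log_mgf p n a x = (\<Sum>i<n. log_mgf p (x * (sqrt (real n) * a i))) / real n"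

lemma emp_log_mgf_cong: "(\<And>i. i < n \<Longrightarrow> a i = b i) \<Longrightarrow> emp_log_mgf p n a x = emp_log_mgf p n b x"
  unfolding emp_log_mgf_def by (intro arg_cong2[where f = "(/)"] sum.cong) auto

context
  fixes p :: real
  assumes p: "1 < p"
begin

lemma emp_log_mgf_mono: "\<bar>x\<bar> \<le> \<bar>x'\<bar> \<Longrightarrow> emp_log_mgf p n a x \<le> emp_log_mgf p n a x'"
  unfolding emp_log_mgf_def
  by (intro divide_right_mono sum_mono log_mgf_mono[OF p]) (auto simp: abs_mult mult_right_mono)

lemma emp_log_mgf_minus: "emp_log_mgf p n a (- x) = emp_log_mgf p n a x"
  using emp_log_mgf_mono[of x "- x" n a] emp_log_mgf_mono[of "- x" x n a] by simp

lemma emp_log_mgf_measurable: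
  assumes "\<And>i. i < n \<Longrightarrow> (\<lambda>\<omega>. a \<omega> i) \<in> borel_measurable M"
  shows "(\<lambda>\<omega>. emp_log_mgf p n (a \<omega>) x) \<in> borel_measurable M"
  unfolding emp_log_mgf_def using assms borel_measurable_log_mgf[OF p] by measurable

text \<open>Normalising y multiplies its coordinates by a factor s close to 1, and monotonicity of
  \<open>log_mgf\<close> in the modulus traps the value between those for the fixed factors 1 -
  \<eta> and 1 + \<eta>. The outer sums have i.i.d. summands when y is Gaussian.\<close>

lemma emp_log_mgf_normalized_bounds:
  fixes y :: "nat \<Rightarrow> real"
  assumes n: "1 \<le> n" and \<eta>: "0 < \<eta>" "\<eta> \<le> 1"
    and near: "\<bar>(\<Sum>i<n. (y i)\<^sup>2) / real n - 1\<bar> < \<eta> / 2"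
  defines "N \<equiv> L2_set y {..<n}"
  shows "(\<Sum>i<n. log_mgf p (x * (1 - \<eta>) * y i)) / real n \<le> emp_log_mgf p n (\<lambda>i. y i / N) x"
    and "emp_log_mgf p n (\<lambda>i. y i / N) x \<le> (\<Sum>i<n. log_mgf p (x * (1 + \<eta>) * y i)) / real n"
proof -
  define q where "q = N\<^sup>2 / real n"
  have q: "\<bar>q - 1\<bar> < \<eta> / 2" using near by (simp add: q_def N_def L2_set_def sum_nonneg)
  have q': "1 - \<eta> / 2 \<le> q" "q \<le> 1 + \<eta> / 2" using q by linarith+
  then have qpos: "0 < q" using \<eta> by linarith
  have N: "0 < N"
  proof -
    have "N \<noteq> 0" using qpos by (auto simp: q_def)
    moreover have "0 \<le> N" unfolding N_def by (rule L2_set_nonneg)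
    ultimately show ?thesis by linarith
  qed
  define s where "s = sqrt (real n) / N"
  have s0: "0 < s" using N n by (simp add: s_def)
  \<comment> \<open>The scaling factor is the inverse square root of the mean square q, so bounds on
    q become bounds on s.\<close>
  have s2: "s\<^sup>2 * q = 1" using N n by (simp add: s_def q_def power_divide)
  have s_le: "s \<le> 1 + \<eta>"
  proof (rule ccontr)
    assume "\<not> s \<le> 1 + \<eta>"
    then have "(1 + \<eta>)\<^sup>2 < s\<^sup>2" using \<eta> by (intro power_strict_mono) auto
    then have "(1 + \<eta>)\<^sup>2 * q < 1" using qpos s2 by (metis mult_strict_right_mono)
    moreover have "(1 + \<eta>)\<^sup>2 * (1 - \<eta> / 2) \<le> (1 + \<eta>)\<^sup>2 * q" using q' by (intro mult_left_mono) auto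
    \<comment> \<open>The product equals 1 + 3\<eta>/2 - \<eta>^3/2, and \<eta>^3 \<le>
      \<eta>.\<close>
    moreover have "1 \<le> (1 + \<eta>)\<^sup>2 * (1 - \<eta> / 2)"
    proof -
      have "\<eta> * \<eta> * \<eta> \<le> \<eta> * 1 * 1" using \<eta> by (intro mult_mono) auto
      then show ?thesis using \<eta> by (simp add: power2_eq_square algebra_simps)
    qed
    ultimately show False by linarith
  qed
  have s_ge: "1 - \<eta> \<le> s"
  proof (rule ccontr)
    assume "\<not> 1 - \<eta> \<le> s"
    then have "s\<^sup>2 < (1 - \<eta>)\<^sup>2" using s0 by (intro power_strict_mono) auto
    then have "1 < (1 - \<eta>)\<^sup>2 * q" using qpos s2 by (metis mult_strict_right_mono)
    moreover have "(1 - \<eta>)\<^sup>2 * q \<le> (1 - \<eta>)\<^sup>2 * (1 + \<eta> / 2)" using q' by (intro mult_left_mono) auto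
    moreover have "(1 - \<eta>)\<^sup>2 * (1 + \<eta> / 2) \<le> 1"
    proof -
      have "\<eta> * \<eta> * \<eta> \<le> \<eta> * 1 * 1" using \<eta> by (intro mult_mono) auto
      then show ?thesis using \<eta> by (simp add: power2_eq_square algebra_simps)
    qed
    ultimately show False by linarith
  qed
  have eq: "x * (sqrt (real n) * (y i / N)) = x * s * y i" for i by (simp add: s_def)
  have lo: "\<bar>x * (1 - \<eta>) * y i\<bar> \<le> \<bar>x * s * y i\<bar>" and up: "\<bar>x * s * y i\<bar> \<le> \<bar>x * (1 + \<eta>) * y i\<bar>" for i
  proof -
    have "\<bar>1 - \<eta>\<bar> \<le> \<bar>s\<bar>" "\<bar>s\<bar> \<le> \<bar>1 + \<eta>\<bar>" using s_le s_ge s0 \<eta> by auto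
    then show "\<bar>x * (1 - \<eta>) * y i\<bar> \<le> \<bar>x * s * y i\<bar>" "\<bar>x * s * y i\<bar> \<le> \<bar>x * (1 + \<eta>) * y i\<bar>"
      by (auto simp: abs_mult intro!: mult_right_mono mult_left_mono)
  qed
  show "(\<Sum>i<n. log_mgf p (x * (1 - \<eta>) * y i)) / real n \<le> emp_log_mgf p n (\<lambda>i. y i / N) x"
    unfolding emp_log_mgf_def eq using lo by (intro divide_right_mono sum_mono log_mgf_mono[OF p]) auto
  show "emp_log_mgf p n (\<lambda>i. y i / N) x \<le> (\<Sum>i<n. log_mgf p (x * (1 + \<eta>) * y i)) / real n"
    unfolding emp_log_mgf_def eq using up by (intro divide_right_mono sum_mono log_mgf_mono[OF p]) auto
qed

section \<open>Cones of atypical directions\<close>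

lemma avg_log_mgf_near:
  assumes "0 < e"
  obtains d where "0 < d" "\<And>x'. \<bar>x' - x\<bar> < d \<Longrightarrow> \<bar>avg_log_mgf p x' - avg_log_mgf p x\<bar> < e"
proof -
  have "isCont (avg_log_mgf p) x"
    using continuous_avg_log_mgf[OF p, of UNIV] by (simp add: continuous_on_eq_continuous_at)
  then show ?thesis using assms that unfolding continuous_at_eps_delta dist_real_def by blast
qed

text \<open>The normalisation makes membership depend on the direction of y only, and the strict
  inequalities provide the openness needed for comparison with a Gaussian direction.\<close>

definition dev_cone :: "nat \<Rightarrow> real \<Rightarrow> real \<Rightarrow> (nat \<Rightarrow> real) set" where
  "dev_cone n x \<epsilon> = {y \<in> space (lborel_Pi n). 0 < L2_set y {..<n} \<and>
     \<epsilon> < \<bar>emp_log_mgf p n (\<lambda>i. y i / L2_set y {..<n}) x - avg_log_mgf p x\<bar>}"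

lemma sets_dev_cone: "dev_cone n x \<epsilon> \<in> sets (lborel_Pi n)"
proof -
  have [measurable]: "(\<lambda>y. emp_log_mgf p n (\<lambda>i. y i / L2_set y {..<n}) x) \<in> borel_measurable (lborel_Pi n)"
    by (intro emp_log_mgf_measurable) measurable
  show ?thesis unfolding dev_cone_def by measurable
qed

lemma dev_cone_scale:
  assumes c: "0 < c" and y: "y \<in> space (lborel_Pi n)"
  shows "(\<lambda>i\<in>{..<n}. c * y i) \<in> dev_cone n x \<epsilon> \<longleftrightarrow> y \<in> dev_cone n x \<epsilon>"
proof -
  have L: "L2_set (\<lambda>i\<in>{..<n}. c * y i) {..<n} = c * L2_set y {..<n}"
    using c by (simp add: L2_set_scale del: restrict_apply)
  have "emp_log_mgf p n (\<lambda>i. (\<lambda>i\<in>{..<n}. c * y i) i / (c * L2_set y {..<n})) x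
      = emp_log_mgf p n (\<lambda>i. y i / L2_set y {..<n}) x"
    using c by (intro emp_log_mgf_cong) auto
  moreover have "(\<lambda>i\<in>{..<n}. c * y i) \<in> space (lborel_Pi n)" by (simp add: space_PiM)
  ultimately show ?thesis using c y unfolding dev_cone_def mem_Collect_eq L by (simp add: zero_less_mult_iff del: restrict_apply)
qed

text \<open>The normalised vector and the finitely many values of \<open>log_mgf\<close> vary
  continuously near a unit vector; the argument is by sequences converging to \<theta> in every
  coordinate.\<close>

lemma dev_cone_open:
  assumes \<theta>: "L2_set \<theta> {..<n} = 1" and dev: "\<epsilon> < \<bar>emp_log_mgf p n \<theta> x - avg_log_mgf p x\<bar>"
  shows "\<exists>r>0. \<forall>y\<in>space (lborel_Pi n). L2_set (\<lambda>i. y i - \<theta> i) {..<n} < r \<longrightarrow> y \<in> dev_cone n x \<epsilon>"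
proof (rule ccontr)
  assume "\<not> ?thesis"
  then have "\<forall>k::nat. \<exists>y\<in>space (lborel_Pi n). L2_set (\<lambda>i. y i - \<theta> i) {..<n} < inverse (real (Suc k)) \<and> y \<notin> dev_cone n x \<epsilon>"
    by (metis inverse_positive_iff_positive of_nat_0_less_iff zero_less_Suc)
  then obtain Y where Y: "\<And>k. Y k \<in> space (lborel_Pi n)"
    "\<And>k. L2_set (\<lambda>i. Y k i - \<theta> i) {..<n} < inverse (real (Suc k))" "\<And>k. Y k \<notin> dev_cone n x \<epsilon>"
    by metis
  have lim: "(\<lambda>k. Y k i) \<longlonglongrightarrow> \<theta> i" if "i < n" for i
  proof (rule LIM_zero_cancel, rule Lim_null_comparison[OF _ LIMSEQ_inverse_real_of_nat])
    show "\<forall>\<^sub>F k in sequentially. norm (Y k i - \<theta> i) \<le> inverse (real (Suc k))"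
    proof (intro always_eventually allI)
      fix k
      have "\<bar>Y k i - \<theta> i\<bar> \<le> L2_set (\<lambda>i. Y k i - \<theta> i) {..<n}"
        using abs_le_L2_set[of "{..<n}" i "\<lambda>i. Y k i - \<theta> i"] that by simp
      then show "norm (Y k i - \<theta> i) \<le> inverse (real (Suc k))" using Y(2)[of k] by simp
    qed
  qed
  have "(\<lambda>k. sqrt (\<Sum>i<n. (Y k i)\<^sup>2)) \<longlonglongrightarrow> sqrt (\<Sum>i<n. (\<theta> i)\<^sup>2)"
    using lim by (intro tendsto_intros) auto
  then have N: "(\<lambda>k. L2_set (Y k) {..<n}) \<longlonglongrightarrow> 1"
    using \<theta> by (simp add: L2_set_def)
  have "(\<lambda>k. (\<Sum>i<n. log_mgf p (x * (sqrt (real n) * (Y k i / L2_set (Y k) {..<n})))))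
      \<longlonglongrightarrow> (\<Sum>i<n. log_mgf p (x * (sqrt (real n) * \<theta> i)))"
  proof (rule tendsto_sum)
    fix i assume "i \<in> {..<n}"
    then have "(\<lambda>k. x * (sqrt (real n) * (Y k i / L2_set (Y k) {..<n}))) \<longlonglongrightarrow> x * (sqrt (real n) * (\<theta> i / 1))"
      using lim N by (intro tendsto_intros) auto
    then show "(\<lambda>k. log_mgf p (x * (sqrt (real n) * (Y k i / L2_set (Y k) {..<n})))) \<longlonglongrightarrow> log_mgf p (x * (sqrt (real n) * \<theta> i))"
      using continuous_log_mgf[OF p, of UNIV] by (intro continuous_on_tendsto_compose[of UNIV "log_mgf p"]) simp_all
  qed
  then have "(\<lambda>k. emp_log_mgf p n (\<lambda>i. Y k i / L2_set (Y k) {..<n}) x) \<longlonglongrightarrow> emp_log_mgf p n \<theta> x"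
    unfolding emp_log_mgf_def divide_inverse[of _ "real n"] by (rule tendsto_mult_right)
  then have "(\<lambda>k. \<bar>emp_log_mgf p n (\<lambda>i. Y k i / L2_set (Y k) {..<n}) x - avg_log_mgf p x\<bar>)
      \<longlonglongrightarrow> \<bar>emp_log_mgf p n \<theta> x - avg_log_mgf p x\<bar>" by (intro tendsto_intros)
  then have "\<forall>\<^sub>F k in sequentially. \<epsilon> < \<bar>emp_log_mgf p n (\<lambda>i. Y k i / L2_set (Y k) {..<n}) x - avg_log_mgf p x\<bar>"
    using dev by (rule order_tendstoD)
  moreover have "\<forall>\<^sub>F k in sequentially. 0 < L2_set (Y k) {..<n}" using N by (rule order_tendstoD) simp
  ultimately have "\<forall>\<^sub>F k in sequentially. Y k \<in> dev_cone n x \<epsilon>"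
    by eventually_elim (use Y(1) in \<open>auto simp: dev_cone_def\<close>)
  then show False using Y(3) by simp
qed

lemma gauss_Pi_dev_cone:
  assumes \<epsilon>: "0 < \<epsilon>"
  shows "\<exists>C\<ge>0. \<forall>n\<ge>1. measure (gauss_Pi n) (dev_cone n x \<epsilon>) \<le> C * (1 / (real n)\<^sup>2)"
proof -
  have bm [measurable]: "log_mgf p \<in> borel_measurable borel" by (rule borel_measurable_log_mgf[OF p])
  obtain d where d: "0 < d" "\<And>x'. \<bar>x' - x\<bar> < d \<Longrightarrow> \<bar>avg_log_mgf p x' - avg_log_mgf p x\<bar> < \<epsilon> / 2"
    using avg_log_mgf_near[OF half_gt_zero[OF \<epsilon>], of x] by blast
  \<comment> \<open>Small enough that x (1 - \<eta>) and x (1 + \<eta>) stay within d of x; the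
    summand 1 avoids division by zero at x = 0, and the bound 1 is required by the sandwich.\<close>
  define \<eta> where "\<eta> = min 1 (d / (2 * (\<bar>x\<bar> + 1)))"
  have \<eta>: "0 < \<eta>" "\<eta> \<le> 1" using d(1) by (auto simp: \<eta>_def)
  have x\<eta>: "\<bar>x\<bar> * \<eta> < d"
  proof -
    have "\<bar>x\<bar> * \<eta> \<le> \<bar>x\<bar> * (d / (2 * (\<bar>x\<bar> + 1)))" by (intro mult_left_mono) (auto simp: \<eta>_def)
    also have "\<dots> < d" using d(1) by (simp add: field_simps) (smt (verit) mult_nonneg_nonneg abs_ge_zero)
    finally show ?thesis .
  qed
  have near: "\<bar>avg_log_mgf p (x * (1 - \<eta>)) - avg_log_mgf p x\<bar> < \<epsilon> / 2" "\<bar>avg_log_mgf p (x * (1 + \<eta>)) - avg_log_mgf p x\<bar> < \<epsilon> / 2"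
  proof -
    have "\<bar>x * (1 - \<eta>) - x\<bar> = \<bar>x\<bar> * \<eta>" "\<bar>x * (1 + \<eta>) - x\<bar> = \<bar>x\<bar> * \<eta>"
      using \<eta> by (simp_all add: algebra_simps abs_mult)
    then show "\<bar>avg_log_mgf p (x * (1 - \<eta>)) - avg_log_mgf p x\<bar> < \<epsilon> / 2" "\<bar>avg_log_mgf p (x * (1 + \<eta>)) - avg_log_mgf p x\<bar> < \<epsilon> / 2"
      using d(2) x\<eta> by simp_all
  qed
  have sq4: "integrable (mu 2) (\<lambda>u. (u\<^sup>2) ^ 4)"
    unfolding mu_2_eq power_mult[symmetric] by (rule std_normal_distribution_even_moments)
  have sq1: "(\<integral>u. u\<^sup>2 \<partial>mu 2) = 1"
    unfolding mu_2_eq using std_normal_distribution_even_moments(1)[of 1] by simp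
  obtain C1 where C1: "0 \<le> C1" "\<And>n \<epsilon>. 1 \<le> n \<Longrightarrow> 0 < \<epsilon> \<Longrightarrow> measure (gauss_Pi n)
      {y \<in> space (gauss_Pi n). \<epsilon> \<le> \<bar>(\<Sum>i<n. (y i)\<^sup>2) / real n - 1\<bar>} \<le> C1 / \<epsilon> ^ 4 * (1 / (real n)\<^sup>2)"
    using gauss_Pi_average_tail[of "\<lambda>u. u\<^sup>2"] sq4 sq1 by auto
  have "\<forall>c. \<exists>C. 0 \<le> C \<and> (\<forall>n\<ge>1. \<forall>\<epsilon>>0. measure (gauss_Pi n)
      {y \<in> space (gauss_Pi n). \<epsilon> \<le> \<bar>(\<Sum>i<n. log_mgf p (c * y i)) / real n - avg_log_mgf p c\<bar>} \<le> C / \<epsilon> ^ 4 * (1 / (real n)\<^sup>2))"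
    unfolding avg_log_mgf_def
    by (intro allI gauss_Pi_average_tail) (use integrable_log_mgf_power4_mu_2[OF p] in auto)
  from choice[OF this] obtain C2 where C2': "\<forall>c. 0 \<le> C2 c \<and> (\<forall>n\<ge>1. \<forall>\<epsilon>>0. measure (gauss_Pi n)
      {y \<in> space (gauss_Pi n). \<epsilon> \<le> \<bar>(\<Sum>i<n. log_mgf p (c * y i)) / real n - avg_log_mgf p c\<bar>} \<le> C2 c / \<epsilon> ^ 4 * (1 / (real n)\<^sup>2))"
    by blast
  have C2: "0 \<le> C2 c" "1 \<le> n \<Longrightarrow> 0 < \<epsilon> \<Longrightarrow> measure (gauss_Pi n)
      {y \<in> space (gauss_Pi n). \<epsilon> \<le> \<bar>(\<Sum>i<n. log_mgf p (c * y i)) / real n - avg_log_mgf p c\<bar>} \<le> C2 c / \<epsilon> ^ 4 * (1 / (real n)\<^sup>2)"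
    for c n \<epsilon>
    using C2' by auto
  define C where "C = C1 / (\<eta> / 2) ^ 4 + C2 (x * (1 - \<eta>)) / (\<epsilon> / 2) ^ 4 + C2 (x * (1 + \<eta>)) / (\<epsilon> / 2) ^ 4"
  have "0 \<le> C" using C1(1) C2(1) \<eta> \<epsilon> by (simp add: C_def)
  moreover have "measure (gauss_Pi n) (dev_cone n x \<epsilon>) \<le> C * (1 / (real n)\<^sup>2)" if n: "1 \<le> n" for n
  proof -
    interpret G: prob_space "gauss_Pi n" by (rule prob_space_gauss_Pi)
    let ?A = "{y \<in> space (gauss_Pi n). \<eta> / 2 \<le> \<bar>(\<Sum>i<n. (y i)\<^sup>2) / real n - 1\<bar>}"
    let ?B = "\<lambda>c. {y \<in> space (gauss_Pi n). \<epsilon> / 2 \<le> \<bar>(\<Sum>i<n. log_mgf p (c * y i)) / real n - avg_log_mgf p c\<bar>}"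
    have mA: "?A \<in> sets (gauss_Pi n)" by measurable
    have mB: "?B c \<in> sets (gauss_Pi n)" for c by measurable
    \<comment> \<open>A deviation has three possible causes: an atypical norm, too large an average
      at x (1 + \<eta>), or too small an average at x (1 - \<eta>).\<close>
    have "dev_cone n x \<epsilon> \<subseteq> ?A \<union> ?B (x * (1 - \<eta>)) \<union> ?B (x * (1 + \<eta>))"
    proof
      fix y assume y: "y \<in> dev_cone n x \<epsilon>"
      then have ys: "y \<in> space (gauss_Pi n)" by (simp add: dev_cone_def space_gauss_Pi)
      let ?N = "L2_set y {..<n}"
      let ?e = "emp_log_mgf p n (\<lambda>i. y i / ?N) x"
      have dev: "\<epsilon> < \<bar>?e - avg_log_mgf p x\<bar>" using y by (simp add: dev_cone_def)
      show "y \<in> ?A \<union> ?B (x * (1 - \<eta>)) \<union> ?B (x * (1 + \<eta>))"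
      proof (cases "\<bar>(\<Sum>i<n. (y i)\<^sup>2) / real n - 1\<bar> < \<eta> / 2")
        case True
        note b = emp_log_mgf_normalized_bounds[OF n \<eta> True, of x]
        show ?thesis
        proof (cases "avg_log_mgf p x < ?e")
          case True
          then have "\<epsilon> / 2 \<le> \<bar>(\<Sum>i<n. log_mgf p (x * (1 + \<eta>) * y i)) / real n - avg_log_mgf p (x * (1 + \<eta>))\<bar>"
            using dev near(2) b(2) by linarith
          then show ?thesis using ys by auto
        next
          case False
          then have "\<epsilon> / 2 \<le> \<bar>(\<Sum>i<n. log_mgf p (x * (1 - \<eta>) * y i)) / real n - avg_log_mgf p (x * (1 - \<eta>))\<bar>"
            using dev near(1) b(1) by linarith
          then show ?thesis using ys by auto
        qed
      qed (use ys in auto)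
    qed
    then have "measure (gauss_Pi n) (dev_cone n x \<epsilon>) \<le> measure (gauss_Pi n) (?A \<union> ?B (x * (1 - \<eta>)) \<union> ?B (x * (1 + \<eta>)))"
      using mA mB by (intro G.finite_measure_mono) auto
    also have "\<dots> \<le> measure (gauss_Pi n) ?A + measure (gauss_Pi n) (?B (x * (1 - \<eta>))) + measure (gauss_Pi n) (?B (x * (1 + \<eta>)))"
      using measure_Un_le[of "?A \<union> ?B (x * (1 - \<eta>))" "gauss_Pi n" "?B (x * (1 + \<eta>))"]
        measure_Un_le[of ?A "gauss_Pi n" "?B (x * (1 - \<eta>))"] mA mB by auto
    also have "\<dots> \<le> C1 / (\<eta> / 2) ^ 4 * (1 / (real n)\<^sup>2) + C2 (x * (1 - \<eta>)) / (\<epsilon> / 2) ^ 4 * (1 / (real n)\<^sup>2)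
        + C2 (x * (1 + \<eta>)) / (\<epsilon> / 2) ^ 4 * (1 / (real n)\<^sup>2)"
      using \<eta> \<epsilon> n by (intro add_mono C1(2) C2(2)) auto
    also have "\<dots> = C * (1 / (real n)\<^sup>2)" by (simp add: C_def algebra_simps)
    finally show ?thesis .
  qed
  ultimately show ?thesis by blast
qed

text \<open>The constant is fixed before n and M, so the bounds can be summed over the
  marginals.\<close>

lemma rotation_invariant_dev:
  assumes \<epsilon>: "0 < \<epsilon>"
  shows "\<exists>C\<ge>0. \<forall>n\<ge>1. \<forall>M. rotation_invariant_prob n M \<longrightarrow>
     measure M {\<theta> \<in> space M. \<epsilon> < \<bar>emp_log_mgf p n \<theta> x - avg_log_mgf p x\<bar>} \<le> C * (1 / (real n)\<^sup>2)"
proof -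
  obtain C where C: "0 \<le> C" "\<And>n. 1 \<le> n \<Longrightarrow> measure (gauss_Pi n) (dev_cone n x \<epsilon>) \<le> C * (1 / (real n)\<^sup>2)"
    using gauss_Pi_dev_cone[OF \<epsilon>] by blast
  have "measure M {\<theta> \<in> space M. \<epsilon> < \<bar>emp_log_mgf p n \<theta> x - avg_log_mgf p x\<bar>} \<le> C * (1 / (real n)\<^sup>2)"
    if n: "1 \<le> n" and M: "rotation_invariant_prob n M" for n M
  proof -
    let ?D = "{\<theta> \<in> space M. \<epsilon> < \<bar>emp_log_mgf p n \<theta> x - avg_log_mgf p x\<bar>}"
    have setsM: "sets M = sets (borel_of (nsphere (n - 1)))"
      using M by (auto simp: rotation_invariant_prob_def)
    interpret M: prob_space M using M by (auto simp: rotation_invariant_prob_def)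
    interpret G: prob_space "gauss_Pi n" by (rule prob_space_gauss_Pi)
    have coord: "(\<lambda>x. x i) \<in> borel_measurable M" for i
      using measurable_nsphere_coordinate measurable_cong_sets[OF setsM refl] by blast
    have [measurable]: "(\<lambda>\<theta>. emp_log_mgf p n \<theta> x) \<in> borel_measurable M"
      using coord by (intro emp_log_mgf_measurable) auto
    have "emeasure M ?D \<le> emeasure (gauss_Pi n) (dev_cone n x \<epsilon>)"
    proof (rule rotation_invariant_le_gauss_Pi[OF n M sets_dev_cone])
      show "?D \<in> sets M" by measurable
      fix \<theta> assume \<theta>: "\<theta> \<in> ?D"
      then have "\<theta> \<in> topspace (nsphere (n - 1))" using sets_eq_imp_space_eq[OF setsM] by simp
      then have "L2_set \<theta> {..<n} = 1" using topspace_nsphere_iff[OF n] by (simp add: L2_set_def)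
      then show "\<exists>r>0. \<forall>y\<in>space (lborel_Pi n). L2_set (\<lambda>i. y i - \<theta> i) {..<n} < r \<longrightarrow> y \<in> dev_cone n x \<epsilon>"
        using \<theta> by (intro dev_cone_open) auto
    qed (rule dev_cone_scale)
    then have "measure M ?D \<le> measure (gauss_Pi n) (dev_cone n x \<epsilon>)"
      by (simp add: M.emeasure_eq_measure G.emeasure_eq_measure)
    then show ?thesis using C(2)[OF n] by linarith
  qed
  then show ?thesis using C(1) by blast
qed

lemma sphere_product_projection:
  assumes n: "1 \<le> n" and sets: "sets \<sigma> = sets (borel_of sphere_product)"
  shows "(\<lambda>\<theta>. \<theta> n) \<in> \<sigma> \<rightarrow>\<^sub>M borel_of (nsphere (n - 1))"
proof -
  have "continuous_map sphere_product (nsphere (n - 1)) (\<lambda>\<theta>. \<theta> n)"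
    unfolding sphere_product_def using n by (intro continuous_map_product_projection) auto
  from continuous_map_measurable[OF this] show ?thesis using measurable_cong_sets[OF sets refl] by blast
qed

text \<open>The first Borel-Cantelli lemma needs only the probabilities of the single events, that
  is, the marginals. It gives one null set for all rational x and all tolerances 1/(k+1);
  monotonicity in \<bar>x\<bar> and continuity of the limit then extend convergence to every
  x.\<close>

lemma AE_emp_log_mgf_tendsto:
  assumes \<sigma>: "prob_space \<sigma>" and sets: "sets \<sigma> = sets (borel_of sphere_product)"
    and inv: "\<And>n. n \<ge> 1 \<Longrightarrow> rotation_invariant_prob n (distr \<sigma> (borel_of (nsphere (n - 1))) (\<lambda>\<theta>. \<theta> n))"
  shows "AE \<theta> in \<sigma>. \<forall>x. (\<lambda>n. emp_log_mgf p n (\<theta> n) x) \<longlonglongrightarrow> avg_log_mgf p x"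
proof -
  interpret prob_space \<sigma> by fact
  have ev: "AE \<theta> in \<sigma>. \<forall>\<^sub>F n in sequentially. \<bar>emp_log_mgf p n (\<theta> n) x - avg_log_mgf p x\<bar> \<le> \<epsilon>" if \<epsilon>: "0 < \<epsilon>" for x \<epsilon>
  proof -
    obtain C where C: "0 \<le> C" "\<And>n M. 1 \<le> n \<Longrightarrow> rotation_invariant_prob n M \<Longrightarrow>
        measure M {\<theta> \<in> space M. \<epsilon> < \<bar>emp_log_mgf p n \<theta> x - avg_log_mgf p x\<bar>} \<le> C * (1 / (real n)\<^sup>2)"
      using rotation_invariant_dev[OF \<epsilon>] by blast
    \<comment> \<open>Index 0 is given the empty set because the marginals are specified only from n
      = 1 on.\<close>
    define A where "A n = (if n = 0 then {} else {\<theta> \<in> space \<sigma>. \<epsilon> < \<bar>emp_log_mgf p n (\<theta> n) x - avg_log_mgf p x\<bar>})" for n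
    have A: "A n \<in> sets \<sigma> \<and> measure \<sigma> (A n) \<le> C * (1 / (real n)\<^sup>2)" for n
    proof (cases "n = 0")
      case False
      then have n: "1 \<le> n" by simp
      let ?S = "borel_of (nsphere (n - 1))"
      let ?D = "{\<theta> \<in> space ?S. \<epsilon> < \<bar>emp_log_mgf p n \<theta> x - avg_log_mgf p x\<bar>}"
      have m: "(\<lambda>\<theta>. \<theta> n) \<in> \<sigma> \<rightarrow>\<^sub>M ?S" by (rule sphere_product_projection[OF n sets])
      have [measurable]: "(\<lambda>\<theta>. emp_log_mgf p n \<theta> x) \<in> borel_measurable ?S"
        by (intro emp_log_mgf_measurable measurable_nsphere_coordinate)
      have D: "?D \<in> sets ?S" by measurable
      have A_eq: "A n = (\<lambda>\<theta>. \<theta> n) -` ?D \<inter> space \<sigma>"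
        using n measurable_space[OF m] by (auto simp: A_def)
      then have "measure \<sigma> (A n) = measure (distr \<sigma> ?S (\<lambda>\<theta>. \<theta> n)) ?D"
        using measure_distr[OF m D] by simp
      then show ?thesis using C(2)[OF n inv[OF n]] measurable_sets[OF m D] A_eq by simp
    qed (simp add: A_def)
    have "summable (\<lambda>n. measure \<sigma> (A n))"
    proof (rule summable_comparison_test')
      show "summable (\<lambda>n. C * (1 / (real n)\<^sup>2))"
        using inverse_power_summable[of 2, where 'a = real] by (intro summable_mult) (simp add: inverse_eq_divide)
      show "norm (measure \<sigma> (A n)) \<le> C * (1 / (real n)\<^sup>2)" for n using A[of n] by simp
    qed
    then have "AE \<theta> in \<sigma>. \<forall>\<^sub>F n in sequentially. \<theta> \<in> space \<sigma> - A n"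
      using A by (intro borel_cantelli_AE1) (auto simp: emeasure_eq_measure)
    then show ?thesis
    proof (rule AE_mp, intro AE_I2 impI)
      fix \<theta> assume "\<forall>\<^sub>F n in sequentially. \<theta> \<in> space \<sigma> - A n"
      with eventually_gt_at_top[of 0] show "\<forall>\<^sub>F n in sequentially. \<bar>emp_log_mgf p n (\<theta> n) x - avg_log_mgf p x\<bar> \<le> \<epsilon>"
        by eventually_elim (auto simp: A_def not_less)
    qed
  qed
  have "AE \<theta> in \<sigma>. \<forall>x\<in>\<rat>. \<forall>k::nat. \<forall>\<^sub>F n in sequentially. \<bar>emp_log_mgf p n (\<theta> n) x - avg_log_mgf p x\<bar> \<le> inverse (real (Suc k))"
    using countable_rat by (intro AE_ball_countable' AE_all_countable[THEN iffD2] allI ev) auto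
  then show ?thesis
  proof (rule AE_mp, intro AE_I2 impI allI)
    fix \<theta> x
    assume "\<forall>x\<in>\<rat>. \<forall>k::nat. \<forall>\<^sub>F n in sequentially. \<bar>emp_log_mgf p n (\<theta> n) x - avg_log_mgf p x\<bar> \<le> inverse (real (Suc k))"
    then have rat: "\<forall>\<^sub>F n in sequentially. \<bar>emp_log_mgf p n (\<theta> n) q - avg_log_mgf p q\<bar> < e" if qe: "q \<in> \<rat>" "0 < e" for q e
    proof -
      obtain k where k: "inverse (real (Suc k)) < e" using reals_Archimedean[OF qe(2)] by auto
      then show ?thesis
        using \<open>\<forall>x\<in>\<rat>. \<forall>k. _ x k\<close>[rule_format, OF qe(1), of k] by (auto elim!: eventually_mono)
    qed
    have pos: "(\<lambda>n. emp_log_mgf p n (\<theta> n) x) \<longlonglongrightarrow> avg_log_mgf p x" if x: "0 \<le> x" for x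
    proof (rule LIMSEQ_I)
      fix e :: real assume e: "0 < e"
      obtain d where d: "0 < d" "\<And>x'. \<bar>x' - x\<bar> < d \<Longrightarrow> \<bar>avg_log_mgf p x' - avg_log_mgf p x\<bar> < e / 2"
        using avg_log_mgf_near[OF half_gt_zero[OF e], of x] by blast
      obtain q where q: "q \<in> \<rat>" "x < q" "q < x + d" using Rats_dense_in_real[of x "x + d"] d(1) by auto
      \<comment> \<open>A rational of modulus at most x is needed for the lower comparison; at x = 0
        the only candidate is 0 itself.\<close>
      obtain q' where q': "q' \<in> \<rat>" "\<bar>q'\<bar> \<le> x" "\<bar>avg_log_mgf p q' - avg_log_mgf p x\<bar> < e / 2"
      proof (cases "x = 0")
        case True
        then show ?thesis using e that[of 0] by simp
      next
        case False
        then obtain q' where "q' \<in> \<rat>" "max 0 (x - d) < q'" "q' < x"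
          using Rats_dense_in_real[of "max 0 (x - d)" x] d(1) x by auto
        then show ?thesis using d(2)[of q'] that[of q'] by auto
      qed
      have "\<forall>\<^sub>F n in sequentially. \<bar>emp_log_mgf p n (\<theta> n) x - avg_log_mgf p x\<bar> < e"
        using rat[OF q(1) half_gt_zero[OF e]] rat[OF q'(1) half_gt_zero[OF e]]
      proof eventually_elim
        case (elim n)
        have "emp_log_mgf p n (\<theta> n) q' \<le> emp_log_mgf p n (\<theta> n) x" "emp_log_mgf p n (\<theta> n) x \<le> emp_log_mgf p n (\<theta> n) q"
          using x q q' by (auto intro!: emp_log_mgf_mono)
        moreover have "\<bar>avg_log_mgf p q - avg_log_mgf p x\<bar> < e / 2" using q d(2)[of q] by simp
        ultimately show ?case using elim q'(3) by linarith
      qed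
      then show "\<exists>no. \<forall>n\<ge>no. norm (emp_log_mgf p n (\<theta> n) x - avg_log_mgf p x) < e"
        by (simp add: eventually_sequentially)
    qed
    show "(\<lambda>n. emp_log_mgf p n (\<theta> n) x) \<longlonglongrightarrow> avg_log_mgf p x"
    proof (cases "0 \<le> x")
      case False
      then show ?thesis using pos[of "- x"] by (simp add: emp_log_mgf_minus avg_log_mgf_minus[OF p])
    qed (rule pos)
  qed
qed

end

section \<open>Exponential tilting\<close>

definition lp_sum :: "real \<Rightarrow> nat \<Rightarrow> (nat \<Rightarrow> real) \<Rightarrow> real" where
  "lp_sum p n x = (\<Sum>i<n. \<bar>x i\<bar> powr p)"

definition proj :: "real \<Rightarrow> nat \<Rightarrow> (nat \<Rightarrow> real) \<Rightarrow> (nat \<Rightarrow> real) \<Rightarrow> real" where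
  "proj p n a x = real n powr (1 / p) / real n powr (1 / 2) * (\<Sum>i<n. x i * a i)"

lemma measurable_lp_sum [measurable]: "lp_sum p n \<in> borel_measurable (lborel_Pi n)"
  unfolding lp_sum_def[abs_def] by measurable

lemma measurable_proj [measurable]: "proj p n a \<in> borel_measurable (lborel_Pi n)"
  unfolding proj_def[abs_def] by measurable

text \<open>Up to the term \<open>(1 / p) * ln (real n)\<close>, the exponential growth rate of the
  total mass of the tilted Lebesgue measure; see \<open>nn_integral_exp_tilt\<close>.\<close>

definition emp_pressure :: "real \<Rightarrow> nat \<Rightarrow> (nat \<Rightarrow> real) \<Rightarrow> real \<Rightarrow> real \<Rightarrow> real" where
  "emp_pressure p n a t s = - (1 / p) * ln s + emp_log_mgf p n a (t * s powr (- 1 / p))"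

definition pressure :: "real \<Rightarrow> real \<Rightarrow> real \<Rightarrow> real" where
  "pressure p t s = - (1 / p) * ln s + avg_log_mgf p (t * s powr (- 1 / p))"

text \<open>With \<open>t\<^sub>2 = 1/p - s\<close>, the quantity maximised in \<open>\<Psi>\<^sup>*(w, 1)\<close> is a constant minus \<open>objective p w t s\<close>.\<close>

definition objective :: "real \<Rightarrow> real \<Rightarrow> real \<Rightarrow> real \<Rightarrow> real" where
  "objective p w t s = s - t * w + pressure p t s"

context
  fixes p :: real
  assumes p: "1 < p"
begin

text \<open>The weight is even, so reflecting y and averaging replaces the exponential by
  cosh.\<close>

lemma nn_integral_exp_minus_powr_unit:
  "(\<integral>\<^sup>+y. ennreal (exp (b * y - \<bar>y\<bar> powr p)) \<partial>lborel) = ennreal (cosh_mgf p b)"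
proof -
  let ?f = "\<lambda>y. exp (b * y - \<bar>y\<bar> powr p)"
  have int: "integrable lborel (\<lambda>y. exp (c * y - \<bar>y\<bar> powr p))" for c
  proof (rule Bochner_Integration.integrable_bound)
    show "integrable lborel (\<lambda>y. exp (\<bar>c\<bar> * \<bar>y\<bar>) * exp (- (1 * \<bar>y\<bar> powr p)))"
      using p by (intro integrable_exp_abs_minus_powr) auto
    have "c * y \<le> \<bar>c\<bar> * \<bar>y\<bar>" for y :: real using abs_ge_self[of "c * y"] by (simp add: abs_mult)
    then show "AE y in lborel. norm (exp (c * y - \<bar>y\<bar> powr p)) \<le> norm (exp (\<bar>c\<bar> * \<bar>y\<bar>) * exp (- (1 * \<bar>y\<bar> powr p)))"
      by (auto simp: exp_add[symmetric])
  qed measurable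
  have refl: "(\<integral>y. ?f y \<partial>lborel) = (\<integral>y. exp (- b * y - \<bar>y\<bar> powr p) \<partial>lborel)"
    using lborel_integral_real_affine[of "-1" ?f 0] by simp
  have "2 * cosh_mgf p b = (\<integral>y. ?f y + exp (- b * y - \<bar>y\<bar> powr p) \<partial>lborel)"
    unfolding cosh_mgf_def Bochner_Integration.integral_mult_right_zero[symmetric]
    by (intro Bochner_Integration.integral_cong) (auto simp: cosh_def exp_diff exp_minus field_simps)
  also have "\<dots> = 2 * (\<integral>y. ?f y \<partial>lborel)"
    using int[of b] int[of "- b"] by (simp add: refl)
  finally have "cosh_mgf p b = (\<integral>y. ?f y \<partial>lborel)" by simp
  then show ?thesis using int[of b] by (subst nn_integral_eq_integral) auto
qed

lemma nn_integral_exp_minus_powr: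
  assumes A: "0 < A"
  shows "(\<integral>\<^sup>+y. ennreal (exp (B * y - A * \<bar>y\<bar> powr p)) \<partial>lborel)
    = ennreal (exp (- (1 / p) * ln A + log_mgf p (B * A powr (- 1 / p))))"
proof -
  let ?c = "A powr (- 1 / p)"
  have c: "0 < ?c" using A by simp
  have Ac: "A * ?c powr p = 1" unfolding powr_powr using A p by (simp add: powr_minus)
  have eq: "B * (?c * y) - A * \<bar>?c * y\<bar> powr p = B * ?c * y - \<bar>y\<bar> powr p" for y
  proof -
    have "A * \<bar>?c * y\<bar> powr p = (A * ?c powr p) * \<bar>y\<bar> powr p"
      using c by (simp add: abs_mult powr_mult)
    then show ?thesis unfolding Ac by (simp add: mult.assoc)
  qed
  have "(\<integral>\<^sup>+y. ennreal (exp (B * y - A * \<bar>y\<bar> powr p)) \<partial>lborel)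
      = ennreal \<bar>?c\<bar> * (\<integral>\<^sup>+y. ennreal (exp (B * (0 + ?c * y) - A * \<bar>0 + ?c * y\<bar> powr p)) \<partial>lborel)"
    using c by (intro nn_integral_real_affine) auto
  also have "\<dots> = ennreal ?c * ennreal (cosh_mgf p (B * ?c))"
    using c by (simp only: add_0 eq nn_integral_exp_minus_powr_unit abs_of_pos)
  also have "\<dots> = ennreal (exp (- (1 / p) * ln A) * exp (log_mgf p (B * ?c)))"
    using A cosh_mgf_pos[OF p, of "B * ?c"] by (simp add: exp_log_mgf[OF p] powr_def ennreal_mult mult.commute)
  finally show ?thesis by (simp add: exp_add[symmetric])
qed

text \<open>Both the projection and \<open>lp_sum\<close> are sums over coordinates, so the integral
  is a product of one-dimensional ones, each brought to unit coefficient by scaling.\<close>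

lemma nn_integral_exp_tilt:
  assumes n: "1 \<le> n" and s: "0 < s"
  shows "(\<integral>\<^sup>+x. ennreal (exp (real n * (t * proj p n a x - s * lp_sum p n x))) \<partial>lborel_Pi n)
    = ennreal (exp (real n * (emp_pressure p n a t s - (1 / p) * ln (real n))))"
proof -
  define k where "k = real n powr (1 / p) / real n powr (1 / 2)"
  let ?A = "real n * s"
  let ?B = "\<lambda>i. real n * t * k * a i"
  have A: "0 < ?A" using n s by simp
  \<comment> \<open>The scaling by n^(1/p - 1/2) in \<open>proj\<close>, the factor n of the
    exponent and the substitution by n^(-1/p) leave exactly the sqrt n of
    \<open>emp_log_mgf\<close>.\<close>
  have k: "real n * k * real n powr (- 1 / p) = sqrt (real n)"
  proof -
    have "real n powr (1 / p) * real n powr (- 1 / p) = 1" using n by (simp add: powr_add[symmetric])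
    then have "k * real n powr (- 1 / p) = 1 / sqrt (real n)" by (simp add: k_def powr_half_sqrt)
    then have "real n * k * real n powr (- 1 / p) = real n / sqrt (real n)" by (simp add: mult.assoc)
    also have "\<dots> = sqrt (real n)" by (rule real_div_sqrt) simp
    finally show ?thesis .
  qed
  have BA: "?B i * ?A powr (- 1 / p) = t * s powr (- 1 / p) * (sqrt (real n) * a i)" for i
  proof -
    have "?A powr (- 1 / p) = real n powr (- 1 / p) * s powr (- 1 / p)"
      using n s by (simp add: powr_mult)
    then have "?B i * ?A powr (- 1 / p) = t * s powr (- 1 / p) * ((real n * k * real n powr (- 1 / p)) * a i)"
      by (simp only: mult_ac)
    then show ?thesis unfolding k .
  qed
  have "real n * (t * proj p n a x - s * lp_sum p n x) = (\<Sum>i<n. ?B i * x i - ?A * \<bar>x i\<bar> powr p)" for x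
    unfolding proj_def lp_sum_def k_def[symmetric] by (simp add: sum_subtractf sum_distrib_left right_diff_distrib mult_ac)
  then have "(\<integral>\<^sup>+x. ennreal (exp (real n * (t * proj p n a x - s * lp_sum p n x))) \<partial>lborel_Pi n)
      = (\<integral>\<^sup>+x. (\<Prod>i<n. ennreal (exp (?B i * x i - ?A * \<bar>x i\<bar> powr p))) \<partial>lborel_Pi n)"
    by (simp add: exp_sum prod_ennreal)
  also have "\<dots> = (\<Prod>i<n. \<integral>\<^sup>+y. ennreal (exp (?B i * y - ?A * \<bar>y\<bar> powr p)) \<partial>lborel)"
    by (intro lborel_Pi.product_nn_integral_prod) auto
  also have "\<dots> = (\<Prod>i<n. ennreal (exp (- (1 / p) * ln ?A + log_mgf p (t * s powr (- 1 / p) * (sqrt (real n) * a i)))))"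
    by (simp only: nn_integral_exp_minus_powr[OF A] BA)
  also have "\<dots> = ennreal (exp (\<Sum>i<n. - (1 / p) * ln ?A + log_mgf p (t * s powr (- 1 / p) * (sqrt (real n) * a i))))"
    by (simp add: exp_sum prod_ennreal)
  also have "(\<Sum>i<n. - (1 / p) * ln ?A + log_mgf p (t * s powr (- 1 / p) * (sqrt (real n) * a i)))
      = real n * (emp_pressure p n a t s - (1 / p) * ln (real n))"
    unfolding sum.distrib emp_pressure_def emp_log_mgf_def using n s p by (simp add: ln_mult field_simps)
  finally show ?thesis .
qed

lemma emp_pressure_minus: "emp_pressure p n a (- t) s = emp_pressure p n a t s"
  by (simp add: emp_pressure_def emp_log_mgf_minus[OF p])

lemma pressure_minus: "pressure p (- t) s = pressure p t s"
  by (simp add: pressure_def avg_log_mgf_minus[OF p])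

lemma emp_pressure_tendsto:
  assumes "\<And>x. (\<lambda>n. emp_log_mgf p n (a n) x) \<longlonglongrightarrow> avg_log_mgf p x"
  shows "(\<lambda>n. emp_pressure p n (a n) t s) \<longlonglongrightarrow> pressure p t s"
  unfolding emp_pressure_def pressure_def by (intro tendsto_add tendsto_const assms)

text \<open>Chernoff's bound with the two tilts t and -t, one for each sign of the projection. On
  the event the larger exponent is at least n (t d - s), and evenness of the pressure turns the two
  masses into the factor 2.\<close>

lemma emeasure_tail_le:
  assumes n: "1 \<le> n" and s: "0 < s" and t: "0 \<le> t"
  shows "emeasure (lborel_Pi n) {x \<in> space (lborel_Pi n). lp_sum p n x \<le> 1 \<and> d \<le> \<bar>proj p n a x\<bar>}
    \<le> ennreal (2 * exp (real n * (s - t * d + emp_pressure p n a t s - (1 / p) * ln (real n))))"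
proof -
  let ?E = "{x \<in> space (lborel_Pi n). lp_sum p n x \<le> 1 \<and> d \<le> \<bar>proj p n a x\<bar>}"
  let ?e = "\<lambda>t x. ennreal (exp (real n * (t * proj p n a x - s * lp_sum p n x)))"
  let ?c = "exp (real n * (s - t * d))"
  have "emeasure (lborel_Pi n) ?E = (\<integral>\<^sup>+x. indicator ?E x \<partial>lborel_Pi n)" by (intro nn_integral_indicator[symmetric]) measurable
  also have "\<dots> \<le> (\<integral>\<^sup>+x. ennreal ?c * (?e t x + ?e (- t) x) \<partial>lborel_Pi n)"
  proof (rule nn_integral_mono)
    fix x
    show "indicator ?E x \<le> ennreal ?c * (?e t x + ?e (- t) x)"
    proof (cases "x \<in> ?E")
      case True
      define v where "v = proj p n a x"
      define T where "T = lp_sum p n x"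
      have vT: "T \<le> 1" "d \<le> \<bar>v\<bar>" using True by (auto simp: v_def T_def)
      have "0 \<le> s - t * d + (t * \<bar>v\<bar> - s * T)"
        using mult_left_mono[OF vT(1) less_imp_le[OF s]] mult_left_mono[OF vT(2) t] by simp
      then have "1 \<le> exp (real n * (s - t * d + (t * \<bar>v\<bar> - s * T)))" by simp
      also have "\<dots> = ?c * exp (real n * (t * \<bar>v\<bar> - s * T))" by (simp add: exp_add[symmetric] algebra_simps)
      also have "exp (real n * (t * \<bar>v\<bar> - s * T)) \<le> exp (real n * (t * v - s * T)) + exp (real n * (- t * v - s * T))"
        by (cases "0 \<le> v") auto
      finally have "1 \<le> ?c * (exp (real n * (t * v - s * T)) + exp (real n * (- t * v - s * T)))" by simp
      then have "ennreal 1 \<le> ennreal (?c * (exp (real n * (t * v - s * T)) + exp (real n * (- t * v - s * T))))"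
        by (rule ennreal_leI)
      then show ?thesis using True by (simp add: v_def T_def ennreal_mult ennreal_plus[symmetric] del: ennreal_plus)
    qed simp
  qed
  also have "\<dots> = ennreal ?c * (ennreal (exp (real n * (emp_pressure p n a t s - (1 / p) * ln (real n))))
      + ennreal (exp (real n * (emp_pressure p n a (- t) s - (1 / p) * ln (real n)))))"
    by (simp only: nn_integral_exp_tilt[OF n s, symmetric]) (simp add: nn_integral_cmult nn_integral_add)
  also have "\<dots> = ennreal (2 * exp (real n * (s - t * d + emp_pressure p n a t s - (1 / p) * ln (real n))))"
    unfolding emp_pressure_minus
    by (simp add: ennreal_mult[symmetric] ennreal_plus[symmetric] del: ennreal_plus) (simp add: exp_add[symmetric] algebra_simps)
  finally show ?thesis .
qed

text \<open>These are the stationarity conditions of \<open>objective\<close>. They say that the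
  tilted measure is centred at projection w and \<open>lp_sum\<close> 1.\<close>

lemma minimizer_derivatives:
  assumes s: "0 < s" and min: "\<And>t' s'. 0 < s' \<Longrightarrow> objective p w t s \<le> objective p w t' s'"
  shows "((\<lambda>t'. pressure p t' s) has_real_derivative w) (at t)"
    and "((\<lambda>s'. pressure p t s') has_real_derivative (- 1)) (at s)"
proof -
  let ?c = "s powr (- 1 / p)" and ?D = "w * s powr (1 / p)"
  have c: "0 < ?c" "?c * s powr (1 / p) = 1" using s by (auto simp: powr_minus)
  \<comment> \<open>Moving t by \<open>k * s powr (1 / p)\<close> at fixed s shifts the argument of
    \<open>avg_log_mgf\<close> by exactly k, so minimality becomes a supporting line of slope
    \<open>?D\<close>.\<close>
  have "avg_log_mgf p (t * ?c) + ?D * k \<le> avg_log_mgf p (t * ?c + k)" for k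
  proof -
    have "(t + k * s powr (1 / p)) * ?c = t * ?c + k * (?c * s powr (1 / p))" by (simp add: algebra_simps)
    also have "\<dots> = t * ?c + k" by (simp only: c mult_1_right)
    finally have eq: "(t + k * s powr (1 / p)) * ?c = t * ?c + k" .
    have "s - t * w + (- (1 / p) * ln s + avg_log_mgf p (t * ?c))
        \<le> s - (t + k * s powr (1 / p)) * w + (- (1 / p) * ln s + avg_log_mgf p (t * ?c + k))"
      using min[OF s, of "t + k * s powr (1 / p)"] unfolding objective_def pressure_def eq .
    then show ?thesis by (simp add: algebra_simps)
  qed
  then have H: "(avg_log_mgf p has_real_derivative ?D) (at (t * ?c))"
    by (rule avg_log_mgf_has_derivative[OF p])
  have g: "((\<lambda>t'. t' * ?c) has_real_derivative ?c) (at t)" by (auto intro!: derivative_eq_intros)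
  have "((\<lambda>t'. pressure p t' s) has_real_derivative 0 + ?D * ?c) (at t)"
    unfolding pressure_def
    by (intro DERIV_add DERIV_const DERIV_chain2[where g = "\<lambda>t'. t' * ?c", OF H g])
  then show "((\<lambda>t'. pressure p t' s) has_real_derivative w) (at t)"
    using c(2) by (simp add: mult.assoc mult.commute[of "s powr (1 / p)"])
  have "((\<lambda>s'. t * s' powr (- 1 / p)) has_real_derivative t * ((- 1 / p) * s powr (- 1 / p - 1))) (at s)"
    using s by (intro DERIV_cmult has_real_derivative_powr)
  from DERIV_chain2[OF H this] have "((\<lambda>s'. avg_log_mgf p (t * s' powr (- 1 / p))) has_real_derivative
      ?D * (t * ((- 1 / p) * s powr (- 1 / p - 1)))) (at s)" .
  moreover have "((\<lambda>s'. - (1 / p) * ln s') has_real_derivative (- (1 / p) * (1 / s))) (at s)"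
    using s by (intro DERIV_cmult) (auto intro!: derivative_eq_intros)
  \<comment> \<open>The chain rule supplies only the existence of E; its value follows from the
    local minimum in s.\<close>
  ultimately obtain E where E: "((\<lambda>s'. pressure p t s') has_real_derivative E) (at s)"
    unfolding pressure_def by (metis DERIV_add)
  have "((\<lambda>s'. objective p w t s') has_real_derivative 1 - 0 + E) (at s)"
    unfolding objective_def by (intro DERIV_add DERIV_diff DERIV_const E DERIV_ident)
  moreover have "\<forall>s'. \<bar>s - s'\<bar> < s \<longrightarrow> objective p w t s \<le> objective p w t s'" using min by auto
  ultimately have "1 - 0 + E = 0" using s by (intro DERIV_local_min[of "objective p w t"]) auto
  then show "((\<lambda>s'. pressure p t s') has_real_derivative (- 1)) (at s)" using E by (simp add: add.commute eq_neg_iff_add_eq_0[symmetric])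
qed

section \<open>Concentration of the tilted measure\<close>

lemma derivative_upper_step:
  fixes f :: "real \<Rightarrow> real"
  assumes "(f has_real_derivative D) (at x)" "D < E" "0 < b"
  obtains h where "0 < h" "h < b" "f (x + h) - f x < h * E"
proof -
  have "((\<lambda>y. f y - y * E) has_real_derivative D - E) (at x)"
    using assms(1) by (auto intro!: derivative_eq_intros)
  from DERIV_neg_dec_right[OF this] assms(2) obtain d where d: "0 < d" "\<And>h. 0 < h \<Longrightarrow> h < d \<Longrightarrow> f (x + h) - (x + h) * E < f x - x * E"
    by auto
  have "f (x + min d b / 2) - (x + min d b / 2) * E < f x - x * E" using d(1) assms(3) by (intro d(2)) auto
  then show ?thesis using d(1) assms(3) by (intro that[of "min d b / 2"]) (auto simp: algebra_simps)
qed

lemma derivative_lower_step: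
  fixes f :: "real \<Rightarrow> real"
  assumes "(f has_real_derivative D) (at x)" "E < D" "0 < b"
  obtains h where "0 < h" "h < b" "f (x - h) - f x < - h * E"
proof -
  have "((\<lambda>y. f (- y)) has_real_derivative - D) (at (- x))"
    using DERIV_mirror[of f D "- x"] assms(1) by simp
  from derivative_upper_step[OF this, of "- E" b] assms(2,3)
  obtain h where "0 < h" "h < b" "f (- (- x + h)) - f (- (- x)) < h * (- E)" by auto
  then show ?thesis by (intro that[of h]) simp_all
qed

context
  fixes a :: "nat \<Rightarrow> nat \<Rightarrow> real"
  assumes lim: "\<And>x. (\<lambda>n. emp_log_mgf p n (a n) x) \<longlonglongrightarrow> avg_log_mgf p x"
begin

text \<open>On E n the tilt (t', s') exceeds the tilt (t, s) by a factor of at least exp(n c), while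
  its total mass exceeds the other by a smaller exponential factor. The constant 1/8 lets four such
  sets take at most half of the mass.\<close>

lemma tilt_negligible:
  assumes s: "0 < s" and s': "0 < s'" and neg: "pressure p t' s' - pressure p t s < c"
    and E: "\<And>n. E n \<in> sets (lborel_Pi n)"
    and le: "\<And>n x. x \<in> E n \<Longrightarrow> c \<le> (t' - t) * proj p n (a n) x - (s' - s) * lp_sum p n x"
  shows "\<forall>\<^sub>F n in sequentially.
     (\<integral>\<^sup>+x. ennreal (exp (real n * (t * proj p n (a n) x - s * lp_sum p n x))) * indicator (E n) x \<partial>lborel_Pi n)
      \<le> ennreal (1 / 8 * exp (real n * (emp_pressure p n (a n) t s - (1 / p) * ln (real n))))"
proof -
  define \<kappa> where "\<kappa> = (c - (pressure p t' s' - pressure p t s)) / 2"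
  have \<kappa>: "0 < \<kappa>" using neg by (simp add: \<kappa>_def)
  have "(\<lambda>n. emp_pressure p n (a n) t' s' - emp_pressure p n (a n) t s) \<longlonglongrightarrow> pressure p t' s' - pressure p t s"
    by (intro tendsto_diff emp_pressure_tendsto lim)
  then have "\<forall>\<^sub>F n in sequentially. emp_pressure p n (a n) t' s' - emp_pressure p n (a n) t s < c - \<kappa>"
    by (rule order_tendstoD) (use neg in \<open>simp add: \<kappa>_def field_simps\<close>)
  moreover have "\<forall>\<^sub>F n in sequentially. exp (- \<kappa>) ^ n < 1 / 8"
    using LIMSEQ_realpow_zero[of "exp (- \<kappa>)"] \<kappa> by (intro order_tendstoD(2)[of _ 0]) auto
  ultimately show ?thesis using eventually_ge_at_top[of 1]
  proof eventually_elim
    case (elim n)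
    let ?q = "\<lambda>t s. emp_pressure p n (a n) t s - (1 / p) * ln (real n)"
    let ?e = "\<lambda>t s x. exp (real n * (t * proj p n (a n) x - s * lp_sum p n x))"
    have "(\<integral>\<^sup>+x. ennreal (?e t s x) * indicator (E n) x \<partial>lborel_Pi n)
        \<le> (\<integral>\<^sup>+x. ennreal (exp (- (real n * c))) * ennreal (?e t' s' x) \<partial>lborel_Pi n)"
    proof (rule nn_integral_mono)
      fix x
      show "ennreal (?e t s x) * indicator (E n) x \<le> ennreal (exp (- (real n * c))) * ennreal (?e t' s' x)"
      proof (cases "x \<in> E n")
        case True
        have "real n * c \<le> real n * ((t' - t) * proj p n (a n) x - (s' - s) * lp_sum p n x)"
          using le[OF True] by (intro mult_left_mono) auto
        then have "?e t s x \<le> exp (- (real n * c)) * ?e t' s' x"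
          by (simp add: exp_add[symmetric] algebra_simps)
        then show ?thesis using True by (simp add: ennreal_mult[symmetric] ennreal_leI)
      qed simp
    qed
    also have "\<dots> = ennreal (exp (- (real n * c))) * (\<integral>\<^sup>+x. ennreal (?e t' s' x) \<partial>lborel_Pi n)"
      by (rule nn_integral_cmult) measurable
    also have "\<dots> = ennreal (exp (- (real n * c)) * exp (real n * ?q t' s'))"
      using elim(3) by (simp only: nn_integral_exp_tilt[OF _ s']) (simp add: ennreal_mult)
    also have "\<dots> \<le> ennreal (1 / 8 * exp (real n * ?q t s))"
    proof (rule ennreal_leI)
      have "real n * (emp_pressure p n (a n) t' s' - emp_pressure p n (a n) t s) \<le> real n * (c - \<kappa>)"
        using elim(1) by (intro mult_left_mono) auto
      then have "exp (- (real n * c)) * exp (real n * ?q t' s') \<le> exp (- (real n * \<kappa>)) * exp (real n * ?q t s)"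
        by (simp add: exp_add[symmetric] algebra_simps)
      also have "exp (- (real n * \<kappa>)) = exp (- \<kappa>) ^ n" by (simp add: exp_of_nat_mult[symmetric])
      also have "\<dots> * exp (real n * ?q t s) \<le> 1 / 8 * exp (real n * ?q t s)"
        using elim(2) by (intro mult_right_mono) auto
      finally show "exp (- (real n * c)) * exp (real n * ?q t' s') \<le> 1 / 8 * exp (real n * ?q t s)" .
    qed
    finally show ?case .
  qed
qed

text \<open>Outside the shell lie four half-spaces in the pair (projection, \<open>lp_sum\<close>),
  each negligible under the tilt at the minimiser. The rest carries at least half of the tilted
  mass, and dividing by the largest value of the tilting factor there bounds the Lebesgue
  measure.\<close>

lemma emeasure_shell_lower:
  assumes s: "0 < s" and min: "\<And>t' s'. 0 < s' \<Longrightarrow> objective p w t s \<le> objective p w t' s'" and \<delta>: "0 < \<delta>"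
  shows "\<forall>\<^sub>F n in sequentially.
    ennreal (1 / 2 * exp (real n * (emp_pressure p n (a n) t s - (1 / p) * ln (real n) + s - t * w - (\<bar>t\<bar> + s) * \<delta>)))
    \<le> emeasure (lborel_Pi n) {x \<in> space (lborel_Pi n). lp_sum p n x < 1 + \<delta> \<and> \<bar>proj p n (a n) x - w\<bar> < \<delta>}"
proof -
  have D1: "((\<lambda>t'. pressure p t' s) has_real_derivative w) (at t)"
    by (rule minimizer_derivatives(1)[OF s]) (rule min)
  have D2: "((\<lambda>s'. pressure p t s') has_real_derivative (- 1)) (at s)"
    by (rule minimizer_derivatives(2)[OF s]) (rule min)
  \<comment> \<open>Each of the four moves of the tilt gains at least h times the threshold of its
    half-space, while the derivatives w and -1 make the pressure grow by strictly less. The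
    condition \<open>h3 < s\<close> keeps the moved parameter positive.\<close>
  obtain h1 where h1: "0 < h1" "pressure p (t + h1) s - pressure p t s < h1 * (w + \<delta>)"
    using derivative_upper_step[OF D1, of "w + \<delta>" 1] \<delta> by auto
  obtain h2 where h2: "0 < h2" "pressure p (t - h2) s - pressure p t s < - h2 * (w - \<delta>)"
    using derivative_lower_step[OF D1, of "w - \<delta>" 1] \<delta> by auto
  obtain h3 where h3: "0 < h3" "h3 < s" "pressure p t (s - h3) - pressure p t s < - h3 * (- 1 - \<delta>)"
    using derivative_lower_step[OF D2, of "- 1 - \<delta>" s] \<delta> s by auto
  obtain h4 where h4: "0 < h4" "pressure p t (s + h4) - pressure p t s < h4 * (- 1 + \<delta>)"
    using derivative_upper_step[OF D2, of "- 1 + \<delta>" 1] \<delta> by auto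
  let ?v = "\<lambda>n. proj p n (a n)" and ?T = "\<lambda>n. lp_sum p n" and ?S = "\<lambda>n. space (lborel_Pi n)"
  define E1 where "E1 n = {x \<in> ?S n. w + \<delta> \<le> ?v n x}" for n
  define E2 where "E2 n = {x \<in> ?S n. ?v n x \<le> w - \<delta>}" for n
  define E3 where "E3 n = {x \<in> ?S n. 1 + \<delta> \<le> ?T n x}" for n
  define E4 where "E4 n = {x \<in> ?S n. ?T n x \<le> 1 - \<delta>}" for n
  define Z where "Z n = exp (real n * (emp_pressure p n (a n) t s - (1 / p) * ln (real n)))" for n
  define f where "f n x = ennreal (exp (real n * (t * ?v n x - s * ?T n x)))" for n x
  have mE: "E1 n \<in> sets (lborel_Pi n)" "E2 n \<in> sets (lborel_Pi n)" "E3 n \<in> sets (lborel_Pi n)" "E4 n \<in> sets (lborel_Pi n)" for n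
    unfolding E1_def E2_def E3_def E4_def by measurable
  have f_meas [measurable]: "f n \<in> borel_measurable (lborel_Pi n)" for n unfolding f_def by measurable
  have "\<forall>\<^sub>F n in sequentially. (\<integral>\<^sup>+x. f n x * indicator (E1 n) x \<partial>lborel_Pi n) \<le> ennreal (1 / 8 * Z n)"
    unfolding f_def Z_def using s h1
    by (intro tilt_negligible[where c = "h1 * (w + \<delta>)" and t' = "t + h1" and s' = s] mE(1)) (auto simp: E1_def)
  moreover have "\<forall>\<^sub>F n in sequentially. (\<integral>\<^sup>+x. f n x * indicator (E2 n) x \<partial>lborel_Pi n) \<le> ennreal (1 / 8 * Z n)"
    unfolding f_def Z_def using s h2
    by (intro tilt_negligible[where c = "- h2 * (w - \<delta>)" and t' = "t - h2" and s' = s] mE(2)) (auto simp: E2_def)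
  moreover have "\<forall>\<^sub>F n in sequentially. (\<integral>\<^sup>+x. f n x * indicator (E3 n) x \<partial>lborel_Pi n) \<le> ennreal (1 / 8 * Z n)"
    unfolding f_def Z_def
  proof (rule tilt_negligible[where c = "h3 * (1 + \<delta>)" and t' = t and s' = "s - h3"])
    fix n x assume "x \<in> E3 n"
    then have "h3 * (1 + \<delta>) \<le> h3 * ?T n x" using h3(1) by (intro mult_left_mono) (auto simp: E3_def)
    then show "h3 * (1 + \<delta>) \<le> (t - t) * ?v n x - (s - h3 - s) * ?T n x" by (simp add: algebra_simps)
  qed (use s h3 mE(3) in \<open>auto simp: algebra_simps\<close>)
  moreover have "\<forall>\<^sub>F n in sequentially. (\<integral>\<^sup>+x. f n x * indicator (E4 n) x \<partial>lborel_Pi n) \<le> ennreal (1 / 8 * Z n)"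
    unfolding f_def Z_def
  proof (rule tilt_negligible[where c = "h4 * (- 1 + \<delta>)" and t' = t and s' = "s + h4"])
    fix n x assume "x \<in> E4 n"
    then have "h4 * ?T n x \<le> h4 * (1 - \<delta>)" using h4(1) by (intro mult_left_mono) (auto simp: E4_def)
    then show "h4 * (- 1 + \<delta>) \<le> (t - t) * ?v n x - (s + h4 - s) * ?T n x" by (simp add: algebra_simps)
  qed (use s h4 mE(4) in auto)
  ultimately show ?thesis using eventually_ge_at_top[of 1]
  proof eventually_elim
    case (elim n)
    let ?G = "{x \<in> ?S n. ?T n x < 1 + \<delta> \<and> \<bar>?v n x - w\<bar> < \<delta>}"
    \<comment> \<open>A bound for the tilting factor on the shell. It rests on \<open>lp_sum\<close>
      being above 1 - \<delta>, which is why \<open>E4\<close> is split off as well.\<close>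
    let ?c = "exp (real n * (t * w + \<bar>t\<bar> * \<delta> - s * (1 - \<delta>)))"
    let ?I = "\<lambda>E. \<integral>\<^sup>+x. f n x * indicator E x \<partial>lborel_Pi n"
    have G: "?G \<in> sets (lborel_Pi n)" by measurable
    have "ennreal (Z n) = (\<integral>\<^sup>+x. f n x \<partial>lborel_Pi n)"
      unfolding f_def Z_def using elim(5) by (intro nn_integral_exp_tilt[symmetric] s)
    also have "\<dots> \<le> (\<integral>\<^sup>+x. ennreal ?c * indicator ?G x + (f n x * indicator (E1 n) x + (f n x * indicator (E2 n) x
        + (f n x * indicator (E3 n) x + f n x * indicator (E4 n) x))) \<partial>lborel_Pi n)"
    proof (rule nn_integral_mono)
      fix x assume x: "x \<in> ?S n"
      consider "x \<in> E1 n" | "x \<in> E2 n" | "x \<in> E3 n" | "x \<in> E4 n"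
        | "x \<in> ?G" "1 - \<delta> < ?T n x"
        using x by (force simp: E1_def E2_def E3_def E4_def abs_less_iff not_le)
      then show "f n x \<le> ennreal ?c * indicator ?G x + (f n x * indicator (E1 n) x + (f n x * indicator (E2 n) x
        + (f n x * indicator (E3 n) x + f n x * indicator (E4 n) x)))"
      proof cases
        case 5
        then have v: "\<bar>?v n x - w\<bar> \<le> \<delta>" by auto
        have "t * (?v n x - w) \<le> \<bar>t\<bar> * \<bar>?v n x - w\<bar>" by (simp flip: abs_mult)
        also have "\<dots> \<le> \<bar>t\<bar> * \<delta>" using v by (intro mult_left_mono) auto
        finally have "t * ?v n x \<le> t * w + \<bar>t\<bar> * \<delta>" by (simp add: algebra_simps)
        moreover have "s * (1 - \<delta>) \<le> s * ?T n x" using 5 s by (intro mult_left_mono) auto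
        ultimately have "real n * (t * ?v n x - s * ?T n x) \<le> real n * (t * w + \<bar>t\<bar> * \<delta> - s * (1 - \<delta>))"
          by (intro mult_left_mono) auto
        then have "f n x \<le> ennreal ?c" by (simp add: f_def ennreal_leI)
        then show ?thesis using 5 by (simp add: add_increasing2)
      qed (auto simp: add_increasing add_increasing2)
    qed
    also have "\<dots> = ennreal ?c * emeasure (lborel_Pi n) ?G + (?I (E1 n) + (?I (E2 n) + (?I (E3 n) + ?I (E4 n))))"
      using G mE by (subst nn_integral_add, measurable)+ (simp add: nn_integral_cmult_indicator)
    also have "\<dots> \<le> ennreal ?c * emeasure (lborel_Pi n) ?G + (ennreal (1 / 8 * Z n) + (ennreal (1 / 8 * Z n) + (ennreal (1 / 8 * Z n) + ennreal (1 / 8 * Z n))))"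
      using elim(1-4) by (intro add_mono order_refl)
    also have "ennreal (1 / 8 * Z n) + (ennreal (1 / 8 * Z n) + (ennreal (1 / 8 * Z n) + ennreal (1 / 8 * Z n))) = ennreal (1 / 2 * Z n)"
      by (subst ennreal_plus[symmetric], simp add: Z_def, simp add: Z_def)+ simp
    finally have le: "ennreal (Z n) \<le> ennreal ?c * emeasure (lborel_Pi n) ?G + ennreal (1 / 2 * Z n)" .
    let ?X = "ennreal ?c * emeasure (lborel_Pi n) ?G" and ?h = "ennreal (1 / 2 * Z n)"
    have halves: "?h + ?h = ennreal (Z n)"
      by (subst ennreal_plus[symmetric]) (auto simp: Z_def)
    \<comment> \<open>Half of the mass is removed by cancelling a finite summand rather than by the
      truncated subtraction of \<open>ennreal\<close>.\<close>
    have "?h + ?h \<le> ?h + ?X" using le by (simp only: halves add.commute[of ?h ?X])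
    then have "?h \<le> ?X" unfolding ennreal_add_left_cancel_le by simp
    then have "ennreal (inverse ?c) * ennreal (1 / 2 * Z n) \<le> ennreal (inverse ?c) * (ennreal ?c * emeasure (lborel_Pi n) ?G)"
      by (rule mult_left_mono) simp
    also have "\<dots> = emeasure (lborel_Pi n) ?G"
      by (simp add: mult.assoc[symmetric] ennreal_mult[symmetric])
    finally have "ennreal (inverse ?c) * ennreal (1 / 2 * Z n) \<le> emeasure (lborel_Pi n) ?G" .
    moreover have "ennreal (inverse ?c) * ennreal (1 / 2 * Z n) = ennreal (inverse ?c * (1 / 2 * Z n))"
      by (rule ennreal_mult[symmetric]) (auto simp: Z_def)
    moreover have "inverse ?c * (1 / 2 * Z n) = 1 / 2 * exp (real n * (emp_pressure p n (a n) t s - (1 / p) * ln (real n) + s - t * w - (\<bar>t\<bar> + s) * \<delta>))"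
      by (simp add: Z_def exp_minus[symmetric] exp_add[symmetric]) (simp add: algebra_simps)
    ultimately show ?case by simp
  qed
qed

text \<open>The shell sticks out of the unit ball, so it is contracted into it. This moves the
  projection only slightly and costs a volume factor of at least exp(-n \<delta>).\<close>

lemma emeasure_ball_lower:
  assumes s: "0 < s" and min: "\<And>t' s'. 0 < s' \<Longrightarrow> objective p w t s \<le> objective p w t' s'"
    and \<rho>: "0 < \<rho>" and \<epsilon>: "0 < \<epsilon>"
  shows "\<forall>\<^sub>F n in sequentially.
    ennreal (exp (real n * (objective p w t s - (1 / p) * ln (real n) - \<epsilon>)))
    \<le> emeasure (lborel_Pi n) {x \<in> space (lborel_Pi n). lp_sum p n x \<le> 1 \<and> \<bar>proj p n (a n) x - w\<bar> < \<rho>}"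
proof -
  \<comment> \<open>The first bound keeps the contracted projection within \<rho> of w; the second
    keeps the loss (\<bar>t\<bar> + s) \<delta> from tilting plus \<delta> from the contraction
    below \<epsilon>/4.\<close>
  define \<delta> where "\<delta> = min (\<rho> / (1 + \<bar>w\<bar>)) (\<epsilon> / (4 * (\<bar>t\<bar> + s + 1)))"
  have \<delta>0: "0 < \<delta>" using \<rho> \<epsilon> s by (simp add: \<delta>_def add_pos_nonneg)
  have \<delta>w: "\<delta> * (1 + \<bar>w\<bar>) \<le> \<rho>"
  proof -
    have "\<delta> * (1 + \<bar>w\<bar>) \<le> \<rho> / (1 + \<bar>w\<bar>) * (1 + \<bar>w\<bar>)" by (intro mult_right_mono) (auto simp: \<delta>_def)
    then show ?thesis by (simp add: add_pos_nonneg add_nonneg_eq_0_iff)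
  qed
  have \<delta>t: "\<delta> * (\<bar>t\<bar> + s + 1) \<le> \<epsilon> / 4"
  proof -
    have "\<delta> * (\<bar>t\<bar> + s + 1) \<le> \<epsilon> / (4 * (\<bar>t\<bar> + s + 1)) * (\<bar>t\<bar> + s + 1)" using s by (intro mult_right_mono) (auto simp: \<delta>_def)
    also have "\<dots> = \<epsilon> / 4" using s by (simp add: field_simps add_pos_nonneg)
    finally show ?thesis .
  qed
  \<comment> \<open>The factor by which \<open>lp_sum\<close> below 1 + \<delta> becomes at most
    1.\<close>
  define \<beta> where "\<beta> = (1 + \<delta>) powr (- 1 / p)"
  have l0: "0 < \<beta>" using \<delta>0 by (simp add: \<beta>_def)
  have l1: "1 - \<delta> \<le> \<beta>" "\<beta> \<le> 1"
  proof -
    have "(1 - \<delta>) * (1 + \<delta>) \<le> 1" using \<delta>0 by (simp add: algebra_simps)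
    then have "1 - \<delta> \<le> (1 + \<delta>) powr (- 1)" using \<delta>0 by (simp add: powr_minus field_simps)
    also have "\<dots> \<le> \<beta>" unfolding \<beta>_def using \<delta>0 p by (intro powr_mono) (auto simp: field_simps)
    finally show "1 - \<delta> \<le> \<beta>" .
    have "\<beta> \<le> (1 + \<delta>) powr 0" unfolding \<beta>_def using \<delta>0 p by (intro powr_mono) auto
    then show "\<beta> \<le> 1" using \<delta>0 by simp
  qed
  have lp: "\<beta> powr p = 1 / (1 + \<delta>)" unfolding \<beta>_def powr_powr using p \<delta>0 by (simp add: powr_minus field_simps)
  have ln_l: "- \<delta> \<le> ln \<beta>"
  proof -
    have "ln (1 + \<delta>) \<le> \<delta>" using \<delta>0 by (intro ln_add_one_self_le_self) simp
    then have "1 / p * ln (1 + \<delta>) \<le> 1 * \<delta>" using p \<delta>0 by (intro mult_mono) auto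
    then show ?thesis using \<delta>0 by (simp add: \<beta>_def ln_powr)
  qed
  have "(\<lambda>n. emp_pressure p n (a n) t s) \<longlonglongrightarrow> pressure p t s" by (intro emp_pressure_tendsto lim)
  then have "\<forall>\<^sub>F n in sequentially. pressure p t s - \<epsilon> / 4 < emp_pressure p n (a n) t s"
    using \<epsilon> by (intro order_tendstoD) auto
  moreover have "\<forall>\<^sub>F n in sequentially. exp (- \<epsilon> / 4) ^ n < 1 / 2"
    using LIMSEQ_realpow_zero[of "exp (- \<epsilon> / 4)"] \<epsilon> by (intro order_tendstoD(2)[of _ 0]) auto
  moreover have "\<forall>\<^sub>F n in sequentially.
    ennreal (1 / 2 * exp (real n * (emp_pressure p n (a n) t s - (1 / p) * ln (real n) + s - t * w - (\<bar>t\<bar> + s) * \<delta>)))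
    \<le> emeasure (lborel_Pi n) {x \<in> space (lborel_Pi n). lp_sum p n x < 1 + \<delta> \<and> \<bar>proj p n (a n) x - w\<bar> < \<delta>}"
    by (rule emeasure_shell_lower[OF s _ \<delta>0]) (rule min)
  ultimately show ?thesis using eventually_ge_at_top[of 1]
  proof eventually_elim
    case (elim n)
    let ?S = "space (lborel_Pi n)"
    let ?G = "{x \<in> ?S. lp_sum p n x < 1 + \<delta> \<and> \<bar>proj p n (a n) x - w\<bar> < \<delta>}"
    let ?Q = "{x \<in> ?S. lp_sum p n x \<le> 1 \<and> \<bar>proj p n (a n) x - w\<bar> < \<rho>}"
    let ?r = "\<lambda>x. \<lambda>i\<in>{..<n}. 0 + \<beta> * x i"
    have Q: "?Q \<in> sets (lborel_Pi n)" by measurable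
    have sub: "?G \<subseteq> {x \<in> ?S. ?r x \<in> ?Q}"
    proof safe
      fix x assume x: "x \<in> ?S" "lp_sum p n x < 1 + \<delta>" "\<bar>proj p n (a n) x - w\<bar> < \<delta>"
      show "?r x \<in> ?S" by (simp add: space_PiM)
      have "lp_sum p n (?r x) = \<beta> powr p * lp_sum p n x"
        using l0 by (simp add: lp_sum_def abs_mult powr_mult sum_distrib_left)
      also have "\<dots> \<le> 1" using x(2) \<delta>0 by (simp add: lp field_simps)
      finally show "lp_sum p n (?r x) \<le> 1" .
      have pr: "proj p n (a n) (?r x) = \<beta> * proj p n (a n) x"
        by (simp add: proj_def sum_distrib_left mult_ac)
      have "\<bar>\<beta> * proj p n (a n) x - w\<bar> = \<bar>\<beta> * (proj p n (a n) x - w) + (\<beta> - 1) * w\<bar>" by (simp add: algebra_simps)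
      also have "\<dots> \<le> \<beta> * \<bar>proj p n (a n) x - w\<bar> + (1 - \<beta>) * \<bar>w\<bar>"
        using abs_triangle_ineq[of "\<beta> * (proj p n (a n) x - w)" "(\<beta> - 1) * w"] l0 l1 by (simp add: abs_mult)
      also have "\<dots> < \<delta> + \<delta> * \<bar>w\<bar>"
      proof (rule add_less_le_mono)
        have "\<beta> * \<bar>proj p n (a n) x - w\<bar> \<le> 1 * \<bar>proj p n (a n) x - w\<bar>" using l1 by (intro mult_right_mono) auto
        then show "\<beta> * \<bar>proj p n (a n) x - w\<bar> < \<delta>" using x(3) by simp
        show "(1 - \<beta>) * \<bar>w\<bar> \<le> \<delta> * \<bar>w\<bar>" using l1 by (intro mult_right_mono) auto
      qed
      also have "\<dots> \<le> \<rho>" using \<delta>w by (simp add: algebra_simps)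
      finally show "\<bar>proj p n (a n) (?r x) - w\<bar> < \<rho>" unfolding pr .
    qed
    have m: "{x \<in> ?S. ?r x \<in> ?Q} \<in> sets (lborel_Pi n)"
    proof -
      have "?r \<in> lborel_Pi n \<rightarrow>\<^sub>M lborel_Pi n" by measurable
      from measurable_sets[OF this Q] show ?thesis by (simp add: vimage_def Int_def conj_commute)
    qed
    let ?X = "emp_pressure p n (a n) t s - (1 / p) * ln (real n) + s - t * w - (\<bar>t\<bar> + s) * \<delta>"
    have "exp (real n * (objective p w t s - (1 / p) * ln (real n) - \<epsilon>))
        \<le> exp (- \<epsilon> / 4) ^ n * (exp (- real n * \<delta>) * exp (real n * ?X))"
    proof -
      \<comment> \<open>Three quarters of \<epsilon> are spent: on the convergence of the pressure,
        on the factor 1/2, and on tilting together with contraction.\<close>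
      have "(\<bar>t\<bar> + s) * \<delta> + \<delta> \<le> \<epsilon> / 4" using \<delta>t by (simp add: algebra_simps)
      then have "objective p w t s - (1 / p) * ln (real n) - \<epsilon> \<le> - \<epsilon> / 4 + (- \<delta> + ?X)"
        using elim(1) \<epsilon> unfolding objective_def by linarith
      then have "real n * (objective p w t s - (1 / p) * ln (real n) - \<epsilon>) \<le> real n * (- \<epsilon> / 4 + (- \<delta> + ?X))"
        by (intro mult_left_mono) auto
      also have "\<dots> = real n * (- \<epsilon> / 4) + (- real n * \<delta> + real n * ?X)" by (simp add: algebra_simps)
      finally show ?thesis by (simp only: exp_le_cancel_iff exp_add[symmetric] exp_of_nat_mult[symmetric])
    qed
    also have "\<dots> \<le> 1 / 2 * (\<beta> ^ n * exp (real n * ?X))"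
    proof (intro mult_mono)
      have "real n * (- \<delta>) \<le> real n * ln \<beta>" using ln_l by (intro mult_left_mono) auto
      then have "exp (real n * (- \<delta>)) \<le> exp (real n * ln \<beta>)" by simp
      also have "exp (real n * ln \<beta>) = \<beta> ^ n" using l0 by (simp add: exp_of_nat_mult)
      finally show "exp (- real n * \<delta>) \<le> \<beta> ^ n" by simp
    qed (use elim(2) l0 in auto)
    finally have "ennreal (exp (real n * (objective p w t s - (1 / p) * ln (real n) - \<epsilon>)))
        \<le> ennreal (1 / 2 * (\<beta> ^ n * exp (real n * ?X)))" by (rule ennreal_leI)
    also have "\<dots> = ennreal (\<beta> ^ n) * ennreal (1 / 2 * exp (real n * ?X))"
      using l0 by (simp add: ennreal_mult[symmetric] mult_ac)
    also have "\<dots> \<le> ennreal (\<beta> ^ n) * emeasure (lborel_Pi n) {x \<in> ?S. ?r x \<in> ?Q}"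
      using elim(3) emeasure_mono[OF sub m] by (intro mult_left_mono) auto
    also have "\<dots> = emeasure (lborel_Pi n) ?Q" by (rule emeasure_lborel_Pi_affine[OF l0 Q, symmetric])
    finally show ?case .
  qed
qed

end

end

section \<open>The rate function\<close>

lemma ln_ennreal_ennreal_exp: "ln_ennreal (ennreal (exp x)) = ereal x"
  by (simp add: ln_ennreal_def)

lemma ln_ennreal_top [simp]: "ln_ennreal top = \<infinity>"
  by (simp add: ln_ennreal_def)

lemma ln_ennreal_mono: "x \<le> y \<Longrightarrow> ln_ennreal x \<le> ln_ennreal y"
proof -
  assume le: "x \<le> y"
  show ?thesis
  proof (cases "x = 0 \<or> y = \<infinity>")
    case False
    then have "x \<noteq> 0" "y \<noteq> \<infinity>" by auto
    moreover from this have "y \<noteq> 0" "x \<noteq> \<infinity>" using le by (auto simp: top_unique)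
    ultimately have "0 < enn2real x" "enn2real x \<le> enn2real y"
      using le by (auto simp: enn2real_positive_iff less_top zero_less_iff_neq_zero intro!: enn2real_mono)
    then show ?thesis using \<open>x \<noteq> 0\<close> \<open>y \<noteq> 0\<close> \<open>x \<noteq> \<infinity>\<close> \<open>y \<noteq> \<infinity>\<close> by (simp add: ln_ennreal_def ln_mono)
  qed (auto simp: ln_ennreal_def)
qed

lemma ereal_integral_real:
  assumes "integrable M f"
  shows "ereal_integral M (\<lambda>x. ereal (f x)) = ereal (\<integral>x. f x \<partial>M)"
proof -
  have fin: "(\<integral>\<^sup>+x. ennreal (f x) \<partial>M) < \<infinity>" "(\<integral>\<^sup>+x. ennreal (- f x) \<partial>M) < \<infinity>"
    using assms by (auto simp: real_integrable_def less_top)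
  then have "(\<integral>x. f x \<partial>M) = enn2real (\<integral>\<^sup>+x. ennreal (f x) \<partial>M) - enn2real (\<integral>\<^sup>+x. ennreal (- f x) \<partial>M)"
    using assms by (intro real_lebesgue_integral_def)
  moreover have "enn2ereal x = ereal (enn2real x)" if "x < \<infinity>" for x
    using that by (cases x) auto
  ultimately show ?thesis using fin by (simp add: ereal_integral_def)
qed

lemma emeasure_lborel_half_line: "emeasure lborel {0::real..} = top" "emeasure lborel {..0::real} = top"
proof -
  have "(SUP n. of_nat n :: ennreal) \<le> emeasure lborel {0::real..}"
  proof (rule SUP_least)
    fix n
    have "(of_nat n :: ennreal) = emeasure lborel {0..real n}" by (simp add: ennreal_of_nat_eq_real_of_nat)
    also have "\<dots> \<le> emeasure lborel {0::real..}" by (intro emeasure_mono) auto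
    finally show "(of_nat n :: ennreal) \<le> emeasure lborel {0::real..}" .
  qed
  then show "emeasure lborel {0::real..} = top" by (simp add: ennreal_SUP_of_nat_eq_top top_unique)
  have "(SUP n. of_nat n :: ennreal) \<le> emeasure lborel {..0::real}"
  proof (rule SUP_least)
    fix n
    have "(of_nat n :: ennreal) = emeasure lborel {- real n..0}" by (simp add: ennreal_of_nat_eq_real_of_nat)
    also have "\<dots> \<le> emeasure lborel {..0::real}" by (intro emeasure_mono) auto
    finally show "(of_nat n :: ennreal) \<le> emeasure lborel {..0::real}" .
  qed
  then show "emeasure lborel {..0::real} = top" by (simp add: ennreal_SUP_of_nat_eq_top top_unique)
qed

context
  fixes p :: real
  assumes p: "1 < p"
begin

text \<open>Layer-cake: \<open>exp (- \<bar>y\<bar>\<^sup>p)\<close> is the integral of \<open>exp (- t)\<close> over \<open>t \<ge> \<bar>y\<bar>\<^sup>p\<close>, and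
  \<open>\<bar>y\<bar>\<^sup>p \<le> t\<close> cuts out an interval of length \<open>2 t\<^sup>1\<^sup>/\<^sup>p\<close>.\<close>

lemma cosh_mgf_0_eq_Gamma: "cosh_mgf p 0 = 2 * Gamma (1 + 1 / p)"
proof -
  have ind: "indicator {\<bar>y\<bar> powr p..} t = (indicator {0..} t * indicator {- (t powr (1 / p))..t powr (1 / p)} y :: ennreal)" for y t :: real
  proof (cases "0 \<le> t")
    case True
    have "\<bar>y\<bar> powr p \<le> t \<longleftrightarrow> \<bar>y\<bar> \<le> t powr (1 / p)"
    proof
      assume "\<bar>y\<bar> powr p \<le> t"
      then have "(\<bar>y\<bar> powr p) powr (1 / p) \<le> t powr (1 / p)" using p by (intro powr_mono2) auto
      then show "\<bar>y\<bar> \<le> t powr (1 / p)" using p by (simp add: powr_powr)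
    next
      assume "\<bar>y\<bar> \<le> t powr (1 / p)"
      then have "\<bar>y\<bar> powr p \<le> (t powr (1 / p)) powr p" using p by (intro powr_mono2) auto
      then show "\<bar>y\<bar> powr p \<le> t" using p True by (simp add: powr_powr)
    qed
    then show ?thesis using True by (auto simp: indicator_def abs_le_iff)
  next
    case False
    then have "\<not> \<bar>y\<bar> powr p \<le> t" using powr_ge_zero[of "\<bar>y\<bar>" p] by linarith
    then show ?thesis using False by (simp add: indicator_def)
  qed
  have inner: "(\<integral>\<^sup>+t. ennreal (exp (- t)) * indicator {c..} t \<partial>lborel) = ennreal (exp (- c))" for c :: real
  proof -
    have "((\<lambda>t::real. - exp (- t)) \<longlongrightarrow> - 0) at_top"
      by (intro tendsto_minus filterlim_compose[OF exp_at_bot] filterlim_uminus_at_bot_at_top)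
    then have "(\<integral>\<^sup>+t. ennreal (exp (- t)) * indicator {c..} t \<partial>lborel) = ennreal (- 0 - (- exp (- c)))"
      by (intro nn_integral_FTC_atLeast[where F = "\<lambda>t. - exp (- t)"]) (auto intro!: derivative_eq_intros)
    then show ?thesis by simp
  qed
  have "ennreal (cosh_mgf p 0) = (\<integral>\<^sup>+y. ennreal (exp (- (\<bar>y\<bar> powr p))) \<partial>lborel)"
    using nn_integral_exp_minus_powr_unit[OF p, of 0] by simp
  also have "\<dots> = (\<integral>\<^sup>+y. \<integral>\<^sup>+t. ennreal (exp (- t)) * indicator {0..} t * indicator {- (t powr (1 / p))..t powr (1 / p)} y \<partial>lborel \<partial>lborel)"
  proof (rule nn_integral_cong)
    fix y :: real
    show "ennreal (exp (- (\<bar>y\<bar> powr p))) = (\<integral>\<^sup>+t. ennreal (exp (- t)) * indicator {0..} t * indicator {- (t powr (1 / p))..t powr (1 / p)} y \<partial>lborel)"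
      using inner[of "\<bar>y\<bar> powr p"] by (simp only: ind mult.assoc)
  qed
  also have "\<dots> = (\<integral>\<^sup>+t. \<integral>\<^sup>+y. ennreal (exp (- t)) * indicator {0..} t * indicator {- (t powr (1 / p))..t powr (1 / p)} (y::real) \<partial>lborel \<partial>lborel)"
    by (rule lborel_pair.Fubini') (simp add: indicator_def, measurable)
  also have "\<dots> = (\<integral>\<^sup>+t. 2 * ennreal (indicator {0..} t * t powr (1 + 1 / p - 1) / exp t) \<partial>lborel)"
  proof (rule nn_integral_cong)
    fix t :: real
    have "(\<integral>\<^sup>+y. ennreal (exp (- t)) * indicator {0..} t * indicator {- (t powr (1 / p))..t powr (1 / p)} (y::real) \<partial>lborel)
      = ennreal (exp (- t)) * indicator {0..} t * ennreal (2 * t powr (1 / p))"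
      by (subst nn_integral_cmult_indicator) auto
    also have "\<dots> = 2 * ennreal (indicator {0..} t * t powr (1 + 1 / p - 1) / exp t)"
      by (auto simp: indicator_def exp_minus field_simps ennreal_mult[symmetric] simp flip: ennreal_numeral)
    finally show "(\<integral>\<^sup>+y. ennreal (exp (- t)) * indicator {0..} t * indicator {- (t powr (1 / p))..t powr (1 / p)} (y::real) \<partial>lborel)
      = 2 * ennreal (indicator {0..} t * t powr (1 + 1 / p - 1) / exp t)" .
  qed
  also have "\<dots> = 2 * ennreal (Gamma (1 + 1 / p))"
    using p by (subst nn_integral_cmult) (auto simp: Gamma_conv_nn_integral_real add_pos_pos)
  also have "\<dots> = ennreal (2 * Gamma (1 + 1 / p))"
    using p by (simp add: ennreal_mult Gamma_real_pos add_pos_pos less_imp_le)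
  finally show ?thesis
    using p by (subst (asm) ennreal_inj) (auto simp: Gamma_real_pos add_pos_pos less_imp_le cosh_mgf_pos[OF p])
qed

text \<open>The minimum of \<open>objective\<close> at w = 0, attained at t = 0 and s = 1/p. It is
  also the growth rate of the volume of the ball, apart from the factor n^(-n/p), hence the
  normalising constant of the rate.\<close>

definition base_value :: real where
  "base_value = 1 / p + (1 / p) * ln p + log_mgf p 0"

lemma ln_normalizer: "exp ((1 / p) * ln p + log_mgf p 0) = 2 * p powr (1 / p) * Gamma (1 + 1 / p)"
  using p by (simp add: exp_add exp_log_mgf[OF p] cosh_mgf_0_eq_Gamma powr_def)

section \<open>Closed forms of the logarithmic transforms\<close>

lemma nn_integral_mu:
  assumes "g \<in> borel_measurable borel"
  shows "(\<integral>\<^sup>+y. g y \<partial>mu p)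
    = (\<integral>\<^sup>+y. ennreal (exp (- ((1 / p) * ln p + log_mgf p 0) - (\<bar>y\<bar> powr p) / p)) * g y \<partial>lborel)"
proof -
  have "1 / (2 * p powr (1 / p) * Gamma (1 + 1 / p)) = exp (- ((1 / p) * ln p + log_mgf p 0))"
    unfolding exp_minus ln_normalizer by (simp add: inverse_eq_divide)
  then have "1 / (2 * p powr (1 / p) * Gamma (1 + 1 / p)) * exp (- (\<bar>y\<bar> powr p) / p)
      = exp (- ((1 / p) * ln p + log_mgf p 0) - (\<bar>y\<bar> powr p) / p)" for y :: real
    by (simp only: exp_add[symmetric]) simp
  then have "mu p = density lborel (\<lambda>y. ennreal (exp (- ((1 / p) * ln p + log_mgf p 0) - (\<bar>y\<bar> powr p) / p)))"
    unfolding mu_def by (simp only:)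
  then show ?thesis using assms by (simp only:) (rule nn_integral_density, auto)
qed

lemma Lam_eq:
  assumes "t2 < 1 / p"
  shows "Lam p t1 t2 = ereal (- (1 / p) * ln (1 / p - t2) + log_mgf p (t1 * (1 / p - t2) powr (- 1 / p)) - ((1 / p) * ln p + log_mgf p 0))"
proof -
  let ?s = "1 / p - t2" and ?N = "(1 / p) * ln p + log_mgf p 0"
  have "(\<integral>\<^sup>+y. ennreal (exp (t1 * y + t2 * \<bar>y\<bar> powr p)) \<partial>mu p)
      = (\<integral>\<^sup>+y. ennreal (exp (- ?N)) * ennreal (exp (t1 * y - ?s * \<bar>y\<bar> powr p)) \<partial>lborel)"
  proof (subst nn_integral_mu, measurable, rule nn_integral_cong)
    fix y :: real
    have "- ?N - \<bar>y\<bar> powr p / p + (t1 * y + t2 * \<bar>y\<bar> powr p) = - ?N + (t1 * y - ?s * \<bar>y\<bar> powr p)"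
      by (simp add: algebra_simps)
    then show "ennreal (exp (- ?N - \<bar>y\<bar> powr p / p)) * ennreal (exp (t1 * y + t2 * \<bar>y\<bar> powr p))
        = ennreal (exp (- ?N)) * ennreal (exp (t1 * y - ?s * \<bar>y\<bar> powr p))"
      by (simp only: ennreal_mult[symmetric] exp_ge_zero exp_add[symmetric])
  qed
  also have "\<dots> = ennreal (exp (- ?N)) * ennreal (exp (- (1 / p) * ln ?s + log_mgf p (t1 * ?s powr (- 1 / p))))"
  proof -
    have "(\<integral>\<^sup>+y. ennreal (exp (- ?N)) * ennreal (exp (t1 * y - ?s * \<bar>y\<bar> powr p)) \<partial>lborel)
        = ennreal (exp (- ?N)) * (\<integral>\<^sup>+y. ennreal (exp (t1 * y - ?s * \<bar>y\<bar> powr p)) \<partial>lborel)"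
      by (rule nn_integral_cmult) measurable
    then show ?thesis using nn_integral_exp_minus_powr[OF p, of ?s t1] assms by simp
  qed
  also have "\<dots> = ennreal (exp (- (1 / p) * ln ?s + log_mgf p (t1 * ?s powr (- 1 / p)) - ?N))"
    by (simp only: ennreal_mult[symmetric] exp_ge_zero exp_add[symmetric]) (simp add: algebra_simps)
  finally show ?thesis unfolding Lam_def by (simp only: ln_ennreal_ennreal_exp)
qed

text \<open>On the half-line where t1 y \<ge> 0 the Lebesgue integrand stays above a positive
  constant.\<close>

lemma Lam_infinite:
  assumes "1 / p \<le> t2"
  shows "Lam p t1 t2 = \<infinity>"
proof -
  let ?N = "(1 / p) * ln p + log_mgf p 0"
  have "(\<integral>\<^sup>+y. ennreal (exp (- ?N)) * indicator (if 0 \<le> t1 then {0..} else {..0::real}) y \<partial>lborel)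
      \<le> (\<integral>\<^sup>+y. ennreal (exp (- ?N - \<bar>y\<bar> powr p / p)) * ennreal (exp (t1 * y + t2 * \<bar>y\<bar> powr p)) \<partial>lborel)"
  proof (rule nn_integral_mono)
    fix y :: real
    show "ennreal (exp (- ?N)) * indicator (if 0 \<le> t1 then {0..} else {..0::real}) y
      \<le> ennreal (exp (- ?N - \<bar>y\<bar> powr p / p)) * ennreal (exp (t1 * y + t2 * \<bar>y\<bar> powr p))"
    proof (cases "y \<in> (if 0 \<le> t1 then {0..} else {..0})")
      case True
      then have "0 \<le> t1 * y" by (auto split: if_splits simp: zero_le_mult_iff)
      moreover have "1 / p * \<bar>y\<bar> powr p \<le> t2 * \<bar>y\<bar> powr p" using assms by (intro mult_right_mono) auto
      ultimately have "- ?N \<le> (- ?N - \<bar>y\<bar> powr p / p) + (t1 * y + t2 * \<bar>y\<bar> powr p)" by simp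
      then have "exp (- ?N) \<le> exp (- ?N - \<bar>y\<bar> powr p / p) * exp (t1 * y + t2 * \<bar>y\<bar> powr p)"
        by (simp only: exp_add[symmetric] exp_le_cancel_iff)
      then show ?thesis using True by (simp only: ennreal_mult[symmetric] exp_ge_zero indicator_simps mult_1_right ennreal_leI)
    qed simp
  qed
  also have "\<dots> = (\<integral>\<^sup>+y. ennreal (exp (t1 * y + t2 * \<bar>y\<bar> powr p)) \<partial>mu p)"
    by (rule nn_integral_mu[symmetric]) measurable
  finally have "(\<integral>\<^sup>+y. ennreal (exp (- ?N)) * indicator (if 0 \<le> t1 then {0..} else {..0::real}) y \<partial>lborel)
      \<le> (\<integral>\<^sup>+y. ennreal (exp (t1 * y + t2 * \<bar>y\<bar> powr p)) \<partial>mu p)" .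
  moreover have "(\<integral>\<^sup>+y. ennreal (exp (- ?N)) * indicator (if 0 \<le> t1 then {0..} else {..0::real}) y \<partial>lborel) = \<infinity>"
    by (subst nn_integral_cmult_indicator) (auto simp: ennreal_mult_eq_top_iff emeasure_lborel_half_line)
  ultimately have "(\<integral>\<^sup>+y. ennreal (exp (t1 * y + t2 * \<bar>y\<bar> powr p)) \<partial>mu p) = \<infinity>" by (simp add: top_unique)
  then show ?thesis unfolding Lam_def by simp
qed

lemma Psi_eq:
  assumes "t2 < 1 / p"
  shows "Psi p (mu 2) t1 t2 = ereal (pressure p t1 (1 / p - t2) - ((1 / p) * ln p + log_mgf p 0))"
proof -
  let ?s = "1 / p - t2" and ?N = "(1 / p) * ln p + log_mgf p 0"
  let ?f = "\<lambda>u. - (1 / p) * ln ?s + log_mgf p (t1 * ?s powr (- 1 / p) * u) - ?N"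
  have "Lam p (t1 * u) t2 = ereal (?f u)" for u
    using Lam_eq[OF assms, of "t1 * u"] by (simp add: mult_ac)
  then have "Psi p (mu 2) t1 t2 = ereal_integral (mu 2) (\<lambda>u. ereal (?f u))" by (simp add: Psi_def)
  also have "\<dots> = ereal (\<integral>u. ?f u \<partial>mu 2)"
    using integrable_log_mgf_mu_2[OF p] by (intro ereal_integral_real) auto
  also have "(\<integral>u. ?f u \<partial>mu 2) = pressure p t1 ?s - ?N"
    using integrable_log_mgf_mu_2[OF p, of "t1 * ?s powr (- 1 / p)"] mu_2.prob_space
    by (simp add: pressure_def avg_log_mgf_def)
  finally show ?thesis .
qed

lemma Psi_infinite:
  assumes "1 / p \<le> t2"
  shows "Psi p (mu 2) t1 t2 = \<infinity>"
  using Lam_infinite[OF assms] mu_2.emeasure_space_1 by (simp add: Psi_def ereal_integral_def)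

text \<open>The substitution s = 1/p - t2 > 0 describes exactly the half-plane where
  \<open>Psi\<close> is finite. Members of the supremum are affine in w, which later makes sublevel
  sets closed and convex.\<close>

definition rate :: "real \<Rightarrow> ereal" where
  "rate w = (SUP (t, s)\<in>UNIV \<times> {0<..}. ereal (base_value - objective p w t s))"

lemma rate_upper: "0 < s \<Longrightarrow> ereal (base_value - objective p w t s) \<le> rate w"
  unfolding rate_def by (rule SUP_upper2[of "(t, s)"]) auto

lemma rate_least: "(\<And>t s. 0 < s \<Longrightarrow> ereal (base_value - objective p w t s) \<le> x) \<Longrightarrow> rate w \<le> x"
  unfolding rate_def by (rule SUP_least) auto

text \<open>Parameters with t2 \<ge> 1/p contribute -\<infinity> to the transform, which leaves
  those with s > 0.\<close>

lemma legendre2_Psi_1: "legendre2 (Psi p (mu 2)) w 1 = rate w"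
proof (rule antisym)
  show "legendre2 (Psi p (mu 2)) w 1 \<le> rate w"
    unfolding legendre2_def
  proof (rule SUP_least, clarify)
    fix t1 t2 :: real
    show "ereal (t1 * w + t2 * 1) - Psi p (mu 2) t1 t2 \<le> rate w"
    proof (cases "t2 < 1 / p")
      case True
      then show ?thesis using rate_upper[of "1 / p - t2" w t1]
        by (simp add: Psi_eq objective_def base_value_def algebra_simps)
    qed (simp add: Psi_infinite)
  qed
  show "rate w \<le> legendre2 (Psi p (mu 2)) w 1"
  proof (rule rate_least)
    fix t s :: real assume s: "0 < s"
    have "ereal (base_value - objective p w t s) = ereal (t * w + (1 / p - s) * 1) - Psi p (mu 2) t (1 / p - s)"
      using s by (simp add: Psi_eq objective_def base_value_def algebra_simps)
    also have "\<dots> \<le> legendre2 (Psi p (mu 2)) w 1"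
      unfolding legendre2_def by (rule SUP_upper2[of "(t, 1 / p - s)"]) auto
    finally show "ereal (base_value - objective p w t s) \<le> legendre2 (Psi p (mu 2)) w 1" .
  qed
qed

text \<open>By scaling, the transform at \<open>(w \<tau>\<^sup>1\<^sup>/\<^sup>p, \<tau>)\<close> exceeds the one at \<open>(w, 1)\<close> by
  \<open>(\<tau> - 1 - ln \<tau>) / p \<ge> 0\<close>, so the infimum in \<^const>\<open>I_qu\<close> is attained at \<open>\<tau> = 1\<close>.\<close>

lemma I_qu_eq_rate: "I_qu p (mu 2) w = rate w"
proof (rule antisym)
  show "I_qu p (mu 2) w \<le> rate w"
    unfolding I_qu_def legendre2_Psi_1[symmetric] by (rule Inf_lower, rule CollectI, rule exI[of _ w], rule exI[of _ 1]) simp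
  show "rate w \<le> I_qu p (mu 2) w"
    unfolding I_qu_def
  proof (rule Inf_greatest, clarify)
    fix \<tau>1 \<tau>2 :: real assume \<tau>: "0 < \<tau>2"
    let ?w = "\<tau>1 * \<tau>2 powr - (1 / p)"
    show "rate ?w \<le> legendre2 (Psi p (mu 2)) \<tau>1 \<tau>2"
    proof (rule rate_least)
      fix t s :: real assume s: "0 < s"
      \<comment> \<open>Together with s' this preserves both products with the dual variables and
        the argument of \<open>avg_log_mgf\<close>; only the logarithm and the coefficient 1/p feel
        the scaling.\<close>
      define t' where "t' = t * \<tau>2 powr - (1 / p)"
      define s' where "s' = s / \<tau>2"
      have s': "0 < s'" using s \<tau> by (simp add: s'_def)
      have "s' powr (- 1 / p) = s powr (- 1 / p) * \<tau>2 powr (1 / p)"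
        using s \<tau> by (simp add: s'_def powr_divide powr_minus divide_simps)
      then have x: "t' * s' powr (- 1 / p) = t * s powr (- 1 / p)"
        using \<tau> by (simp add: t'_def powr_minus)
      have "ln \<tau>2 \<le> \<tau>2 - 1" using \<tau> by (rule ln_le_minus_one)
      then have "ln \<tau>2 / p \<le> (\<tau>2 - 1) / p" using p by (intro divide_right_mono) auto
      moreover have eqs: "t' * \<tau>1 = t * ?w" "s' * \<tau>2 = s" "ln s' = ln s - ln \<tau>2"
        using s \<tau> by (simp_all add: t'_def s'_def ln_div)
      ultimately have "base_value - objective p ?w t s \<le> t' * \<tau>1 + (1 / p - s') * \<tau>2 - (pressure p t' s' - ((1 / p) * ln p + log_mgf p 0))"
        unfolding objective_def base_value_def pressure_def x
        by (simp only: left_diff_distrib eqs) (simp add: right_diff_distrib diff_divide_distrib)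
      also have "ereal \<dots> = ereal (t' * \<tau>1 + (1 / p - s') * \<tau>2) - Psi p (mu 2) t' (1 / p - s')"
        using s' by (simp add: Psi_eq)
      also have "\<dots> \<le> legendre2 (Psi p (mu 2)) \<tau>1 \<tau>2"
        unfolding legendre2_def by (rule SUP_upper2[of "(t', 1 / p - s')"]) auto
      finally show "ereal (base_value - objective p ?w t s) \<le> legendre2 (Psi p (mu 2)) \<tau>1 \<tau>2" by simp
    qed
  qed
qed

text \<open>The two parts are minimised separately: \<open>avg_log_mgf\<close> is smallest at 0, and
  s - (ln s)/p is smallest at s = 1/p by ln z \<le> z - 1 for z = p s.\<close>

lemma objective_0: "0 < s \<Longrightarrow> base_value \<le> objective p 0 t s"
  and objective_base: "objective p w 0 (1 / p) = base_value"
proof -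
  show "objective p w 0 (1 / p) = base_value"
    using p by (simp add: objective_def base_value_def pressure_def avg_log_mgf_0[OF p] ln_div)
  assume s: "0 < s"
  have "log_mgf p 0 \<le> avg_log_mgf p (t * s powr (- 1 / p))"
    unfolding avg_log_mgf_0[OF p, symmetric] by (rule avg_log_mgf_mono[OF p]) simp
  moreover have "1 / p + 1 / p * ln p \<le> s - 1 / p * ln s"
  proof -
    have "ln (p * s) \<le> p * s - 1" using s p by (intro ln_le_minus_one) simp
    then have "(1 + ln p + ln s) / p \<le> (p * s) / p" using s p by (intro divide_right_mono) (auto simp: ln_mult)
    then show ?thesis using p by (simp add: add_divide_distrib)
  qed
  ultimately show "base_value \<le> objective p 0 t s"
    by (simp add: objective_def base_value_def pressure_def)
qed

section \<open>Monotonicity and sublevel sets of the rate\<close>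

lemma rate_nonneg: "0 \<le> rate w"
  using rate_upper[of "1 / p" w 0] p by (simp add: objective_base zero_ereal_def)

text \<open>The pressure is even in t, so the sign of t can be matched to that of w' and the linear
  term only grows.\<close>

lemma rate_mono: "\<bar>w\<bar> \<le> \<bar>w'\<bar> \<Longrightarrow> rate w \<le> rate w'"
proof (rule rate_least)
  fix t s :: real assume w: "\<bar>w\<bar> \<le> \<bar>w'\<bar>" and s: "0 < s"
  define t' where "t' = (if 0 \<le> w' then \<bar>t\<bar> else - \<bar>t\<bar>)"
  have "t * w \<le> \<bar>t\<bar> * \<bar>w\<bar>" by (simp flip: abs_mult)
  also have "\<dots> \<le> \<bar>t\<bar> * \<bar>w'\<bar>" using w by (intro mult_left_mono) auto
  also have "\<dots> = t' * w'" by (simp add: t'_def)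
  finally have "t * w \<le> t' * w'" .
  moreover have "pressure p t' s = pressure p t s" by (auto simp: t'_def abs_if pressure_minus[OF p])
  ultimately have "base_value - objective p w t s \<le> base_value - objective p w' t' s" by (simp add: objective_def)
  then show "ereal (base_value - objective p w t s) \<le> rate w'" using rate_upper[OF s, of w' t'] by (meson ereal_less_eq(3) order_trans)
qed

lemma rate_minus: "rate (- w) = rate w"
  by (intro antisym rate_mono) auto

lemma rate_sublevel: "{w. rate w \<le> c} = (\<Inter>(t, s)\<in>UNIV \<times> {0<..}. {w. ereal (base_value - s - pressure p t s + t * w) \<le> c})"
  by (auto simp: rate_def SUP_le_iff objective_def algebra_simps)

lemma closed_rate_sublevel: "closed {w. rate w \<le> c}"
  unfolding rate_sublevel
proof (intro closed_INT ballI, clarify)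
  fix t s :: real
  show "closed {w. ereal (base_value - s - pressure p t s + t * w) \<le> c}"
  proof (cases c)
    case (real r)
    then show ?thesis by (auto intro!: closed_Collect_le continuous_intros)
  qed auto
qed

lemma convex_rate_sublevel: "convex {w. rate w \<le> ereal c}"
  unfolding rate_sublevel
proof (intro convex_INT, clarify)
  fix t s :: real
  have "{w. ereal (base_value - s - pressure p t s + t * w) \<le> ereal c} = {w. inner t w \<le> c - (base_value - s - pressure p t s)}"
    by (auto simp: algebra_simps)
  then show "convex {w. ereal (base_value - s - pressure p t s + t * w) \<le> ereal c}" by (simp only: convex_halfspace_le)
qed

text \<open>The single affine minorant with t = 1 and s = 1/p already bounds \<bar>w\<bar>.\<close>

lemma compact_rate_sublevel: "compact {w. rate w \<le> ereal c}"
proof -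
  define K where "K = c - (base_value - 1 / p - pressure p 1 (1 / p))"
  have "\<bar>w\<bar> \<le> K" if "rate w \<le> ereal c" for w
  proof -
    have "rate \<bar>w\<bar> \<le> ereal c" using rate_mono[of "\<bar>w\<bar>" w] that by simp
    then have "ereal (base_value - objective p \<bar>w\<bar> 1 (1 / p)) \<le> ereal c"
      using rate_upper[of "1 / p" "\<bar>w\<bar>" 1] p by (meson order_trans zero_less_divide_1_iff less_trans zero_less_one)
    then show ?thesis by (simp add: objective_def K_def)
  qed
  then have "bounded {w. rate w \<le> ereal c}" by (intro boundedI[of _ K]) auto
  then show ?thesis using closed_rate_sublevel by (simp add: compact_eq_bounded_closed)
qed

end

section \<open>The large deviation principle\<close>

context
  fixes p :: real
  assumes p: "1 < p"
begin

lemma continuous_objective: "continuous_on (UNIV \<times> {0<..}) (\<lambda>(t, s). objective p w t s)"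
proof -
  have "continuous_on (UNIV \<times> {0<..}) (\<lambda>x. avg_log_mgf p (fst x * snd x powr (- 1 / p)))"
    by (rule continuous_on_compose2[OF continuous_avg_log_mgf[OF p, of UNIV]]) (auto intro!: continuous_intros)
  then show ?thesis
    unfolding objective_def pressure_def case_prod_beta by (intro continuous_intros) auto
qed

text \<open>Finiteness of the rate at a point of strictly larger modulus makes
  \<open>objective\<close> coercive: parameters doing at least as well as (0, 1/p) lie in a compact
  rectangle on which s stays positive.\<close>

lemma objective_minimizer:
  assumes w: "\<bar>w\<bar> < \<bar>w'\<bar>" and fin: "rate p w' < \<infinity>"
  shows "\<exists>t s. 0 < s \<and> (\<forall>t' s'. 0 < s' \<longrightarrow> objective p w t s \<le> objective p w t' s')"
proof -
  let ?b = "base_value p"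
  obtain J where J: "rate p w' = ereal J" "0 \<le> J"
    using fin rate_nonneg[OF p, of w'] by (cases "rate p w'") auto
  define \<Delta> where "\<Delta> = \<bar>w'\<bar> - \<bar>w\<bar>"
  have \<Delta>: "0 < \<Delta>" using w by (simp add: \<Delta>_def)
  define T where "T = J / \<Delta>"
  define c where "c = ?b + T * \<bar>w\<bar> - log_mgf p 0"
  have t_bound: "\<bar>t\<bar> \<le> T" if s: "0 < s" and le: "objective p w t s \<le> ?b" for t s
  proof -
    \<comment> \<open>The point of modulus \<bar>w'\<bar> on the side favoured by t. Comparing
      \<open>objective\<close> there and at w leaves the surplus \<bar>t\<bar> \<Delta>, which the
      finite rate bounds by J.\<close>
    define w'' where "w'' = (if 0 \<le> t then \<bar>w'\<bar> else - \<bar>w'\<bar>)"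
    have "rate p w'' \<le> rate p w'" by (intro rate_mono[OF p]) (simp add: w''_def)
    with rate_upper[OF p s, of w'' t] have "ereal (?b - objective p w'' t s) \<le> ereal J"
      unfolding J(1)[symmetric] by (rule order_trans)
    moreover have "t * w'' = \<bar>t\<bar> * \<bar>w'\<bar>" by (simp add: w''_def)
    moreover have "t * w \<le> \<bar>t\<bar> * \<bar>w\<bar>" by (simp flip: abs_mult)
    ultimately have "\<bar>t\<bar> * \<Delta> \<le> J" using le by (simp add: objective_def \<Delta>_def right_diff_distrib)
    then show ?thesis using \<Delta> by (simp add: T_def field_simps)
  qed
  \<comment> \<open>With t bounded, s - (ln s)/p \<le> c remains. It excludes small s through the
    logarithm and large s because 1 - 1/p > 0.\<close>
  have s_bound: "exp (- p * c) \<le> s \<and> s \<le> c / (1 - 1 / p)" if s: "0 < s" and le: "objective p w t s \<le> ?b" for t s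
  proof -
    have "t * w \<le> \<bar>t\<bar> * \<bar>w\<bar>" by (simp flip: abs_mult)
    also have "\<dots> \<le> T * \<bar>w\<bar>" using t_bound[OF s le] by (intro mult_right_mono) auto
    finally have tw: "t * w \<le> T * \<bar>w\<bar>" .
    have "log_mgf p 0 \<le> avg_log_mgf p (t * s powr (- 1 / p))"
      unfolding avg_log_mgf_0[OF p, symmetric] by (rule avg_log_mgf_mono[OF p]) simp
    with tw le have c: "s - ln s / p \<le> c" by (simp add: objective_def pressure_def c_def)
    have "ln s / p \<le> s / p" using ln_le_minus_one[OF s] p by (intro divide_right_mono) auto
    then have "s * (1 - 1 / p) \<le> c" using c by (simp add: algebra_simps)
    moreover have "0 < 1 - 1 / p" using p by simp
    ultimately have "s \<le> c / (1 - 1 / p)" by (simp add: pos_le_divide_eq)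
    moreover have "- p * c \<le> ln s"
    proof -
      have "- c \<le> ln s / p" using c s by linarith
      then have "p * (- c) \<le> p * (ln s / p)" using p by (intro mult_left_mono) auto
      then show ?thesis using p by simp
    qed
    then have "exp (- p * c) \<le> exp (ln s)" by simp
    ultimately show ?thesis using s by simp
  qed
  define K where "K = {- T..T} \<times> {exp (- p * c)..c / (1 - 1 / p)}"
  have base: "objective p w 0 (1 / p) = ?b" by (rule objective_base[OF p])
  have inK: "(t, s) \<in> K" if "0 < s" "objective p w t s \<le> ?b" for t s
    using t_bound[OF that] s_bound[OF that] by (auto simp: K_def abs_le_iff)
  have "compact K" unfolding K_def by (intro compact_Times compact_Icc)
  moreover have "K \<noteq> {}" using inK[of "1 / p" 0] base p by auto
  moreover have Kpos: "K \<subseteq> UNIV \<times> {0<..}"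
    using less_le_trans[OF exp_gt_zero[of "- p * c"]] by (auto simp: K_def)
  ultimately obtain z where z: "z \<in> K" "\<And>z'. z' \<in> K \<Longrightarrow> (case z of (t, s) \<Rightarrow> objective p w t s) \<le> (case z' of (t, s) \<Rightarrow> objective p w t s)"
    using continuous_attains_inf[of K "\<lambda>(t, s). objective p w t s"] continuous_on_subset[OF continuous_objective Kpos] by blast
  obtain t s where ts: "z = (t, s)" by (cases z)
  have "objective p w t s \<le> objective p w t' s'" if "0 < s'" for t' s'
  proof (cases "objective p w t' s' \<le> ?b")
    case True
    then show ?thesis using z(2)[OF inK[OF that True]] by (simp add: ts)
  next
    case False
    have "objective p w t s \<le> ?b" using z(2)[OF inK[of "1 / p" 0]] base p by (simp add: ts)
    then show ?thesis using False by linarith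
  qed
  moreover have "0 < s" using z(1) Kpos ts by auto
  ultimately show ?thesis by blast
qed

context
  fixes P :: "nat \<Rightarrow> 'a measure" and X :: "nat \<Rightarrow> 'a \<Rightarrow> nat \<Rightarrow> real" and a :: "nat \<Rightarrow> nat \<Rightarrow> real"
  assumes prob: "\<And>n. n \<ge> 1 \<Longrightarrow> prob_space (P n)"
    and unif: "\<And>n. n \<ge> 1 \<Longrightarrow> uniform_on_lp_ball (P n) n p (X n)"
    and lim: "\<And>x. (\<lambda>n. emp_log_mgf p n (a n) x) \<longlonglongrightarrow> avg_log_mgf p x"
begin

definition event_prob :: "nat \<Rightarrow> real set \<Rightarrow> ennreal" where
  "event_prob n S = emeasure (P n) (W p X a n -` S \<inter> space (P n))"

definition slice_vol :: "nat \<Rightarrow> real set \<Rightarrow> ennreal" where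
  "slice_vol n S = emeasure (lborel_Pi n) {x \<in> space (lborel_Pi n). lp_sum p n x \<le> 1 \<and> proj p n (a n) x \<in> S}"

section \<open>Probabilities as quotients of slice volumes\<close>

lemma W_measurable: "1 \<le> n \<Longrightarrow> W p X a n \<in> borel_measurable (P n)"
proof -
  assume "1 \<le> n"
  then have "X n \<in> P n \<rightarrow>\<^sub>M lborel_Pi n" using unif by (simp add: uniform_on_lp_ball_def)
  from measurable_compose[OF this measurable_proj, of p "a n"]
  show ?thesis unfolding W_def[abs_def] proj_def .
qed

lemma slice_vol_mono: "S \<subseteq> S' \<Longrightarrow> S' \<in> sets borel \<Longrightarrow> slice_vol n S \<le> slice_vol n S'"
proof -
  assume "S \<subseteq> S'" and [measurable]: "S' \<in> sets borel"
  then show ?thesis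
    unfolding slice_vol_def by (intro emeasure_mono subsetI) (blast, measurable)
qed

lemma event_prob_eq:
  assumes n: "1 \<le> n" and S: "S \<in> sets borel"
  shows "event_prob n S = slice_vol n S / slice_vol n UNIV"
proof -
  let ?L = "lborel_Pi n"
  have X: "X n \<in> P n \<rightarrow>\<^sub>M ?L" and D: "distr (P n) ?L (X n) = uniform_measure ?L (lp_ball n p)"
    using unif[OF n] by (auto simp: uniform_on_lp_ball_def)
  let ?E = "{x \<in> space ?L. proj p n (a n) x \<in> S}"
  have E: "?E \<in> sets ?L" using S by measurable
  have ball: "lp_ball n p = {x \<in> space ?L. lp_sum p n x \<le> 1}" by (simp add: lp_ball_def lp_sum_def)
  then have ballm: "lp_ball n p \<in> sets ?L" by simp measurable
  have "W p X a n -` S \<inter> space (P n) = X n -` ?E \<inter> space (P n)"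
    using measurable_space[OF X] by (auto simp: W_def proj_def)
  then have "event_prob n S = emeasure (distr (P n) ?L (X n)) ?E"
    unfolding event_prob_def using emeasure_distr[OF X E] by simp
  also have "\<dots> = emeasure ?L (lp_ball n p \<inter> ?E) / emeasure ?L (lp_ball n p)"
    unfolding D using ballm E by (rule emeasure_uniform_measure)
  also have "lp_ball n p \<inter> ?E = {x \<in> space ?L. lp_sum p n x \<le> 1 \<and> proj p n (a n) x \<in> S}" unfolding ball by auto
  also have "emeasure ?L (lp_ball n p) = slice_vol n UNIV" by (simp add: ball slice_vol_def)
  finally show ?thesis by (simp add: slice_vol_def)
qed

lemma event_prob_mono: "1 \<le> n \<Longrightarrow> S \<subseteq> S' \<Longrightarrow> S' \<in> sets borel \<Longrightarrow> event_prob n S \<le> event_prob n S'"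
  unfolding event_prob_def using measurable_sets[OF W_measurable, of n S'] by (intro emeasure_mono) auto

lemma eventually_exp_small: "0 < \<epsilon> \<Longrightarrow> \<forall>\<^sub>F n::nat in sequentially. 2 \<le> exp (real n * \<epsilon>)" for \<epsilon> :: real
proof -
  assume \<epsilon>: "0 < \<epsilon>"
  have "\<forall>\<^sub>F n::nat in sequentially. 1 / \<epsilon> \<le> real n"
    using eventually_ge_at_top[of "nat \<lceil>1 / \<epsilon>\<rceil>"] by eventually_elim linarith
  then show ?thesis
  proof eventually_elim
    case (elim n)
    then have "1 \<le> real n * \<epsilon>" using \<epsilon> by (simp add: field_simps)
    then show ?case using exp_ge_add_one_self[of "real n * \<epsilon>"] by linarith
  qed
qed

text \<open>Chernoff's bound with t = 0 and d = 0. At t = 0 the empirical pressure does not depend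
  on the direction, so the bound holds for every n \<ge> 1 without a limit.\<close>

lemma slice_vol_UNIV_upper:
  assumes n: "1 \<le> n"
  shows "slice_vol n UNIV \<le> ennreal (2 * exp (real n * (base_value p - (1 / p) * ln (real n))))"
proof -
  have "emp_pressure p n (a n) 0 (1 / p) = 1 / p * ln p + log_mgf p 0"
    using n p by (simp add: emp_pressure_def emp_log_mgf_def ln_div)
  then show ?thesis
    using emeasure_tail_le[OF p n, of "1 / p" 0 0 "a n"] p
    by (simp add: slice_vol_def base_value_def[OF p] add.assoc)
qed

lemma slice_vol_lower:
  assumes s: "0 < s" and min: "\<And>t' s'. 0 < s' \<Longrightarrow> objective p w t s \<le> objective p w t' s'"
    and \<rho>: "0 < \<rho>" and \<epsilon>: "0 < \<epsilon>"
  shows "\<forall>\<^sub>F n in sequentially. ennreal (exp (real n * (objective p w t s - (1 / p) * ln (real n) - \<epsilon>)))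
    \<le> slice_vol n (ball w \<rho>)"
proof -
  have "\<forall>\<^sub>F n in sequentially. ennreal (exp (real n * (objective p w t s - (1 / p) * ln (real n) - \<epsilon>)))
    \<le> emeasure (lborel_Pi n) {x \<in> space (lborel_Pi n). lp_sum p n x \<le> 1 \<and> \<bar>proj p n (a n) x - w\<bar> < \<rho>}"
    by (rule emeasure_ball_lower[OF p lim s _ \<rho> \<epsilon>]) (rule min)
  then show ?thesis by (simp add: slice_vol_def dist_real_def abs_minus_commute)
qed

text \<open>The ball contains the slice near projection 0, whose minimiser (0, 1/p) is
  explicit.\<close>

lemma slice_vol_UNIV_lower:
  assumes \<epsilon>: "0 < \<epsilon>"
  shows "\<forall>\<^sub>F n in sequentially. ennreal (exp (real n * (base_value p - (1 / p) * ln (real n) - \<epsilon>))) \<le> slice_vol n UNIV"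
proof -
  have min: "objective p 0 0 (1 / p) \<le> objective p 0 t' s'" if "0 < s'" for t' s'
    using objective_0[OF p that] objective_base[OF p] by simp
  have "0 < 1 / p" using p by simp
  then have "\<forall>\<^sub>F n in sequentially. ennreal (exp (real n * (objective p 0 0 (1 / p) - (1 / p) * ln (real n) - \<epsilon>)))
    \<le> slice_vol n (ball 0 1)"
    by (rule slice_vol_lower[OF _ _ zero_less_one \<epsilon>]) (rule min)
  then show ?thesis
  proof eventually_elim
    case (elim n)
    then show ?case using slice_vol_mono[of "ball 0 1" UNIV n] by (simp add: objective_base[OF p])
  qed
qed

lemma event_prob_upper:
  assumes t: "0 \<le> t" and s: "0 < s" and \<epsilon>: "0 < \<epsilon>"
  shows "\<forall>\<^sub>F n in sequentially. event_prob n {v. d \<le> \<bar>v\<bar>} \<le> ennreal (exp (real n * (objective p d t s - base_value p + \<epsilon>)))"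
proof -
  \<comment> \<open>One third each for the limit of the pressure, for the factor 2 and for the
    volume of the ball in the denominator.\<close>
  define e where "e = \<epsilon> / 3"
  have e: "0 < e" using \<epsilon> by (simp add: e_def)
  have "\<forall>\<^sub>F n in sequentially. emp_pressure p n (a n) t s < pressure p t s + e"
    using e by (intro order_tendstoD(2)[OF emp_pressure_tendsto[OF p lim]]) simp
  then show ?thesis
    using eventually_exp_small[OF e] slice_vol_UNIV_lower[OF e] eventually_ge_at_top[of 1]
  proof eventually_elim
    case (elim n)
    let ?l = "(1 / p) * ln (real n)"
    let ?B = "exp (real n * (objective p d t s - base_value p + \<epsilon>))"
    let ?V = "exp (real n * (base_value p - ?l - e))"
    have S: "{v::real. d \<le> \<bar>v\<bar>} \<in> sets borel" by measurable
    have "2 * exp (real n * (s - t * d + emp_pressure p n (a n) t s - ?l))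
        \<le> exp (real n * e) * exp (real n * (s - t * d + emp_pressure p n (a n) t s - ?l))"
      using elim(2) by (intro mult_right_mono) auto
    also have "\<dots> = exp (real n * (e + (s - t * d + emp_pressure p n (a n) t s - ?l)))"
      by (simp add: exp_add[symmetric] distrib_left)
    also have "\<dots> \<le> exp (real n * ((objective p d t s - base_value p + \<epsilon>) + (base_value p - ?l - e)))"
    proof -
      have "e + (s - t * d + emp_pressure p n (a n) t s - ?l) \<le> (objective p d t s - base_value p + \<epsilon>) + (base_value p - ?l - e)"
        using elim(1) by (simp add: objective_def e_def)
      then show ?thesis by (simp only: exp_le_cancel_iff) (rule mult_left_mono, auto)
    qed
    also have "\<dots> = ?V * ?B" by (simp only: exp_add[symmetric] distrib_left[symmetric] add.commute)
    finally have "ennreal (2 * exp (real n * (s - t * d + emp_pressure p n (a n) t s - ?l))) \<le> ennreal (?V * ?B)"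
      by (rule ennreal_leI)
    moreover have "slice_vol n {v. d \<le> \<bar>v\<bar>} \<le> ennreal (2 * exp (real n * (s - t * d + emp_pressure p n (a n) t s - ?l)))"
      using emeasure_tail_le[OF p elim(4) s t] by (simp add: slice_vol_def)
    moreover have "ennreal (?V * ?B) \<le> slice_vol n UNIV * ennreal ?B"
      using elim(3) by (simp add: ennreal_mult mult_right_mono)
    ultimately have "slice_vol n {v. d \<le> \<bar>v\<bar>} \<le> slice_vol n UNIV * ennreal ?B" by (meson order_trans)
    moreover have "0 < slice_vol n UNIV" by (rule less_le_trans[OF _ elim(3)]) simp
    ultimately show ?case unfolding event_prob_eq[OF elim(4) S] by (intro divide_le_posI_ennreal)
  qed
qed

lemma event_prob_lower:
  assumes s: "0 < s" and min: "\<And>t' s'. 0 < s' \<Longrightarrow> objective p w t s \<le> objective p w t' s'"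
    and \<rho>: "0 < \<rho>" and \<epsilon>: "0 < \<epsilon>"
  shows "\<forall>\<^sub>F n in sequentially. ennreal (exp (real n * (objective p w t s - base_value p - \<epsilon>))) \<le> event_prob n (ball w \<rho>)"
proof -
  \<comment> \<open>One half for the slice in the numerator, one for the factor 2 in the bound on
    the denominator.\<close>
  define e where "e = \<epsilon> / 2"
  have e: "0 < e" using \<epsilon> by (simp add: e_def)
  have "\<forall>\<^sub>F n in sequentially. ennreal (exp (real n * (objective p w t s - (1 / p) * ln (real n) - e))) \<le> slice_vol n (ball w \<rho>)"
    by (rule slice_vol_lower[OF s _ \<rho> e]) (rule min)
  then show ?thesis
    using eventually_exp_small[OF e] slice_vol_UNIV_lower[OF e] eventually_ge_at_top[of 1]
  proof eventually_elim
    case (elim n)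
    let ?l = "(1 / p) * ln (real n)"
    let ?B = "exp (real n * (objective p w t s - base_value p - \<epsilon>))"
    have V: "0 < slice_vol n UNIV" by (rule less_le_trans[OF _ elim(3)]) simp
    have up: "slice_vol n UNIV \<le> ennreal (2 * exp (real n * (base_value p - ?l)))" by (rule slice_vol_UNIV_upper[OF elim(4)])
    then have fin: "slice_vol n UNIV \<noteq> top" by (auto simp: top_unique)
    have "ennreal ?B * slice_vol n UNIV \<le> ennreal ?B * ennreal (2 * exp (real n * (base_value p - ?l)))"
      using up by (rule mult_left_mono) simp
    also have "\<dots> = ennreal (2 * (?B * exp (real n * (base_value p - ?l))))"
      by (simp add: ennreal_mult[symmetric])
    also have "\<dots> \<le> ennreal (exp (real n * e) * (?B * exp (real n * (base_value p - ?l))))"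
      using elim(2) by (intro ennreal_leI mult_right_mono) auto
    also have "exp (real n * e) * (?B * exp (real n * (base_value p - ?l))) = exp (real n * (objective p w t s - ?l - e))"
      by (simp only: exp_add[symmetric] distrib_left[symmetric]) (simp add: e_def)
    also have "ennreal \<dots> \<le> slice_vol n (ball w \<rho>)" by (rule elim(1))
    finally have "ennreal ?B * slice_vol n UNIV / slice_vol n UNIV \<le> slice_vol n (ball w \<rho>) / slice_vol n UNIV"
      by (rule divide_right_mono_ennreal)
    then show ?case
      using V fin by (simp add: event_prob_eq[OF elim(4)] mult_divide_eq_ennreal)
  qed
qed

section \<open>Bounds on the logarithmic scale\<close>

lemma scaled_ln_ennreal_exp: "1 \<le> n \<Longrightarrow> ereal (1 / real n) * ln_ennreal (ennreal (exp (real n * x))) = ereal x"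
  by (simp only: ln_ennreal_ennreal_exp times_ereal.simps) simp

lemma scaled_ln_ennreal_mono: "x \<le> y \<Longrightarrow> ereal (1 / real n) * ln_ennreal x \<le> ereal (1 / real n) * ln_ennreal y"
  by (intro ereal_mult_left_mono ln_ennreal_mono) auto

text \<open>A closed set is enclosed in the two-sided tail starting at the modulus of its point f
  nearest to 0. Since the rate increases with the modulus, it is minimal on the set at f, so nothing
  is lost.\<close>

lemma limsup_event_prob:
  assumes F: "closed F"
  shows "limsup (\<lambda>n. ereal (1 / real n) * ln_ennreal (event_prob n F)) \<le> - (INF x\<in>F. rate p x)"
proof (cases "F = {}")
  case True
  have "\<forall>\<^sub>F n in sequentially. ereal (1 / real n) * ln_ennreal (event_prob n F) \<le> - \<infinity>"
    using eventually_ge_at_top[of 1] by eventually_elim (simp add: True event_prob_def ln_ennreal_def)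
  then have "limsup (\<lambda>n. ereal (1 / real n) * ln_ennreal (event_prob n F)) \<le> - \<infinity>" by (rule Limsup_bounded)
  then show ?thesis by simp
next
  case False
  let ?L = "limsup (\<lambda>n. ereal (1 / real n) * ln_ennreal (event_prob n F))"
  obtain f where f: "f \<in> F" "\<And>y. y \<in> F \<Longrightarrow> \<bar>f\<bar> \<le> \<bar>y\<bar>"
    using distance_attains_inf[OF F False, of 0] by (auto simp: dist_real_def)
  have L: "?L \<le> ereal (objective p \<bar>f\<bar> t s - base_value p)" if "0 \<le> t" "0 < s" for t s
  proof (rule ereal_le_epsilon2)
    fix \<epsilon> :: real assume \<epsilon>: "0 < \<epsilon>"
    have "\<forall>\<^sub>F n in sequentially. ereal (1 / real n) * ln_ennreal (event_prob n F) \<le> ereal (objective p \<bar>f\<bar> t s - base_value p + \<epsilon>)"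
      using event_prob_upper[OF that \<epsilon>, of "\<bar>f\<bar>"] eventually_ge_at_top[of 1]
    proof eventually_elim
      case (elim n)
      have "event_prob n F \<le> event_prob n {v. \<bar>f\<bar> \<le> \<bar>v\<bar>}" using f(2) elim(2) by (intro event_prob_mono) auto
      also note elim(1)
      finally show ?case using scaled_ln_ennreal_mono[of "event_prob n F" _ n]
        by (simp only: scaled_ln_ennreal_exp[OF elim(2), symmetric, of "objective p \<bar>f\<bar> t s - base_value p + \<epsilon>"])
    qed
    then have "?L \<le> ereal (objective p \<bar>f\<bar> t s - base_value p + \<epsilon>)" by (rule Limsup_bounded)
    then show "?L \<le> ereal (objective p \<bar>f\<bar> t s - base_value p) + ereal \<epsilon>" by simp
  qed
  have "rate p \<bar>f\<bar> \<le> - ?L"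
  proof (rule rate_least[OF p])
    fix t s :: real assume s: "0 < s"
    \<comment> \<open>The Chernoff bound needs t \<ge> 0; at a nonnegative point \<bar>t\<bar> does
      at least as well as t.\<close>
    have "objective p \<bar>f\<bar> \<bar>t\<bar> s \<le> objective p \<bar>f\<bar> t s"
    proof -
      have "t * \<bar>f\<bar> \<le> \<bar>t\<bar> * \<bar>f\<bar>" by (intro mult_right_mono) auto
      moreover have "pressure p \<bar>t\<bar> s = pressure p t s" by (auto simp: abs_if pressure_minus[OF p])
      ultimately show ?thesis by (simp add: objective_def)
    qed
    then have "ereal (base_value p - objective p \<bar>f\<bar> t s) \<le> - ereal (objective p \<bar>f\<bar> \<bar>t\<bar> s - base_value p)" by simp
    also have "\<dots> \<le> - ?L" using L[of "\<bar>t\<bar>" s] s by (simp only: ereal_minus_le_minus)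
    finally show "ereal (base_value p - objective p \<bar>f\<bar> t s) \<le> - ?L" .
  qed
  moreover have "rate p f \<le> rate p \<bar>f\<bar>" by (rule rate_mono[OF p]) simp
  moreover have "(INF x\<in>F. rate p x) \<le> rate p f" using f(1) by (rule INF_lower)
  ultimately have "(INF x\<in>F. rate p x) \<le> - ?L" by (meson order_trans)
  then have "- (- ?L) \<le> - (INF x\<in>F. rate p x)" by (simp only: ereal_minus_le_minus)
  then show ?thesis by simp
qed

text \<open>Tilting works where a minimiser exists. At a nonzero point of finite rate this may fail,
  so w is moved to w (1 - \<eta>), still inside G, where \<open>objective_minimizer\<close> applies
  with w as the larger point.\<close>

lemma liminf_event_prob:
  assumes G: "open G"
  shows "- (INF x\<in>G. rate p x) \<le> liminf (\<lambda>n. ereal (1 / real n) * ln_ennreal (event_prob n G))"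
proof -
  let ?L = "liminf (\<lambda>n. ereal (1 / real n) * ln_ennreal (event_prob n G))"
  have low: "- rate p w \<le> ?L" if w: "w \<in> G" and s: "0 < s"
    and min: "\<And>t' s'. 0 < s' \<Longrightarrow> objective p w t s \<le> objective p w t' s'" for w t s
  proof (rule ereal_le_epsilon2)
    fix \<epsilon> :: real assume \<epsilon>: "0 < \<epsilon>"
    obtain \<rho> where \<rho>: "0 < \<rho>" "ball w \<rho> \<subseteq> G" using G w by (meson open_contains_ball)
    have "\<forall>\<^sub>F n in sequentially. ennreal (exp (real n * (objective p w t s - base_value p - \<epsilon>))) \<le> event_prob n (ball w \<rho>)"
      by (rule event_prob_lower[OF s _ \<rho>(1) \<epsilon>]) (rule min)
    then have "\<forall>\<^sub>F n in sequentially. ereal (objective p w t s - base_value p - \<epsilon>) \<le> ereal (1 / real n) * ln_ennreal (event_prob n G)"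
      using eventually_ge_at_top[of 1]
    proof eventually_elim
      case (elim n)
      have "event_prob n (ball w \<rho>) \<le> event_prob n G" using elim(2) \<rho>(2) G by (intro event_prob_mono) auto
      with elim(1) have "ennreal (exp (real n * (objective p w t s - base_value p - \<epsilon>))) \<le> event_prob n G" by (rule order_trans)
      then show ?case using scaled_ln_ennreal_mono[of _ "event_prob n G" n]
        by (simp only: scaled_ln_ennreal_exp[OF elim(2), symmetric, of "objective p w t s - base_value p - \<epsilon>"])
    qed
    then have L: "ereal (objective p w t s - base_value p - \<epsilon>) \<le> ?L" by (rule Liminf_bounded)
    have "- rate p w \<le> - ereal (base_value p - objective p w t s)"
      using rate_upper[OF p s, of w t] by (simp only: ereal_minus_le_minus)
    also have "\<dots> = ereal (objective p w t s - base_value p - \<epsilon>) + ereal \<epsilon>" by simp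
    also have "\<dots> \<le> ?L + ereal \<epsilon>" using L by (rule add_right_mono)
    finally show "- rate p w \<le> ?L + ereal \<epsilon>" .
  qed
  have "- ?L \<le> rate p w" if w: "w \<in> G" for w
  proof (cases "rate p w = \<infinity>")
    case False
    then have fin: "rate p w < \<infinity>" by simp
    have "- rate p w \<le> ?L"
    proof (cases "w = 0")
      case True
      show ?thesis
      proof (rule low[OF w])
        show "0 < 1 / p" using p by simp
        show "objective p w 0 (1 / p) \<le> objective p w t' s'" if "0 < s'" for t' s'
          using objective_0[OF p that] objective_base[OF p] True by simp
      qed
    next
      case False
      have "((\<lambda>\<eta>. w * (1 - \<eta>)) \<longlongrightarrow> w * (1 - 0)) (at_right 0)" by (intro tendsto_intros)
      then have "\<forall>\<^sub>F \<eta> in at_right 0. w * (1 - \<eta>) \<in> G" using G w by (intro topological_tendstoD) auto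
      moreover have "\<forall>\<^sub>F \<eta> in at_right 0. \<eta> < (1::real)" by (rule eventually_at_right_real[THEN eventually_mono]) auto
      moreover have "\<forall>\<^sub>F \<eta> in at_right 0. (0::real) < \<eta>" by (simp add: eventually_at_right_less)
      ultimately have "\<forall>\<^sub>F \<eta> in at_right 0. w * (1 - \<eta>) \<in> G \<and> \<eta> < 1 \<and> 0 < \<eta>" by eventually_elim simp
      then obtain \<eta> where \<eta>: "w * (1 - \<eta>) \<in> G" "\<eta> < 1" "0 < \<eta>"
        using eventually_happens'[OF trivial_limit_at_right_real] by blast
      let ?v = "w * (1 - \<eta>)"
      have v: "\<bar>?v\<bar> < \<bar>w\<bar>" using False \<eta> by (simp add: abs_mult)
      obtain t s where ts: "0 < s" "\<And>t' s'. 0 < s' \<Longrightarrow> objective p ?v t s \<le> objective p ?v t' s'"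
        using objective_minimizer[OF v fin] by blast
      have "- rate p ?v \<le> ?L" by (rule low[OF \<eta>(1) ts(1)]) (rule ts(2))
      have "rate p ?v \<le> rate p w" using v by (intro rate_mono[OF p]) simp
      then have "- rate p w \<le> - rate p ?v" by (simp only: ereal_minus_le_minus)
      also note \<open>- rate p ?v \<le> ?L\<close>
      finally show ?thesis .
    qed
    then show ?thesis by (simp add: ereal_uminus_le_reorder)
  qed simp
  then have "- ?L \<le> (INF x\<in>G. rate p x)" by (rule INF_greatest)
  then show ?thesis by (simp add: ereal_uminus_le_reorder)
qed

lemma satisfies_LDP_rate: "satisfies_LDP P (W p X a) (\<lambda>n. real n) (rate p)"
  unfolding satisfies_LDP_def lower_semicontinuous_def
proof (intro conjI ballI allI)
  show "0 \<le> rate p x" for x by (rule rate_nonneg[OF p])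
  show "closed {x. rate p x \<le> c}" for c by (rule closed_rate_sublevel[OF p])
  fix \<Gamma> :: "real set"
  show "- (INF x\<in>interior \<Gamma>. rate p x) \<le> liminf (\<lambda>n. ereal (1 / real n) *
      ln_ennreal (emeasure (P n) (W p X a n -` interior \<Gamma> \<inter> space (P n))))"
    using liminf_event_prob[of "interior \<Gamma>"] by (simp add: event_prob_def)
  show "limsup (\<lambda>n. ereal (1 / real n) * ln_ennreal (emeasure (P n) (W p X a n -` closure \<Gamma> \<inter> space (P n))))
      \<le> - (INF x\<in>closure \<Gamma>. rate p x)"
    using limsup_event_prob[of "closure \<Gamma>"] by (simp add: event_prob_def)
  \<comment> \<open>Comparison of the two probabilities needs measurability of \<open>W\<close>,
    which is available only from n = 1 on.\<close>
  have "\<forall>\<^sub>F n in sequentially. ereal (1 / real n) * ln_ennreal (event_prob n (interior \<Gamma>))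
      \<le> ereal (1 / real n) * ln_ennreal (event_prob n (closure \<Gamma>))"
    using eventually_ge_at_top[of 1]
  proof eventually_elim
    case (elim n)
    have "interior \<Gamma> \<subseteq> closure \<Gamma>" using interior_subset closure_subset by blast
    then show ?case using elim by (intro scaled_ln_ennreal_mono event_prob_mono) auto
  qed
  then have "limsup (\<lambda>n. ereal (1 / real n) * ln_ennreal (event_prob n (interior \<Gamma>)))
      \<le> limsup (\<lambda>n. ereal (1 / real n) * ln_ennreal (event_prob n (closure \<Gamma>)))" by (rule Limsup_mono)
  with Liminf_le_Limsup[OF sequentially_bot]
  have "liminf (\<lambda>n. ereal (1 / real n) * ln_ennreal (event_prob n (interior \<Gamma>)))
      \<le> limsup (\<lambda>n. ereal (1 / real n) * ln_ennreal (event_prob n (closure \<Gamma>)))" by (rule order_trans)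
  then show "liminf (\<lambda>n. ereal (1 / real n) * ln_ennreal (emeasure (P n) (W p X a n -` interior \<Gamma> \<inter> space (P n))))
      \<le> limsup (\<lambda>n. ereal (1 / real n) * ln_ennreal (emeasure (P n) (W p X a n -` closure \<Gamma> \<inter> space (P n))))"
    by (simp add: event_prob_def)
qed

end

end

theorem theorem2p5:
  fixes p :: real
    and \<sigma> :: "(nat \<Rightarrow> nat \<Rightarrow> real) measure"
    and P :: "nat \<Rightarrow> 'a measure"
    and X :: "nat \<Rightarrow> 'a \<Rightarrow> nat \<Rightarrow> real"
  assumes "1 < p"
    and "prob_space \<sigma>"
    and "sets \<sigma> = sets (borel_of sphere_product)"
    and "\<And>n. n \<ge> 1 \<Longrightarrow>
           rotation_invariant_prob n (distr \<sigma> (borel_of (nsphere (n - 1))) (\<lambda>\<theta>. \<theta> n))"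
    and "\<And>n. n \<ge> 1 \<Longrightarrow> prob_space (P n)"
    and "\<And>n. n \<ge> 1 \<Longrightarrow> uniform_on_lp_ball (P n) n p (X n)"
  shows "(AE \<theta> in \<sigma>. satisfies_LDP P (W p X \<theta>) (\<lambda>n. real n) (I_qu p (mu 2)))
         \<and> quasiconvex (I_qu p (mu 2))
         \<and> symmetric_fun (I_qu p (mu 2))
         \<and> good_rate_function (I_qu p (mu 2))"
proof -
  note p = \<open>1 < p\<close>
  have I: "I_qu p (mu 2) = rate p" using I_qu_eq_rate[OF p] by (rule ext)
  have "AE \<theta> in \<sigma>. \<forall>x. (\<lambda>n. emp_log_mgf p n (\<theta> n) x) \<longlonglongrightarrow> avg_log_mgf p x"
    by (rule AE_emp_log_mgf_tendsto[OF p assms(2-4)])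
  then have "AE \<theta> in \<sigma>. satisfies_LDP P (W p X \<theta>) (\<lambda>n. real n) (rate p)"
    by (rule AE_mp) (auto intro!: AE_I2 satisfies_LDP_rate[OF p] assms)
  moreover have "quasiconvex (rate p)"
    unfolding quasiconvex_def using rate_nonneg[OF p] convex_rate_sublevel[OF p] by force
  moreover have "symmetric_fun (rate p)"
    unfolding symmetric_fun_def using rate_minus[OF p] by simp
  moreover have "good_rate_function (rate p)"
    unfolding good_rate_function_def using compact_rate_sublevel[OF p] by simp
  ultimately show ?thesis unfolding I by blast
qed

end
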